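(* Let $n\geq 1$. A map $\operatorname{z}\colon \operatorname{Conv}(\mathbb{R}^n;\mathbb{R})\to\mathbb{R}^n$ is a continuous, dually translation covariant, vertically translation invariant, dually simple valuation if and only if there exist functions $\psi\in C_c(\mathbb{R}^n;\mathbb{R}^n)$ and $\zeta\in C_c(\mathbb{R}^n)$ such that \[ \operatorname{z}(v)=\int_{\mathbb{R}^n}\psi(x)\,\mathrm{d}\operatorname{MA}(v;x) + \int_{\mathbb{R}^n\times\mathbb{R}^n}\zeta(x)\, y\,\mathrm{d}\Theta_0(v;(x,y)) \] for every $v\in\operatorname{Conv}(\mathbb{R}^n;\mathbb{R})$.
   Context: $\operatorname{Conv}(\mathbb{R}^n;\mathbb{R})$ is the space of all convex functions $v\colon\mathbb{R}^n\to\mathbb{R}$ (finite-valued), equipped with the topology of epi-convergence, which on this space coincides with pointwise convergence; continuity refers to this topology. A map $\operatorname{Z}$ on $\operatorname{Conv}(\mathbb{R}^n;\mathbb{R})$ with values in an Abelian semigroup is a valuation if $\operatorname{Z}(v\vee w)+\operatorname{Z}(v\wedge w)=\operatorname{Z}(v)+\operatorname{Z}(w)$ whenever $v,w$ and their pointwise maximum $v\vee w$ and pointwise minimum $v\wedge w$ lie in the space. A map $\operatorname{z}\colon\operatorname{Conv}(\mathbb{R}^n;\mathbb{R})\to\mathbb{R}^n$ is dually translation covariant if there is a map $\operatorname{z}^0\colon\operatorname{Conv}(\mathbb{R}^n;\mathbb{R})\to\mathbb{R}$ with $\operatorname{z}(v+\langle x,\cdot\rangle)=\operatorname{z}(v)+\operatorname{z}^0(v)\,x$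 for all $v$ and $x\in\mathbb{R}^n$. It is vertically translation invariant if $\operatorname{z}(v+c)=\operatorname{z}(v)$ for all $v$ and $c\in\mathbb{R}$. It is dually simple if $\operatorname{z}(v)=0$ whenever $v$, up to addition of a linear functional, depends on fewer than $n$ variables, i.e. there exist a linear functional $\ell$ and a proper linear subspace $E\subsetneq\mathbb{R}^n$ with orthogonal projection $P_E$ such that $(v-\ell)(x)=(v-\ell)(P_E x)$ for all $x$. $C_c(\mathbb{R}^n)$, $C_c(\mathbb{R}^n;\mathbb{R}^n)$ denote continuous compactly supported functions $\mathbb{R}^n\to\mathbb{R}$, resp. $\mathbb{R}^n\to\mathbb{R}^n$. $\operatorname{MA}(v;\cdot)$ is the Monge–Ampère measure of $v$ (for $v\in C^2$, $\mathrm{d}\operatorname{MA}(v;x)=\det(\operatorname{Hess}v(x))\,\mathrm{d}x$, and $v\mapsto\operatorname{MA}(v;\cdot)$ is weakly continuous). The Hessian measure $\Theta_0(v;\cdot)$ is the unique Borel measure on $\mathbb{R}^n\times\mathbb{R}^n$ such that $v\mapsto\Theta_0(v;\cdot)$ is weakly continuous and $\int\eta(x,y)\,\mathrm{d}\Theta_0(v;(x,y))=\int_{\mathbb{R}^n}\eta(x,\nabla v(x))\det(\operatorname{Hess}v(x))\,\mathrm{d}x$ for $v\in C^2(\mathbb{R}^n)$ convex and continuous $\eta$ with compact support in the first variable; such integrals are well defined for all $v$, and $\operatorname{MA}(v;B)=\Theta_0(v;B\times\mathbb{R}^n)$. *)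

theory Defs
  imports "HOL-Analysis.Analysis"
begin

definition Conv :: "(real^'n \<Rightarrow> real) set" where
  "Conv = {v. convex_on UNIV v}"

definition subgrad :: "(real^'n \<Rightarrow> real) \<Rightarrow> real^'n \<Rightarrow> (real^'n) set" where
  "subgrad v x = {y. \<forall>z. v z \<ge> v x + y \<bullet> (z - x)}"

definition MA :: "(real^'n \<Rightarrow> real) \<Rightarrow> (real^'n) measure" where
  "MA v = measure_of UNIV (sets borel)
     (\<lambda>B. emeasure lebesgue (\<Union>x\<in>B. subgrad v x))"

definition Theta0 :: "(real^'n \<Rightarrow> real) \<Rightarrow> ((real^'n) \<times> (real^'n)) measure" where
  "Theta0 v = measure_of UNIV (sets borel)
     (\<lambda>A. emeasure lebesgue {y. \<exists>x. (x, y) \<in> A \<and> y \<in> subgrad v x})"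

definition Cc :: "('a::topological_space \<Rightarrow> 'b::real_normed_vector) set" where
  "Cc = {f. continuous_on UNIV f \<and> (\<exists>K. compact K \<and> (\<forall>x. x \<notin> K \<longrightarrow> f x = 0))}"

definition proj_onto :: "(real^'n) set \<Rightarrow> real^'n \<Rightarrow> real^'n" where
  "proj_onto E x = (THE p. p \<in> E \<and> (\<forall>e\<in>E. (x - p) \<bullet> e = 0))"

definition is_valuation :: "((real^'n \<Rightarrow> real) \<Rightarrow> 'a::ab_semigroup_add) \<Rightarrow> bool" where
  "is_valuation Z \<longleftrightarrow> (\<forall>v\<in>Conv. \<forall>w\<in>Conv.
      (\<lambda>x. max (v x) (w x)) \<in> Conv \<longrightarrow> (\<lambda>x. min (v x) (w x)) \<in> Conv \<longrightarrow>
      Z (\<lambda>x. max (v x) (w x)) + Z (\<lambda>x. min (v x) (w x)) = Z v + Z w)"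

definition dually_translation_covariant :: "((real^'n \<Rightarrow> real) \<Rightarrow> real^'n) \<Rightarrow> bool" where
  "dually_translation_covariant z \<longleftrightarrow> (\<exists>z0 :: (real^'n \<Rightarrow> real) \<Rightarrow> real.
      \<forall>v\<in>Conv. \<forall>x. z (\<lambda>y. v y + x \<bullet> y) = z v + z0 v *\<^sub>R x)"

definition vertically_translation_invariant :: "((real^'n \<Rightarrow> real) \<Rightarrow> 'a) \<Rightarrow> bool" where
  "vertically_translation_invariant z \<longleftrightarrow> (\<forall>v\<in>Conv. \<forall>c::real. z (\<lambda>y. v y + c) = z v)"

definition dually_simple :: "((real^'n \<Rightarrow> real) \<Rightarrow> real^'n) \<Rightarrow> bool" where
  "dually_simple z \<longleftrightarrow> (\<forall>v\<in>Conv.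
      (\<exists>(l :: real^'n \<Rightarrow> real) E. linear l \<and> subspace E \<and> E \<noteq> UNIV \<and>
          (\<forall>x. v x - l x = v (proj_onto E x) - l (proj_onto E x)))
      \<longrightarrow> z v = 0)"

end

theory Submission
  imports Defs "HOL-Probability.Distributions" "HOL-Real_Asymp.Real_Asymp"
begin

text \<open>
  The covariance factor \<open>z0\<close> of \<open>z\<close> is a real-valued dually simple valuation that is invariant under
  adding affine functions. Once it is known to be of the form \<open>\<integral>\<zeta> dMA\<close>, the components of
  \<open>z - \<integral>\<zeta>(x) y d\<Theta>0\<close> are valuations of the same kind, so it suffices to represent such a
  real-valued valuation \<open>Z\<close>.

  Write \<open>l+\<close> for the positive part of an affine function \<open>l\<close>. The valuation identity shows that
  \<open>Z (v + s l+)\<close> is affine in \<open>s \<ge> 0\<close>, and that \<open>Z (v + l+) - Z v\<close> depends only on the restriction of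
  \<open>v\<close> to the hyperplane \<open>l = 0\<close>. Hence the values of \<open>Z\<close> on finite sums of such kinks are determined
  by the values \<open>\<zeta> p\<close> on the functions \<open>\<Sum>i. max 0 (x $ i - p $ i)\<close>, and \<open>\<zeta>\<close> is the density. After
  subtracting \<open>\<integral>\<zeta> dMA\<close> one may assume \<open>\<zeta> = 0\<close>; then \<open>Z\<close> vanishes on pointwise limits of sums of
  convex ridge functions \<open>h (x \<bullet> a)\<close>. Such limits need not be dense, but \<open>Z (w + \<Sum>i. s i * (x $ i)^2)\<close> is
  affine in each \<open>s i \<ge> 0\<close>, so \<open>Z w = 0\<close> as soon as \<open>w + \<Sum>i. s i * (x $ i)^2\<close> is such a limit for all
  large \<open>s i\<close>. This holds for the Gaussian mollification \<open>w\<close> of a convex function that is a multiple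
  of the \<open>l1\<close>-norm up to a constant outside a compact set, because the Gaussian is a limit of
  products of cosines, which are averages of cosines of linear functions. These \<open>w\<close> are dense.

  For the converse, \<open>\<Theta>0\<close> is the image of Lebesgue measure under \<open>y \<mapsto> (x(y), y)\<close>, where \<open>x(y)\<close> is the
  almost everywhere unique point whose subdifferential contains \<open>y\<close>, and every property can be
  checked for fixed \<open>y\<close>.
\<close>

section \<open>Finite convex functions\<close>

text \<open>Continuity refers to the product topology, so a neighbourhood of a convex function tests
  only finitely many points, and every density argument amounts to matching a function on a finite
  set. The obstacle is that \<open>Z\<close> is not additive: a mollified function becomes a limit
  of ridge sums only after a large quadratic is added, and no general rule subtracts that quadratic
  again. Affinity along each coordinate square is the substitute, since an affine function of
  \<open>s i\<close> that vanishes for all large values vanishes at 0 as well. Squares suit this for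
  two reasons. They are ridge functions themselves, and the correction needed by a product of
  cosines is half the sum of the squared arguments; for the products approximating a Gaussian this
  sum does not depend on the number of factors, so it survives the limit. The l1-norm is the
  prescribed growth because it is a sum of functions of one coordinate, which mollification
  respects. Only the compactly supported remainder has to be spread over Gaussians, and its total
  mass bounds the quadratic that is required.\<close>

lemma ConvI:
  assumes "\<And>x y t. 0 < t \<Longrightarrow> t < 1 \<Longrightarrow> v ((1 - t) *\<^sub>R x + t *\<^sub>R y) \<le> (1 - t) * v x + t * v y"
  shows "v \<in> Conv"
  unfolding Conv_def using assms by (auto intro!: convex_onI)

lemma ConvD:
  assumes "v \<in> Conv" "0 \<le> t" "t \<le> 1"
  shows "v ((1 - t) *\<^sub>R x + t *\<^sub>R y) \<le> (1 - t) * v x + t * v y"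
  using assms unfolding Conv_def by (auto dest: convex_onD)

lemma Conv_add: "v \<in> Conv \<Longrightarrow> w \<in> Conv \<Longrightarrow> (\<lambda>x. v x + w x) \<in> Conv"
  unfolding Conv_def by (auto intro: convex_on_add)

lemma Conv_scale: "v \<in> Conv \<Longrightarrow> 0 \<le> c \<Longrightarrow> (\<lambda>x. c * v x) \<in> Conv"
  unfolding Conv_def by (auto intro: convex_on_cmul)

lemma Conv_max:
  fixes v w :: "real^'n \<Rightarrow> real"
  assumes "v \<in> Conv" "w \<in> Conv"
  shows "(\<lambda>x. max (v x) (w x)) \<in> Conv"
proof (rule ConvI)
  fix x y :: "real^'n" and t :: real
  assume t: "0 < t" "t < 1"
  have "v ((1 - t) *\<^sub>R x + t *\<^sub>R y) \<le> (1 - t) * v x + t * v y"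
    and "w ((1 - t) *\<^sub>R x + t *\<^sub>R y) \<le> (1 - t) * w x + t * w y"
    using assms t by (auto intro!: ConvD)
  moreover have "(1 - t) * v x \<le> (1 - t) * max (v x) (w x)" "(1 - t) * w x \<le> (1 - t) * max (v x) (w x)"
    "t * v y \<le> t * max (v y) (w y)" "t * w y \<le> t * max (v y) (w y)"
    using t by (auto intro!: mult_left_mono)
  ultimately show "max (v ((1 - t) *\<^sub>R x + t *\<^sub>R y)) (w ((1 - t) *\<^sub>R x + t *\<^sub>R y))
      \<le> (1 - t) * max (v x) (w x) + t * max (v y) (w y)"
    by linarith
qed

lemma Conv_ridge:
  fixes h :: "real \<Rightarrow> real" and a :: "real^'n"
  assumes "convex_on UNIV h"
  shows "(\<lambda>x. h (x \<bullet> a)) \<in> Conv"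
proof (rule ConvI)
  fix x y :: "real^'n" and t :: real
  assume t: "0 < t" "t < 1"
  show "h (((1 - t) *\<^sub>R x + t *\<^sub>R y) \<bullet> a) \<le> (1 - t) * h (x \<bullet> a) + t * h (y \<bullet> a)"
    using convex_onD[OF assms, of t "x \<bullet> a" "y \<bullet> a"] t by (simp add: inner_add_left)
qed

lemma Conv_affine: "(\<lambda>x. x \<bullet> a + b) \<in> Conv"
  by (rule ConvI) (simp add: inner_add_left algebra_simps)

lemma Conv_const: "(\<lambda>x. b) \<in> Conv"
  by (rule ConvI) (simp add: algebra_simps)

lemma Conv_sum:
  "finite I \<Longrightarrow> (\<And>i. i \<in> I \<Longrightarrow> f i \<in> Conv) \<Longrightarrow> (\<lambda>x. \<Sum>i\<in>I. f i x) \<in> Conv"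
  by (induction I rule: finite_induct) (auto intro: Conv_add Conv_const)

lemma Conv_comp_affine:
  fixes v :: "real^'n \<Rightarrow> real" and T :: "real^'m \<Rightarrow> real^'n"
  assumes "v \<in> Conv" "linear T"
  shows "(\<lambda>x. v (T x + c)) \<in> Conv"
proof (rule ConvI)
  interpret linear T by fact
  fix x y :: "real^'m" and t :: real
  assume t: "0 < t" "t < 1"
  have "T ((1 - t) *\<^sub>R x + t *\<^sub>R y) + c = (1 - t) *\<^sub>R (T x + c) + t *\<^sub>R (T y + c)"
    by (simp only: add scale) (simp add: algebra_simps)
  then show "v (T ((1 - t) *\<^sub>R x + t *\<^sub>R y) + c) \<le> (1 - t) * v (T x + c) + t * v (T y + c)"
    using ConvD[OF assms(1)] t by simp
qed

lemma Conv_translate: "v \<in> Conv \<Longrightarrow> (\<lambda>x. v (x - c)) \<in> Conv"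
  using Conv_comp_affine[of v "\<lambda>x. x" "- c"] by (simp add: linear_ident)

lemma Conv_continuous: "v \<in> Conv \<Longrightarrow> continuous_on S v"
  unfolding Conv_def using convex_on_continuous[of UNIV v] continuous_on_subset by blast

lemma subgradD: "y \<in> subgrad v x \<Longrightarrow> v x + y \<bullet> (z - x) \<le> v z"
  by (simp add: subgrad_def)

text \<open>Separation of \<open>(x, v x)\<close> from the strict epigraph: the separating normal,
  divided by its last component, is the subgradient up to sign.\<close>

lemma subgrad_exists:
  fixes v :: "real^'n \<Rightarrow> real"
  assumes "v \<in> Conv"
  obtains y where "y \<in> subgrad v x"
proof -
  let ?S = "{p :: (real^'n) \<times> real. v (fst p) < snd p}"
  have "convex ?S"
    unfolding convex_alt
  proof (intro ballI allI impI)
    fix p q u assume pq: "p \<in> ?S" "q \<in> ?S" and u: "0 \<le> u \<and> u \<le> (1::real)"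
    have *: "v ((1 - u) *\<^sub>R fst p + u *\<^sub>R fst q) \<le> (1 - u) * v (fst p) + u * v (fst q)"
      using ConvD assms u by blast
    have "(1 - u) * v (fst p) + u * v (fst q) < (1 - u) * snd p + u * snd q"
    proof (cases "u = 0")
      case False
      then have "u * v (fst q) < u * snd q" using u pq by simp
      moreover have "(1 - u) * v (fst p) \<le> (1 - u) * snd p"
        using u pq by (intro mult_left_mono) auto
      ultimately show ?thesis by linarith
    qed (use pq in auto)
    with * show "(1 - u) *\<^sub>R p + u *\<^sub>R q \<in> ?S" by simp
  qed
  moreover have "?S \<noteq> {}"
    using gt_ex[of "v 0"] by auto
  ultimately obtain w b where w: "w \<noteq> 0" "\<forall>p\<in>?S. b \<le> w \<bullet> p" "w \<bullet> (x, v x) \<le> b"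
    using separating_hyperplane_sets[of "{(x, v x)}" ?S] by auto
  obtain a c where wac: "w = (a, c)" by (cases w)
  have ineq: "a \<bullet> x + c * v x \<le> a \<bullet> z + c * t" if "v z < t" for z t
    using w(2,3) that wac by (force simp: inner_prod_def)
  have "c \<ge> 0" using ineq[of x "v x + 1"] by (simp add: algebra_simps)
  \<comment> \<open>A vertical hyperplane cannot separate, because \<open>v\<close> is finite
    everywhere: the point \<open>x - a\<close> lies on its wrong side.\<close>
  moreover have "c \<noteq> 0"
  proof
    assume "c = 0"
    then have "a \<bullet> x \<le> a \<bullet> (x - a)" using ineq[of "x - a" "v (x - a) + 1"] by simp
    then have "a = 0" by (simp add: inner_diff_right) (metis inner_gt_zero_iff not_le)
    with \<open>c = 0\<close> w(1) wac show False by (simp add: zero_prod_def)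
  qed
  ultimately have c: "c > 0" by simp
  have "v x + (- (1/c) *\<^sub>R a) \<bullet> (z - x) \<le> v z" for z
  proof (rule field_le_epsilon)
    fix e :: real assume "e > 0"
    then have "a \<bullet> x + c * v x \<le> a \<bullet> z + c * (v z + e)" by (intro ineq) simp
    then have "c * (v x + (- (1/c) *\<^sub>R a) \<bullet> (z - x)) \<le> c * (v z + e)"
      using c by (simp add: algebra_simps inner_diff_right)
    then show "v x + (- (1/c) *\<^sub>R a) \<bullet> (z - x) \<le> v z + e" using c by simp
  qed
  then have "- (1/c) *\<^sub>R a \<in> subgrad v x" by (simp add: subgrad_def)
  then show ?thesis by (rule that)
qed

text \<open>The maximum of the supporting affine functions at the points of \<open>X\<close> is
  Lipschitz. The induction carries \<open>w x \<le> v x\<close>, so that a new affine piece never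
  spoils values already attained.\<close>

lemma Conv_interpolate_Lipschitz:
  fixes v :: "real^'n \<Rightarrow> real"
  assumes v: "v \<in> Conv" and X: "finite X"
  obtains w L where "w \<in> Conv" "\<And>x. x \<in> X \<Longrightarrow> w x = v x" "L \<ge> 0"
    "\<And>x y. \<bar>w x - w y\<bar> \<le> L * norm (x - y)"
proof -
  from X have "\<exists>w L. w \<in> Conv \<and> (\<forall>x. w x \<le> v x) \<and> (\<forall>x\<in>X. w x = v x) \<and> L \<ge> 0 \<and>
      (\<forall>x y. \<bar>w x - w y\<bar> \<le> L * norm (x - y))"
  proof (induction X rule: finite_induct)
    case empty
    obtain y where y: "y \<in> subgrad v 0" using subgrad_exists[OF v] .
    have "(\<lambda>x. x \<bullet> y + v 0) \<in> Conv" by (rule Conv_affine)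
    moreover have "\<forall>x. x \<bullet> y + v 0 \<le> v x" 
      using subgradD[OF y] by (simp add: inner_commute algebra_simps)
    moreover have "\<forall>x z. \<bar>(x \<bullet> y + v 0) - (z \<bullet> y + v 0)\<bar> \<le> norm y * norm (x - z)"
      by (metis Cauchy_Schwarz_ineq2 add_diff_cancel_right inner_commute inner_diff_left)
    ultimately show ?case using norm_ge_zero[of y] by blast
  next
    case (insert p X)
    then obtain w L where w: "w \<in> Conv" "\<forall>x. w x \<le> v x" "\<forall>x\<in>X. w x = v x" "L \<ge> 0"
      "\<forall>x y. \<bar>w x - w y\<bar> \<le> L * norm (x - y)" by auto
    obtain y where y: "y \<in> subgrad v p" using subgrad_exists[OF v] .
    define u where "u = (\<lambda>x. max (w x) (x \<bullet> y + (v p - p \<bullet> y)))"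
    have le: "x \<bullet> y + (v p - p \<bullet> y) \<le> v x" for x
      using subgradD[OF y, of x] by (simp add: inner_commute algebra_simps)
    have "u \<in> Conv" unfolding u_def by (intro Conv_max w Conv_affine)
    moreover have "\<forall>x. u x \<le> v x" using w le by (simp add: u_def)
    moreover have "\<forall>x\<in>insert p X. u x = v x"
      using w le by (auto simp: u_def max_def antisym)
    moreover have "\<bar>u x - u z\<bar> \<le> max L (norm y) * norm (x - z)" for x z
    proof -
      have "\<bar>w x - w z\<bar> \<le> max L (norm y) * norm (x - z)"
        by (rule order_trans[OF w(5)[rule_format]]) (auto intro: mult_right_mono)
      moreover have "\<bar>x \<bullet> y - z \<bullet> y\<bar> \<le> norm y * norm (x - z)"
        using Cauchy_Schwarz_ineq2[of y "x - z"] by (simp add: inner_diff_right inner_commute)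
      then have "\<bar>x \<bullet> y - z \<bullet> y\<bar> \<le> max L (norm y) * norm (x - z)"
        by (rule order_trans) (auto intro: mult_right_mono)
      ultimately show ?thesis unfolding u_def by linarith
    qed
    moreover have "max L (norm y) \<ge> 0" using w by simp
    ultimately show ?case by blast
  qed
  then show ?thesis using that by blast
qed

text \<open>A basic open set of the product topology restricts finitely many coordinates; the
  smallest of their radii serves for all.\<close>

lemma continuous_on_Conv_finite:
  fixes Z :: "(real^'n \<Rightarrow> real) \<Rightarrow> 'b::metric_space"
  assumes "continuous_on Conv Z" "v \<in> Conv" "e > 0"
  shows "\<exists>X d. finite X \<and> d > 0 \<and> (\<forall>w\<in>Conv. (\<forall>x\<in>X. \<bar>w x - v x\<bar> < d) \<longrightarrow> dist (Z w) (Z v) < e)"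
proof -
  obtain U where U: "open U" "v \<in> U" and ZU: "\<And>w. w \<in> Conv \<Longrightarrow> w \<in> U \<Longrightarrow> Z w \<in> ball (Z v) e"
    using assms unfolding continuous_on_topological
    by (metis open_ball centre_in_ball)
  obtain V where V: "v \<in> (\<Pi>\<^sub>E i\<in>UNIV. V i)" "\<And>i. open (V i)" "finite {i. V i \<noteq> UNIV}"
    "(\<Pi>\<^sub>E i\<in>UNIV. V i) \<subseteq> U"
    using product_topology_open_contains_basis[of "\<lambda>i. euclidean" UNIV U v] U
    by (auto simp: open_fun_def)
  define X where "X = {i. V i \<noteq> UNIV}"
  have "\<exists>d>0. \<forall>t. \<bar>t - v x\<bar> < d \<longrightarrow> t \<in> V x" for x
  proof -
    have "v x \<in> V x" using V(1) by auto
    then show ?thesis using V(2)[of x] unfolding open_dist by (auto simp: dist_real_def)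
  qed
  then obtain d where d: "\<And>x. d x > 0" "\<And>x t. \<bar>t - v x\<bar> < d x \<Longrightarrow> t \<in> V x" by metis
  define D where "D = Min (insert 1 (d ` X))"
  have fin: "finite X" using V(3) by (simp add: X_def)
  have "D > 0" unfolding D_def using fin d(1) by (subst Min_gr_iff) auto
  moreover have "dist (Z w) (Z v) < e" if "w \<in> Conv" "\<forall>x\<in>X. \<bar>w x - v x\<bar> < D" for w
  proof -
    have "w x \<in> V x" for x
    proof (cases "x \<in> X")
      case True
      then have "D \<le> d x" unfolding D_def using fin by (intro Min_le) auto
      with that(2) True show ?thesis by (intro d(2)) force
    qed (simp add: X_def)
    then have "w \<in> U" using V(4) by auto
    with ZU[OF that(1)] show ?thesis by (simp add: dist_commute)
  qed
  ultimately show ?thesis using fin by blast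
qed

text \<open>The form in which density is used throughout: a continuous functional vanishes at
  \<open>v\<close> once it vanishes at functions close to \<open>v\<close> on each finite
  set.\<close>

lemma Conv_continuous_eq_zero:
  fixes F :: "(real^'n \<Rightarrow> real) \<Rightarrow> real"
  assumes F: "continuous_on Conv F" and v: "v \<in> Conv"
    and approx: "\<And>X e. finite X \<Longrightarrow> e > 0 \<Longrightarrow> \<exists>w\<in>Conv. (\<forall>x\<in>X. \<bar>w x - v x\<bar> < e) \<and> F w = 0"
  shows "F v = 0"
proof (rule ccontr)
  assume "F v \<noteq> 0"
  then have "\<bar>F v\<bar> > 0" by simp
  from continuous_on_Conv_finite[OF F v this] obtain X d where X: "finite X" "d > 0"
    "\<forall>w\<in>Conv. (\<forall>x\<in>X. \<bar>w x - v x\<bar> < d) \<longrightarrow> dist (F w) (F v) < \<bar>F v\<bar>" by blast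
  from approx[OF X(1,2)] obtain w where "w \<in> Conv" "\<forall>x\<in>X. \<bar>w x - v x\<bar> < d" "F w = 0" by blast
  with X(3) show False by (force simp: dist_real_def)
qed

lemma continuous_on_eval: "continuous_on S (\<lambda>u. u x)"
  by (rule continuous_on_subset[OF continuous_on_product_coordinates]) simp

section \<open>Adding a kink along a hyperplane\<close>

text \<open>Cauchy's functional equation on a half-line: additivity settles rational multiples,
  continuity the rest.\<close>

lemma additive_nonneg_linear:
  fixes f :: "real \<Rightarrow> real"
  assumes add: "\<And>p r. 0 \<le> p \<Longrightarrow> 0 \<le> r \<Longrightarrow> f (p + r) = f p + f r"
    and cont: "continuous_on {0..} f" and s: "0 \<le> s"
  shows "f s = s * f 1"
proof -
  have f0: "f 0 = 0" using add[of 0 0] by simp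
  have mult: "f (real m * x) = real m * f x" if "0 \<le> x" for m x
    by (induction m) (use that f0 add in \<open>auto simp: distrib_right\<close>)
  \<comment> \<open>Rounding down keeps the rationals nonnegative and at most \<open>s\<close>,
    inside the domain where \<open>f\<close> is controlled.\<close>
  define r where "r = (\<lambda>n::nat. real (nat \<lfloor>s * real (Suc n)\<rfloor>) / real (Suc n))"
  have fr: "f (r n) = r n * f 1" for n
  proof -
    have "real (Suc n) * f (1 / real (Suc n)) = f 1"
      using mult[of "1 / real (Suc n)" "Suc n"] by simp
    then have "f (1 / real (Suc n)) = f 1 / real (Suc n)"
      by (simp add: field_simps)
    then show ?thesis
      using mult[of "1 / real (Suc n)" "nat \<lfloor>s * real (Suc n)\<rfloor>"] by (simp add: r_def)
  qed
  have bounds: "s - 1 / real (Suc n) \<le> r n" "r n \<le> s" for n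
  proof -
    have "0 \<le> s * real (Suc n)" using s by simp
    then have "real (nat \<lfloor>s * real (Suc n)\<rfloor>) \<le> s * real (Suc n)"
      "s * real (Suc n) - 1 \<le> real (nat \<lfloor>s * real (Suc n)\<rfloor>)"
      by linarith+
    then show "s - 1 / real (Suc n) \<le> r n" "r n \<le> s" 
      unfolding r_def by (simp_all add: pos_le_divide_eq pos_divide_le_eq left_diff_distrib)
  qed
  have "r \<longlonglongrightarrow> s"
  proof (rule tendsto_sandwich)
    show "(\<lambda>n. s - 1 / real (Suc n)) \<longlonglongrightarrow> s"
      using tendsto_diff[OF tendsto_const LIMSEQ_inverse_real_of_nat, of s]
      by (simp add: inverse_eq_divide)
  qed (use bounds in auto)
  moreover have "r n \<in> {0..}" for n by (simp add: r_def)
  ultimately have "(\<lambda>n. f (r n)) \<longlonglongrightarrow> f s"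
    using cont s by (intro continuous_on_tendsto_compose[OF cont]) auto
  moreover have "(\<lambda>n. f (r n)) \<longlonglongrightarrow> s * f 1"
    unfolding fr by (intro tendsto_mult \<open>r \<longlonglongrightarrow> s\<close> tendsto_const)
  ultimately show ?thesis by (rule LIMSEQ_unique)
qed

text \<open>The pair is normal and offset. The normal is neither normalised nor required to be
  nonzero (zero gives a constant), which keeps scalings and shears of normals free of side
  conditions.\<close>

definition kink :: "(real^'n) \<times> real \<Rightarrow> real^'n \<Rightarrow> real" where
  "kink k x = max 0 (x \<bullet> fst k - snd k)"

lemma kink_Conv: "kink k \<in> Conv"
  using Conv_max[OF Conv_const[of 0] Conv_affine[of "fst k" "- snd k"]]
  by (simp add: kink_def[abs_def])

lemma Conv_kink: "v \<in> Conv \<Longrightarrow> (\<lambda>x. v x + kink k x) \<in> Conv"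
  by (intro Conv_add kink_Conv)

lemma kink_scale: "0 \<le> c \<Longrightarrow> kink (c *\<^sub>R a, c * b) x = c * kink (a, b) x"
  by (simp add: kink_def max_mult_distrib_left right_diff_distrib)

locale affine_invariant_valuation =
  fixes Z :: "(real^'n \<Rightarrow> real) \<Rightarrow> real"
  assumes continuous: "continuous_on Conv Z"
    and valuation: "is_valuation Z"
    and affine: "\<And>v a b. v \<in> Conv \<Longrightarrow> Z (\<lambda>x. v x + (x \<bullet> a + b)) = Z v"
begin

lemma max_min:
  assumes "v \<in> Conv" "w \<in> Conv" "f \<in> Conv" "g \<in> Conv"
    and "\<And>x. f x = max (v x) (w x)" "\<And>x. g x = min (v x) (w x)"
  shows "Z f + Z g = Z v + Z w"
proof -
  have "f = (\<lambda>x. max (v x) (w x))" "g = (\<lambda>x. min (v x) (w x))" using assms by auto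
  then show ?thesis using valuation assms unfolding is_valuation_def by auto
qed

lemma affine': "v \<in> Conv \<Longrightarrow> (\<And>x. w x = v x + (x \<bullet> a + b)) \<Longrightarrow> Z w = Z v"
proof -
  assume "v \<in> Conv" and "\<And>x. w x = v x + (x \<bullet> a + b)"
  moreover from this(2) have "w = (\<lambda>x. v x + (x \<bullet> a + b))" by (intro ext)
  ultimately show ?thesis using affine by simp
qed

text \<open>With \<open>l = x \<bullet> a - b\<close>, the pair \<open>v + p l+\<close> and \<open>v + p l + r l+\<close> has maximum \<open>v + (p + r) l+\<close>
  and minimum \<open>v + p l\<close>.\<close>

lemma kink_Cauchy:
  assumes v: "v \<in> Conv" and p: "0 \<le> p" and r: "0 \<le> r"
  shows "Z (\<lambda>x. v x + (p + r) * kink k x) + Z v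
       = Z (\<lambda>x. v x + p * kink k x) + Z (\<lambda>x. v x + r * kink k x)"
proof -
  define l where "l = (\<lambda>x. x \<bullet> fst k - snd k)"
  define w where "w = (\<lambda>x. (v x + r * kink k x) + (x \<bullet> (p *\<^sub>R fst k) + (- p * snd k)))"
  define u where "u = (\<lambda>x. v x + (x \<bullet> (p *\<^sub>R fst k) + (- p * snd k)))"
  have C: "(\<lambda>x. v x + s * kink k x) \<in> Conv" if "0 \<le> s" for s
    using v that by (intro Conv_add Conv_scale kink_Conv)
  have Zw: "Z w = Z (\<lambda>x. v x + r * kink k x)" unfolding w_def by (intro affine C r)
  have Zu: "Z u = Z v" unfolding u_def by (intro affine v)
  have w: "w x = v x + r * kink k x + p * l x" for x by (simp add: w_def l_def algebra_simps)
  have u: "u x = v x + p * l x" for x by (simp add: u_def l_def algebra_simps)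
  have cases: "l x \<ge> 0 \<and> kink k x = l x \<and> p * l x \<ge> 0 \<and> r * l x \<ge> 0
      \<or> l x \<le> 0 \<and> kink k x = 0 \<and> p * l x \<le> 0" for x
    using p r by (auto simp: kink_def l_def max_def mult_nonneg_nonpos)
  have "Z (\<lambda>x. v x + (p + r) * kink k x) + Z u = Z (\<lambda>x. v x + p * kink k x) + Z w"
  proof (rule max_min)
    show "w \<in> Conv" "u \<in> Conv" unfolding w_def u_def by (intro Conv_add C r Conv_affine v)+
    show "v x + (p + r) * kink k x = max (v x + p * kink k x) (w x)" 
      "u x = min (v x + p * kink k x) (w x)" for x
      using cases[of x] by (elim disjE; simp add: w u distrib_right)+
  qed (use p r C in auto)
  then show ?thesis using Zw Zu by simp
qed

lemma continuous_map:
  assumes "\<And>u. u \<in> Conv \<Longrightarrow> T u \<in> Conv" "\<And>x. continuous_on Conv (\<lambda>u. T u x)"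
  shows "continuous_on Conv (\<lambda>u. Z (T u))"
  by (rule continuous_on_compose2[OF continuous])
    (use assms in \<open>auto intro: continuous_on_coordinatewise_then_product\<close>)

lemma continuous_ray:
  assumes v: "v \<in> Conv" and k: "k \<in> Conv"
  shows "continuous_on {0..} (\<lambda>s. Z (\<lambda>x. v x + s * k x))"
proof (rule continuous_on_compose2[OF continuous])
  show "continuous_on {0..} (\<lambda>s x. v x + s * k x)"
    by (intro continuous_on_coordinatewise_then_product continuous_intros)
qed (use v k in \<open>auto intro!: Conv_add Conv_scale\<close>)

lemma kink_linear:
  assumes v: "v \<in> Conv" and s: "0 \<le> s"
  shows "Z (\<lambda>x. v x + s * kink k x) = Z v + s * (Z (\<lambda>x. v x + kink k x) - Z v)"
proof -
  define f where "f = (\<lambda>s. Z (\<lambda>x. v x + s * kink k x) - Z v)"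
  have "f s = s * f 1"
  proof (rule additive_nonneg_linear)
    show "f (p + r) = f p + f r" if "0 \<le> p" "0 \<le> r" for p r
      using kink_Cauchy[OF v that, of k] by (simp add: f_def)
    show "continuous_on {0..} f"
      unfolding f_def by (intro continuous_intros continuous_ray v kink_Conv)
  qed fact
  then show ?thesis by (simp add: f_def)
qed

text \<open>On the dual side, the conjugate of \<open>v + s l+\<close> is cut by two parallel hyperplanes, at the slopes
  \<open>c\<close> and \<open>c + 1\<close>; the slab between them only depends on the restriction of \<open>v\<close> to \<open>l = 0\<close>. The
  functions \<open>g1\<close> and \<open>g s\<close> below are the conjugates of the pieces.\<close>

lemma kink_local_Lipschitz:
  assumes v: "v \<in> Conv" and vH: "vH \<in> Conv"
    and c: "0 \<le> c" "\<And>x. \<bar>v x - vH x\<bar> \<le> c * \<bar>x \<bullet> fst k - snd k\<bar>"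
  shows "Z (\<lambda>x. v x + kink k x) - Z v = Z (\<lambda>x. vH x + kink k x) - Z vH"
proof -
  define l where "l = (\<lambda>x. x \<bullet> fst k - snd k)"
  have cases: thesis
    if "\<lbrakk>l x \<ge> 0; kink k x = l x; c * l x \<ge> 0; v x - vH x \<le> c * l x; vH x - v x \<le> c * l x\<rbrakk> \<Longrightarrow> thesis"
      and "\<lbrakk>l x \<le> 0; kink k x = 0; c * l x \<le> 0; v x - vH x \<le> - (c * l x); vH x - v x \<le> - (c * l x)\<rbrakk> \<Longrightarrow> thesis"
    for x thesis
  proof (cases "l x \<ge> 0")
    case True
    then show ?thesis using c(1) c(2)[of x] by (intro that(1)) (simp_all add: kink_def l_def abs_le_iff)
  next
    case False
    then have "c * \<bar>x \<bullet> fst k - snd k\<bar> = - (c * l x)" by (simp add: l_def abs_if algebra_simps)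
    then have "v x - vH x \<le> - (c * l x)" "vH x - v x \<le> - (c * l x)" using c(2)[of x] by linarith+
    with False show ?thesis using c(1) by (intro that(2)) (simp_all add: kink_def l_def mult_nonneg_nonpos)
  qed
  have Caff: "(\<lambda>x. u x + s * l x) \<in> Conv" if "u \<in> Conv" for u s
    using Conv_add[OF that Conv_affine[of "s *\<^sub>R fst k" "- s * snd k"]]
    by (simp add: l_def algebra_simps)
  have Zaff: "Z w = Z u" if "u \<in> Conv" "\<And>x. w x = u x + s * l x" for u s w
    by (rule affine'[OF that(1), of w "s *\<^sub>R fst k" "- s * snd k"]) (simp add: that l_def algebra_simps)
  define F where "F = (\<lambda>s. Z (\<lambda>x. v x + s * kink k x))"
  define g where "g = (\<lambda>s x. max (vH x + c * l x) (v x + s * l x))"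
  define g1 where "g1 = (\<lambda>x. max (v x) (vH x + c * l x))"
  have g: "g s \<in> Conv" for s unfolding g_def by (intro Conv_max Caff v vH)
  have g1: "g1 \<in> Conv" unfolding g1_def by (intro Conv_max Caff v vH)
  \<comment> \<open>As \<open>v\<close> and \<open>vH\<close> differ by at most
    \<open>c * \<bar>l\<bar>\<close>, the slope \<open>2 * c\<close> is large enough for
    \<open>v + s l\<close> to lie above \<open>vH + c l\<close> where \<open>l \<ge> 0\<close> and
    below it where \<open>l \<le> 0\<close>.\<close>
  have A: "F s + Z (\<lambda>x. vH x + c * l x) = Z g1 + Z (g s)" if "s = 2 * c \<or> s = 2 * c + 1" for s
    unfolding F_def
  proof (rule max_min)
    show "(\<lambda>x. v x + s * kink k x) \<in> Conv"
      using that c(1) by (intro Conv_add v Conv_scale kink_Conv) auto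
    have sl: "s * y = 2 * (c * y) \<or> s * y = 2 * (c * y) + y" for y
      using that by (auto simp: algebra_simps)
    have "v x + s * kink k x = max (g1 x) (g s x) \<and> vH x + c * l x = min (g1 x) (g s x)" for x
    proof (rule cases[of x])
      assume *: "kink k x = l x" "c * l x \<ge> 0" "v x - vH x \<le> c * l x" "vH x - v x \<le> c * l x" "l x \<ge> 0"
      then have "g1 x = vH x + c * l x" "g s x = v x + s * l x" "v x + s * l x \<ge> vH x + c * l x"
        using sl[of "l x"] unfolding g1_def g_def by linarith+
      with * show ?thesis by simp
    next
      assume *: "kink k x = 0" "c * l x \<le> 0" "v x - vH x \<le> - (c * l x)" "vH x - v x \<le> - (c * l x)" "l x \<le> 0"
      then have "g1 x = v x" "g s x = vH x + c * l x" "v x \<ge> vH x + c * l x"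
        using sl[of "l x"] unfolding g1_def g_def by linarith+
      with * show ?thesis by simp
    qed
    then show "v x + s * kink k x = max (g1 x) (g s x)" "vH x + c * l x = min (g1 x) (g s x)" for x by auto
  qed (intro g g1 Caff vH)+
  have B: "Z (g (2 * c + 1)) + Z (\<lambda>x. vH x + (c + 1) * l x)
      = Z (\<lambda>x. (vH x + kink k x) + c * l x) + Z (\<lambda>x. g (2 * c) x + 1 * l x)"
  proof (rule max_min)
    show "g (2 * c + 1) x = max (vH x + kink k x + c * l x) (g (2 * c) x + 1 * l x)"
      "vH x + (c + 1) * l x = min (vH x + kink k x + c * l x) (g (2 * c) x + 1 * l x)" for x
      unfolding g_def by (rule cases[of x]; simp add: distrib_right; linarith)+
  qed (intro Caff Conv_kink vH g)+
  \<comment> \<open>The piece \<open>g1\<close> does not depend on the slope and cancels between the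
    two instances of \<open>A\<close>; \<open>B\<close> evaluates what remains in terms of
    \<open>vH\<close> alone.\<close>
  have "F (2 * c + 1) - F (2 * c) = Z (\<lambda>x. vH x + kink k x) - Z vH"
  proof -
    have "Z (\<lambda>x. vH x + (c + 1) * l x) = Z vH" "Z (\<lambda>x. vH x + c * l x) = Z vH"
      "Z (\<lambda>x. (vH x + kink k x) + c * l x) = Z (\<lambda>x. vH x + kink k x)"
      "Z (\<lambda>x. g (2 * c) x + 1 * l x) = Z (g (2 * c))"
      by (rule Zaff[where s="c + 1"], fact vH, simp) (rule Zaff[where s=c], fact vH, simp,
          rule Zaff[where s=c], intro Conv_kink vH, simp, rule Zaff[where s=1], rule g, simp)
    with A[of "2 * c"] A[of "2 * c + 1"] B show ?thesis by simp
  qed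
  moreover have "F (2 * c + 1) - F (2 * c) = Z (\<lambda>x. v x + kink k x) - Z v"
    using kink_Cauchy[OF v, of "2 * c" 1 k] c(1) by (simp add: F_def)
  ultimately show ?thesis by simp
qed

text \<open>Here \<open>\<pi>\<close> is the orthogonal projection onto the hyperplane. For
  Lipschitz \<open>w\<close> the difference \<open>w x - w (\<pi> x)\<close> is controlled by the
  distance to the hyperplane, so \<open>kink_local_Lipschitz\<close> applies; density removes the
  Lipschitz condition.\<close>

lemma kink_local_proj:
  assumes v: "v \<in> Conv" and \<pi>: "\<pi> = (\<lambda>x. x - ((x \<bullet> fst k - snd k) / (fst k \<bullet> fst k)) *\<^sub>R fst k)"
  shows "Z (\<lambda>x. v x + kink k x) - Z v = Z (\<lambda>x. v (\<pi> x) + kink k x) - Z (\<lambda>x. v (\<pi> x))"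
proof -
  define T where "T = (\<lambda>x. x - ((x \<bullet> fst k) / (fst k \<bullet> fst k)) *\<^sub>R fst k)"
  have "linear T" by (rule linearI) (simp_all add: T_def algebra_simps inner_add_left add_divide_distrib)
  have \<pi>T: "\<pi> x = T x + (snd k / (fst k \<bullet> fst k)) *\<^sub>R fst k" for x
    by (simp add: \<pi> T_def algebra_simps diff_divide_distrib)
  have C\<pi>: "(\<lambda>x. u (\<pi> x)) \<in> Conv" if "u \<in> Conv" for u
    unfolding \<pi>T by (rule Conv_comp_affine) (fact that, fact)
  define E where "E = (\<lambda>u. (Z (\<lambda>x. u x + kink k x) - Z u) - (Z (\<lambda>x. u (\<pi> x) + kink k x) - Z (\<lambda>x. u (\<pi> x))))"
  have lip: "E w = 0" if w: "w \<in> Conv" "L \<ge> 0" "\<And>x y. \<bar>w x - w y\<bar> \<le> L * norm (x - y)" for w L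
  proof -
    have "\<bar>w x - w (\<pi> x)\<bar> \<le> L * norm (fst k) / (fst k \<bullet> fst k) * \<bar>x \<bullet> fst k - snd k\<bar>" for x
      using w(3)[of x "\<pi> x"] by (simp add: \<pi> mult_ac)
    then have "Z (\<lambda>x. w x + kink k x) - Z w = Z (\<lambda>x. w (\<pi> x) + kink k x) - Z (\<lambda>x. w (\<pi> x))"
      by (intro kink_local_Lipschitz[where c="L * norm (fst k) / (fst k \<bullet> fst k)"] C\<pi> w) (use w in auto)
    then show ?thesis by (simp add: E_def)
  qed
  have "E v = 0"
  proof (rule Conv_continuous_eq_zero[OF _ v])
    show "continuous_on Conv E"
      unfolding E_def by (intro continuous_intros continuous_map continuous_on_eval Conv_kink C\<pi>)
    fix X :: "(real^'n) set" and e :: real assume "finite X" "e > 0"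
    then show "\<exists>w\<in>Conv. (\<forall>x\<in>X. \<bar>w x - v x\<bar> < e) \<and> E w = 0"
      using Conv_interpolate_Lipschitz[OF v, of X] lip by (metis abs_zero diff_self)
  qed
  then show ?thesis by (simp add: E_def)
qed

text \<open>Functions that agree on the hyperplane become equal after composition with the
  projection. With a zero normal there may be no hyperplane at all, but then the kink is a constant
  and both differences vanish.\<close>

lemma kink_local:
  assumes v: "v \<in> Conv" and w: "w \<in> Conv"
    and agree: "\<And>x. x \<bullet> fst k = snd k \<Longrightarrow> v x = w x"
  shows "Z (\<lambda>x. v x + kink k x) - Z v = Z (\<lambda>x. w x + kink k x) - Z w"
proof (cases "fst k = 0")
  case True
  have "Z (\<lambda>x. u x + kink k x) = Z u" if "u \<in> Conv" for u
    by (rule affine'[OF that, of _ 0 "max 0 (- snd k)"]) (simp add: kink_def True)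
  then show ?thesis using v w by simp
next
  case False
  define \<pi> where "\<pi> = (\<lambda>x. x - ((x \<bullet> fst k - snd k) / (fst k \<bullet> fst k)) *\<^sub>R fst k)"
  have "\<pi> x \<bullet> fst k = snd k" for x using False by (simp add: \<pi>_def inner_diff_left)
  then have "v (\<pi> x) = w (\<pi> x)" for x using agree by simp
  then show ?thesis
    using kink_local_proj[OF v \<pi>_def] kink_local_proj[OF w \<pi>_def] by simp
qed

end

section \<open>Iterated differences along kinks\<close>

fun diffs :: "((real^'n \<Rightarrow> real) \<Rightarrow> real) \<Rightarrow> ((real^'n) \<times> real) list \<Rightarrow> (real^'n \<Rightarrow> real) \<Rightarrow> real" where
  "diffs Z [] v = Z v"
| "diffs Z (k # ks) v = diffs Z ks (\<lambda>x. v x + kink k x) - diffs Z ks v"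

lemma kink_swap: "(\<lambda>x. v x + kink k x + kink j x) = (\<lambda>x. v x + kink j x + kink k x)"
  by (simp add: add_ac)

text \<open>Difference operators commute, so the first one may act directly on \<open>Z\<close>.
  This transports facts about a single kink, such as \<open>kink_local\<close>, to iterated
  differences.\<close>

lemma diffs_Cons_inner: "diffs Z (k # ks) v = diffs (\<lambda>v. Z (\<lambda>x. v x + kink k x) - Z v) ks v"
proof (induction ks arbitrary: v)
  case (Cons j ks)
  have "diffs (\<lambda>v. Z (\<lambda>x. v x + kink k x) - Z v) (j # ks) v
      = diffs Z (k # ks) (\<lambda>x. v x + kink j x) - diffs Z (k # ks) v"
    by (simp only: Cons[symmetric] diffs.simps(2)[of _ j])
  then show ?case by (simp add: kink_swap[of v k j])
qed simp

lemma diffs_move: "diffs Z (ks @ k # es) v = diffs Z (k # ks @ es) v"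
proof (induction ks arbitrary: v)
  case (Cons j ks)
  then show ?case by (simp add: kink_swap[of v k j])
qed simp

lemma diffs_invariant:
  assumes step: "\<And>k v w. P v w \<Longrightarrow> P (\<lambda>x. v x + kink k x) (\<lambda>x. w x + kink k x)"
    and Z: "\<And>v w. P v w \<Longrightarrow> Z v = Z w" and "P v w"
  shows "diffs Z ks v = diffs Z ks w"
  using \<open>P v w\<close>
proof (induction ks arbitrary: v w)
  case (Cons k ks)
  from Cons.IH[OF Cons.prems] Cons.IH[OF step[OF Cons.prems, of k]]
  show ?case by simp
qed (use Z in auto)

lemma diffs_mult:
  assumes "\<And>v. v \<in> Conv \<Longrightarrow> Z v = c * W v" "v \<in> Conv"
  shows "diffs Z ks v = c * diffs W ks v"
  using assms(2)
proof (induction ks arbitrary: v)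
  case (Cons k ks)
  from Cons.IH[OF Cons.prems] Cons.IH[OF Conv_kink[OF Cons.prems, of k]]
  show ?case by (simp add: right_diff_distrib)
qed (use assms(1) in auto)

context affine_invariant_valuation
begin

text \<open>The positive parts of \<open>t\<close> and \<open>- t\<close> differ by
  \<open>t\<close>, so reversing the normal changes the kink by an affine function, which
  \<open>Z\<close> ignores.\<close>

lemma kink_scaled:
  assumes u: "u \<in> Conv"
  shows "Z (\<lambda>x. u x + kink (c *\<^sub>R a, c * b) x) - Z u = \<bar>c\<bar> * (Z (\<lambda>x. u x + kink (a, b) x) - Z u)"
proof (cases "c \<ge> 0")
  case True
  then show ?thesis using kink_linear[OF u, of c "(a, b)"] by (simp add: kink_scale)
next
  case False
  have "kink (c *\<^sub>R a, c * b) x = - c * kink (a, b) x + (x \<bullet> (c *\<^sub>R a) + (- c * b))" for x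
  proof -
    have "c * (x \<bullet> a) \<ge> c * b \<longleftrightarrow> x \<bullet> a \<le> b" using False by simp
    then show ?thesis by (auto simp: kink_def max_def algebra_simps)
  qed
  then have "Z (\<lambda>x. u x + kink (c *\<^sub>R a, c * b) x) = Z (\<lambda>x. u x + - c * kink (a, b) x)"
    using False by (intro affine'[where a="c *\<^sub>R a" and b="- c * b"] Conv_add u Conv_scale kink_Conv) auto
  with False show ?thesis using kink_linear[OF u, of "- c" "(a, b)"] by simp
qed

lemma diffs_affine:
  assumes "v \<in> Conv"
  shows "diffs Z ks (\<lambda>x. v x + (x \<bullet> a + b)) = diffs Z ks v"
proof (rule diffs_invariant[where P="\<lambda>v w. w \<in> Conv \<and> v = (\<lambda>x. w x + (x \<bullet> a + b))"])
  show "(\<lambda>x. w x + kink k x) \<in> Conv \<and> (\<lambda>x. v x + kink k x) = (\<lambda>x. w x + kink k x + (x \<bullet> a + b))"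
    if "w \<in> Conv \<and> v = (\<lambda>x. w x + (x \<bullet> a + b))" for v w k
    using that by (auto intro: Conv_kink simp: add_ac)
qed (use assms in \<open>auto intro: affine\<close>)

lemma diffs_local:
  assumes k: "k \<in> set ks" and "v \<in> Conv" "w \<in> Conv" "\<And>x. x \<bullet> fst k = snd k \<Longrightarrow> v x = w x"
  shows "diffs Z ks v = diffs Z ks w"
  using assms
proof (induction ks arbitrary: v w)
  case (Cons j ks)
  show ?case
  proof (cases "k = j")
    case True
    let ?P = "\<lambda>v w. v \<in> Conv \<and> w \<in> Conv \<and> (\<forall>x. x \<bullet> fst k = snd k \<longrightarrow> v x = w x)"
    show ?thesis
      unfolding diffs_Cons_inner True[symmetric]
      by (rule diffs_invariant[where P="?P"]) (use Cons.prems kink_local in \<open>auto intro: Conv_kink\<close>)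
  next
    case False
    then have k: "k \<in> set ks" using Cons.prems by simp
    show ?thesis
      using Cons.IH[OF k Cons.prems(2-4)]
        Cons.IH[OF k Conv_kink[OF Cons.prems(2), of j] Conv_kink[OF Cons.prems(3), of j]] Cons.prems(4)
      by simp
  qed
qed simp

text \<open>On the hyperplane of a listed \<open>k\<close>, the function
  \<open>x \<bullet> (c *\<^sub>R fst k)\<close> is the constant \<open>c * snd k\<close>. By
  locality the normal may therefore change by a multiple of \<open>fst k\<close> if the offset
  absorbs that constant.\<close>

lemma diffs_shift:
  assumes "d \<in> span (fst ` set ks)"
  shows "\<exists>b'. \<forall>v\<in>Conv. diffs Z ks (\<lambda>x. v x + kink (a, b) x) = diffs Z ks (\<lambda>x. v x + kink (a + d, b') x)"
  using assms
proof (induction rule: span_induct_alt)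
  case base
  show ?case by auto
next
  case (step c y d)
  then obtain b' where b': "\<And>v. v \<in> Conv \<Longrightarrow>
    diffs Z ks (\<lambda>x. v x + kink (a, b) x) = diffs Z ks (\<lambda>x. v x + kink (a + d, b') x)" by auto
  from step obtain k where k: "k \<in> set ks" "y = fst k" by auto
  have "diffs Z ks (\<lambda>x. v x + kink (a, b) x) = diffs Z ks (\<lambda>x. v x + kink (a + (c *\<^sub>R y + d), b' + c * snd k) x)"
    if v: "v \<in> Conv" for v
    unfolding b'[OF v]
  proof (rule diffs_local[OF k(1)])
    fix x assume "x \<bullet> fst k = snd k"
    then show "v x + kink (a + d, b') x = v x + kink (a + (c *\<^sub>R y + d), b' + c * snd k) x"
      by (simp add: kink_def k inner_add_right)
  qed (intro Conv_kink v)+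
  then show ?case by blast
qed

lemma diffs_scaled:
  assumes v: "v \<in> Conv"
  shows "diffs Z (((c *\<^sub>R a, c * b)) # ks) v = \<bar>c\<bar> * diffs Z ((a, b) # ks) v"
  unfolding diffs_Cons_inner by (intro diffs_mult kink_scaled v)

end

text \<open>Real-valued form of dual simplicity: invariance along one direction suffices as the
  test, since \<open>affine\<close> already takes care of the linear functional.\<close>

locale simple_valuation = affine_invariant_valuation Z for Z :: "(real^'n \<Rightarrow> real) \<Rightarrow> real" +
  assumes simple: "\<And>v a. v \<in> Conv \<Longrightarrow> a \<noteq> 0 \<Longrightarrow> (\<And>x t. v (x + t *\<^sub>R a) = v x) \<Longrightarrow> Z v = 0"
begin

text \<open>In each difference the branch without the new kink is constant along that axis, so
  \<open>simple\<close> makes it vanish. Only the branch containing all kinks survives.\<close>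

lemma diffs_axes_aux:
  assumes "distinct is" "u \<in> Conv"
    and "\<And>i x t. i \<in> set is \<Longrightarrow> u (x + t *\<^sub>R axis i 1) = u x"
  shows "diffs Z (map (\<lambda>i. (axis i 1, p i)) is) u = Z (\<lambda>x. u x + (\<Sum>i\<leftarrow>is. kink (axis i 1, p i) x))"
  using assms
proof (induction "is" arbitrary: u)
  case (Cons i "is")
  have kinv: "kink (axis i 1, p i) (x + t *\<^sub>R axis j 1) = kink (axis i 1, p i) x" if "j \<noteq> i" for j x t
    using that by (simp add: kink_def inner_add_left inner_axis_axis)
  have 1: "diffs Z (map (\<lambda>i. (axis i 1, p i)) is) (\<lambda>x. u x + kink (axis i 1, p i) x)
      = Z (\<lambda>x. (u x + kink (axis i 1, p i) x) + (\<Sum>i\<leftarrow>is. kink (axis i 1, p i) x))"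
  proof (rule Cons.IH)
    show "u (x + t *\<^sub>R axis j 1) + kink (axis i 1, p i) (x + t *\<^sub>R axis j 1) = u x + kink (axis i 1, p i) x"
      if "j \<in> set is" for j x t
      using that Cons.prems kinv by (cases "j = i") auto
  qed (use Cons.prems Conv_kink in auto)
  have 2: "diffs Z (map (\<lambda>i. (axis i 1, p i)) is) u = Z (\<lambda>x. u x + (\<Sum>i\<leftarrow>is. kink (axis i 1, p i) x))"
    by (rule Cons.IH) (use Cons.prems in auto)
  have C: "(\<lambda>x. \<Sum>j\<leftarrow>js. kink (axis j 1, p j) x) \<in> Conv" for js
    by (induction js) (auto intro: Conv_const Conv_add kink_Conv)
  have "Z (\<lambda>x. u x + (\<Sum>i\<leftarrow>is. kink (axis i 1, p i) x)) = 0"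
  proof (rule simple)
    show "(\<lambda>x. u x + (\<Sum>i\<leftarrow>is. kink (axis i 1, p i) x)) \<in> Conv" using Cons.prems by (intro Conv_add C) auto
    show "axis i (1::real) \<noteq> 0" by (simp add: axis_eq_0_iff)
    fix x t
    have "(\<Sum>j\<leftarrow>is. kink (axis j 1, p j) (x + t *\<^sub>R axis i 1)) = (\<Sum>j\<leftarrow>is. kink (axis j 1, p j) x)"
      using Cons.prems(1)
      by (intro arg_cong[where f=sum_list] map_cong) (auto simp: kink_def inner_add_left inner_axis_axis)
    then show "u (x + t *\<^sub>R axis i 1) + (\<Sum>j\<leftarrow>is. kink (axis j 1, p j) (x + t *\<^sub>R axis i 1))
        = u x + (\<Sum>j\<leftarrow>is. kink (axis j 1, p j) x)" using Cons.prems(3) by simp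
  qed
  then show ?case using 1 2 by (simp add: add.assoc)
qed simp

text \<open>The test function has the unit cube as subdifferential at \<open>p\<close>, and its
  subdifferentials elsewhere contribute nothing: its Monge-Ampere measure is the Dirac mass at
  \<open>p\<close>. Hence this reads off the density at \<open>p\<close>.\<close>

definition vertex :: "real^'n \<Rightarrow> real" where
  "vertex p = Z (\<lambda>x. \<Sum>i\<in>UNIV. kink (axis i 1, p $ i) x)"

text \<open>By locality the coordinates of the argument of \<open>v\<close> may be frozen at the
  values \<open>p i\<close> one after another. In the end \<open>v\<close> is replaced by a
  constant, and \<open>diffs_axes_aux\<close> leaves exactly one value of
  \<open>vertex\<close>.\<close>

lemma diffs_axes:
  assumes p: "\<And>p. vertex p = 0" and dist: "distinct is" and all: "set is = UNIV" and v: "v \<in> Conv"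
  shows "diffs Z (map (\<lambda>i. (axis i 1, p i)) is) v = 0"
proof -
  let ?es = "map (\<lambda>i. (axis i 1, p i)) is"
  have "diffs Z ?es v = diffs Z ?es (\<lambda>x. v (\<chi> i. if i \<in> I then p i else x $ i))"
    and "(\<lambda>x. v (\<chi> i. if i \<in> I then p i else x $ i)) \<in> Conv" for I :: "'n set"
  proof -
    have C: "(\<lambda>x. v (\<chi> i. if i \<in> I then p i else x $ i)) \<in> Conv" for I :: "'n set"
    proof -
      let ?T = "\<lambda>x::real^'n. (\<chi> i. if i \<in> I then 0 else x $ i)::real^'n"
      have "linear ?T" by (rule linearI) (auto simp: vec_eq_iff)
      then have "(\<lambda>x. v (?T x + (\<chi> i. if i \<in> I then p i else 0))) \<in> Conv"
        by (rule Conv_comp_affine[OF v])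
      moreover have "?T x + (\<chi> i. if i \<in> I then p i else 0) = (\<chi> i. if i \<in> I then p i else x $ i)" for x
        by (auto simp: vec_eq_iff)
      ultimately show ?thesis by simp
    qed
    show "(\<lambda>x. v (\<chi> i. if i \<in> I then p i else x $ i)) \<in> Conv" by (rule C)
    have "finite I" by simp
    then show "diffs Z ?es v = diffs Z ?es (\<lambda>x. v (\<chi> i. if i \<in> I then p i else x $ i))"
    proof (induction I rule: finite_induct)
      case (insert j I)
      have "diffs Z ?es (\<lambda>x. v (\<chi> i. if i \<in> I then p i else x $ i))
          = diffs Z ?es (\<lambda>x. v (\<chi> i. if i \<in> insert j I then p i else x $ i))"
      proof (rule diffs_local[of "(axis j 1, p j)"])
        show "(axis j 1, p j) \<in> set ?es" using all by simp
        fix x :: "real^'n" assume "x \<bullet> fst (axis j (1::real), p j) = snd (axis j (1::real), p j)"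
        then have "x $ j = p j" by (simp add: inner_axis)
        then show "v (\<chi> i. if i \<in> I then p i else x $ i) = v (\<chi> i. if i \<in> insert j I then p i else x $ i)"
          by (intro arg_cong[where f=v]) (auto simp: vec_eq_iff)
      qed (rule C)+
      with insert show ?case by simp
    qed simp
  qed
  from this(1)[of UNIV] have "diffs Z ?es v = diffs Z ?es (\<lambda>x. v (\<chi> i. p i))" by simp
  also have "\<dots> = diffs Z ?es (\<lambda>x. 0 + (x \<bullet> 0 + v (\<chi> i. p i)))" by simp
  also have "\<dots> = diffs Z ?es (\<lambda>x. 0)" by (intro diffs_affine Conv_const)
  also have "\<dots> = Z (\<lambda>x. 0 + (\<Sum>i\<leftarrow>is. kink (axis i 1, p i) x))"
    by (intro diffs_axes_aux dist Conv_const) simp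
  also have "(\<lambda>x. 0 + (\<Sum>i\<leftarrow>is. kink (axis i 1, p i) x)) = (\<lambda>x. \<Sum>i\<in>UNIV. kink (axis i 1, (\<chi> i. p i) $ i) x)"
    by (simp add: sum_list_distinct_conv_sum_set[OF dist] all)
  finally show ?thesis using p[of "\<chi> i. p i"] unfolding vertex_def by simp
qed

text \<open>Exchange argument: a direction outside the span of the others may be replaced by a coordinate
  axis outside that span, since the difference operator only sees it modulo the others.\<close>

lemma diffs_spanning:
  assumes p: "\<And>p. vertex p = 0" and dist: "distinct is"
    and sp: "span (fst ` set ks \<union> (\<lambda>i. axis i 1) ` set is) = UNIV" and v: "v \<in> Conv"
  shows "diffs Z (ks @ map (\<lambda>i. (axis i 1, q i)) is) v = 0"
  using dist sp v
proof (induction ks arbitrary: "is" q v)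
  case Nil
  have "j \<in> set is" for j
  proof (rule ccontr)
    assume "j \<notin> set is"
    then have "(\<lambda>i. axis i (1::real)) ` set is \<subseteq> {x::real^'n. x $ j = 0}"
      by (auto simp: axis_def)
    moreover have "subspace {x::real^'n. x $ j = 0}" by (auto simp: subspace_def)
    ultimately have "span ((\<lambda>i. axis i (1::real)) ` set is) \<subseteq> {x::real^'n. x $ j = 0}"
      by (rule span_minimal)
    moreover have "axis j (1::real) \<in> span ((\<lambda>i. axis i (1::real)) ` set is)" using Nil by simp
    ultimately have "axis j (1::real) \<in> {x::real^'n. x $ j = 0}" by (rule subsetD)
    then show False by (simp add: axis_def)
  qed
  then show ?case using diffs_axes[OF p Nil(1) _ Nil(3), of q] by auto
next
  case (Cons k ks)
  obtain a b where k: "k = (a, b)" by (cases k)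
  define es where "es = map (\<lambda>i. (axis i (1::real), q i)) is"
  define A where "A = fst ` set ks \<union> (\<lambda>i. axis i (1::real)) ` set is"
  have A: "A = fst ` set (ks @ es)" by (auto simp: A_def es_def image_Un image_image)
  have spA: "span (insert a A) = UNIV" using Cons.prems(2) by (simp add: A_def k)
  have "diffs Z (k # ks @ es) v = 0"
  proof (cases "span A = UNIV")
    case True
    then have "diffs Z (ks @ es) u = 0" if "u \<in> Conv" for u
      unfolding es_def using Cons.IH[OF Cons.prems(1) _ that] A_def by simp
    then show ?thesis using Cons.prems(3) by (simp add: Conv_kink)
  next
    case False
    have "\<exists>i. axis i 1 \<notin> span A"
    proof (rule ccontr)
      assume "\<not> ?thesis"
      then have "(Basis :: (real^'n) set) \<subseteq> span A" by (auto simp: Basis_vec_def)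
      then have "span (Basis :: (real^'n) set) \<subseteq> span A" by (intro span_minimal subspace_span)
      with False span_Basis show False by blast
    qed
    then obtain i where i: "axis i 1 \<notin> span A" by auto
    have "axis i 1 \<in> span (insert a A)" using spA by simp
    then have a: "a \<in> span (insert (axis i 1) A)" using i by (rule in_span_insert)
    then have sp': "span (insert (axis i 1) A) = UNIV"
      using span_minimal[of "insert a A" "span (insert (axis i 1) A)"] span_superset[of "insert (axis i 1) A"] spA
      by auto
    have "i \<notin> set is" using i by (auto simp: A_def intro: span_base)
    have IH: "diffs Z ((axis i 1, c) # ks @ es) u = 0" if "u \<in> Conv" for c u
    proof -
      have "diffs Z (ks @ map (\<lambda>j. (axis j 1, (q(i := c)) j)) (i # is)) u = 0"
        using sp' \<open>i \<notin> set is\<close> Cons.prems(1)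
        by (intro Cons.IH that) (auto simp: A_def)
      moreover have "map (\<lambda>j. (axis j 1, (q(i := c)) j)) (i # is) = (axis i 1, c) # es"
        using \<open>i \<notin> set is\<close> by (auto simp: es_def)
      ultimately show ?thesis by (simp add: diffs_move)
    qed
    from a obtain c where c: "a - c *\<^sub>R axis i 1 \<in> span A" by (auto simp: span_insert)
    then have "- (a - c *\<^sub>R axis i 1) \<in> span (fst ` set (ks @ es))" unfolding A by (rule span_neg)
    from diffs_shift[OF this, of a b] obtain b' where
      b': "diffs Z (ks @ es) (\<lambda>x. v x + kink (a, b) x) = diffs Z (ks @ es) (\<lambda>x. v x + kink (c *\<^sub>R axis i 1, b') x)"
      using Cons.prems(3) by auto
    have "diffs Z ((c *\<^sub>R axis i 1, b') # ks @ es) v = 0"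
    proof (cases "c = 0")
      case True
      have "diffs Z (ks @ es) (\<lambda>x. v x + (x \<bullet> 0 + max 0 (- b'))) = diffs Z (ks @ es) v"
        by (rule diffs_affine) fact
      with True show ?thesis by (simp add: kink_def)
    next
      case False
      then show ?thesis
        using diffs_scaled[OF Cons.prems(3), of c "axis i 1" "b' / c" "ks @ es"] IH[OF Cons.prems(3), of "b' / c"]
        by simp
    qed
    then show ?thesis by (simp add: k b')
  qed
  then show ?case by (simp add: es_def)
qed

text \<open>If the normals do not span, some direction is orthogonal to all of them, and every
  function occurring in the iterated difference is constant along it.\<close>

lemma diffs_zero:
  assumes p: "\<And>p. vertex p = 0"
  shows "diffs Z ks (\<lambda>x. 0) = 0"
proof (cases "span (fst ` set ks) = UNIV")
  case True
  then show ?thesis using diffs_spanning[OF p, of "[]" ks "\<lambda>x. 0"] by (simp add: Conv_const)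
next
  case False
  then have "span (fst ` set ks) \<subset> UNIV" by auto
  then obtain w where w: "w \<noteq> 0" "\<And>y. y \<in> span (fst ` set ks) \<Longrightarrow> orthogonal w y"
    using orthogonal_to_subspace_exists_gen[of "fst ` set ks" UNIV] by (auto simp: orthogonal_commute)
  have "diffs Z js u = 0" if "set js \<subseteq> set ks" "u \<in> Conv" "\<And>x t. u (x + t *\<^sub>R w) = u x" for js u
    using that
  proof (induction js arbitrary: u)
    case Nil
    then show ?case using simple w(1) by auto
  next
    case (Cons k js)
    then have "w \<bullet> fst k = 0" using w(2)[of "fst k"] by (auto intro: span_base simp: orthogonal_def)
    then have "diffs Z js (\<lambda>x. u x + kink k x) = 0"
      using Cons.prems by (intro Cons.IH Conv_kink) (auto simp: kink_def inner_add_left)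
    then show ?case using Cons by simp
  qed
  from this[of ks "\<lambda>x. 0"] show ?thesis by (simp add: Conv_const)
qed

text \<open>Adding a kink and taking a difference along it are related by
  \<open>diffs Z es (v + kink k) = diffs Z (k # es) v + diffs Z es v\<close>. Generalising over
  \<open>es\<close> turns this into an induction that ends at \<open>diffs_zero\<close>.\<close>

lemma kink_sum_zero:
  assumes p: "\<And>p. vertex p = 0"
  shows "Z (\<lambda>x. \<Sum>k\<leftarrow>ks. kink k x) = 0"
proof -
  have "diffs Z es (\<lambda>x. \<Sum>k\<leftarrow>ks. kink k x) = 0" for es
  proof (induction ks arbitrary: es)
    case Nil
    then show ?case using diffs_zero[OF p] by simp
  next
    case (Cons k ks)
    from Cons[of es] Cons[of "k # es"] show ?case by (simp add: add.commute)
  qed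
  from this[of "[]"] show ?thesis by simp
qed

text \<open>Shearing the kinks through a far away point \<open>p\<close> makes all of them vanish on a given finite set,
  while one of them can be scaled without bound.\<close>

lemma vertex_support:
  obtains R where "\<And>p i. R < \<bar>p $ i\<bar> \<Longrightarrow> vertex p = 0"
proof -
  from continuous_on_Conv_finite[OF continuous Conv_const[of 0] zero_less_one] obtain X d where X: "finite X" "d > 0"
    "\<forall>w\<in>Conv. (\<forall>x\<in>X. \<bar>w x - 0\<bar> < d) \<longrightarrow> dist (Z w) (Z (\<lambda>x. 0)) < 1" by (elim exE conjE)
  have Z0: "Z (\<lambda>x. 0) = 0" by (rule simple[of _ "axis undefined 1"]) (auto simp: axis_eq_0_iff Conv_const)
  define r where "r = (\<Sum>x\<in>X. norm x)"
  have r: "\<bar>x $ j\<bar> \<le> r" if "x \<in> X" for x j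
  proof -
    have "norm x \<le> r" unfolding r_def by (rule member_le_sum) (use that X(1) in auto)
    then show ?thesis using component_le_norm_cart[of x j] by simp
  qed
  have "vertex p = 0" if pi: "3 * r < \<bar>p $ i\<bar>" for p :: "real^'n" and i
  proof -
    have "Max (range (\<lambda>j. \<bar>p $ j\<bar>)) \<in> range (\<lambda>j. \<bar>p $ j\<bar>)" by (rule Max_in) auto
    then obtain m where "Max (range (\<lambda>j. \<bar>p $ j\<bar>)) = \<bar>p $ m\<bar>" by blast
    then have m: "\<bar>p $ j\<bar> \<le> \<bar>p $ m\<bar>" for j
      using Max_ge[of "range (\<lambda>j. \<bar>p $ j\<bar>)" "\<bar>p $ j\<bar>"] by simp
    define s where "s = sgn (p $ m)"
    \<comment> \<open>On \<open>X\<close> all coordinates have size at most \<open>r\<close>, so for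
      the largest coordinate \<open>m\<close> one gets \<open>x $ i + 2 * (s * x $ m) \<le> 3 * r <
      \<bar>p $ m\<bar> \<le> p $ i + 2 * \<bar>p $ m\<bar>\<close>. This is the origin of the
      factors 2 and 3: the sheared kinks vanish on \<open>X\<close>.\<close>
    define c where "c = 2 * s"
    have pm: "\<bar>p $ m\<bar> > 3 * r" using pi m[of i] by simp
    have spm: "s * (p $ m) = \<bar>p $ m\<bar>" by (simp add: s_def abs_sgn)
    define k where "k = (axis m (1::real), p $ m)"
    define v where "v = (\<lambda>x. \<Sum>i\<in>UNIV - {m}. kink (axis i 1, p $ i) x)"
    define v' where "v' = (\<lambda>x. \<Sum>i\<in>UNIV - {m}. kink (axis i 1 + c *\<^sub>R axis m 1, p $ i + c * (p $ m)) x)"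
    have v: "v \<in> Conv" "v' \<in> Conv" unfolding v_def v'_def by (intro Conv_sum kink_Conv; simp)+
    have "Z v = 0"
      by (rule simple[OF v(1), of "axis m 1"])
        (auto simp: axis_eq_0_iff v_def kink_def inner_add_left inner_axis_axis intro!: sum.cong)
    moreover have "Z v' = 0"
    proof (rule simple[OF v(2)])
      \<comment> \<open>A vector orthogonal to all the sheared normals, so \<open>v'\<close> is
        constant along it.\<close>
      define w where "w = (axis m 1 - c *\<^sub>R (\<Sum>i\<in>UNIV - {m}. axis i (1::real)) :: real^'n)"
      have wj: "w \<bullet> axis j 1 = (if j = m then 1 else - c)" for j
        by (simp add: w_def inner_diff_left inner_sum_left inner_axis_axis sum.delta' if_distrib cong: if_cong)
      show "w \<noteq> 0" using wj[of m] by auto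
      show "v' (x + t *\<^sub>R w) = v' x" for x t
        unfolding v'_def kink_def fst_conv snd_conv
        by (intro sum.cong refl) (simp add: inner_add_left inner_add_right wj algebra_simps)
    qed
    moreover have "Z (\<lambda>x. v x + kink k x) - Z v = Z (\<lambda>x. v' x + kink k x) - Z v'"
    proof (rule kink_local[OF v])
      fix x assume "x \<bullet> fst k = snd k"
      then have "x $ m = p $ m" by (simp add: k_def inner_axis)
      then show "v x = v' x" by (simp add: v_def v'_def kink_def inner_add_right inner_axis)
    qed
    moreover have "vertex p = Z (\<lambda>x. v x + kink k x)"
      unfolding vertex_def v_def k_def by (simp add: sum.remove[of UNIV m] add.commute)
    ultimately have vp: "Z (\<lambda>x. v' x + kink k x) = vertex p" "Z v' = 0" by simp_all
    \<comment> \<open>Scaling the remaining kink by \<open>t\<close> multiplies the value by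
      \<open>t\<close> while the function stays zero on \<open>X\<close>; the sign \<open>s\<close>
      makes this kink vanish there too. Boundedness in \<open>t\<close> forces
      \<open>vertex p = 0\<close>.\<close>
    have "\<bar>t * vertex p\<bar> < 1" if t: "t > 0" for t
    proof -
      define u where "u = (\<lambda>x. v' x + kink ((t * s) *\<^sub>R axis m 1, (t * s) * (p $ m)) x)"
      have "r \<ge> 0" by (simp add: r_def sum_nonneg)
      then have "\<bar>s\<bar> = 1" using pm by (auto simp: s_def sgn_if)
      then have "Z u = t * vertex p"
        using kink_scaled[OF v(2), of "t * s" "axis m 1" "p $ m"] vp t by (simp add: u_def k_def abs_mult)
      moreover have "u x = 0" if "x \<in> X" for x
      proof -
        have sx: "s * (x $ j) \<le> r" for j
          using r[OF that, of j] \<open>\<bar>s\<bar> = 1\<close> by (auto simp: abs_if split: if_splits)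
        have "kink (axis i 1 + c *\<^sub>R axis m 1, p $ i + c * (p $ m)) x = 0" for i
        proof -
          have "x $ i + 2 * (s * x $ m) \<le> p $ i + 2 * (s * p $ m)"
            using sx[of m] r[OF that, of i] m[of i] pm spm by linarith
          then show ?thesis by (simp add: kink_def inner_add_right inner_axis c_def mult.assoc)
        qed
        moreover have "kink ((t * s) *\<^sub>R axis m 1, (t * s) * (p $ m)) x = 0"
        proof -
          have "r \<ge> 0" using r[OF that, of m] by linarith
          then have "s * (x $ m) \<le> s * (p $ m)" using sx[of m] spm pm by linarith
          then have "t * (s * (x $ m)) \<le> t * (s * (p $ m))" by (rule mult_left_mono) (use t in simp)
          then have "(t * s) * (x $ m) - (t * s) * (p $ m) \<le> 0" by (simp only: mult.assoc diff_le_0_iff_le)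
          moreover have "kink ((t * s) *\<^sub>R axis m 1, (t * s) * (p $ m)) x = max 0 ((t * s) * (x $ m) - (t * s) * (p $ m))"
            by (simp add: kink_def inner_axis)
          ultimately show ?thesis by (simp only: max_absorb1)
        qed
        ultimately show ?thesis by (simp add: u_def v'_def)
      qed
      moreover have "u \<in> Conv" unfolding u_def by (intro Conv_kink v)
      ultimately show ?thesis using X(3)[rule_format, of u] X(2) Z0 by (simp add: dist_real_def)
    qed
    from this[of "2 / \<bar>vertex p\<bar>"] show ?thesis by (cases "vertex p = 0") (auto simp: abs_mult)
  qed
  then show ?thesis by (rule that)
qed

lemma vertex_continuous: "continuous_on UNIV vertex"
proof -
  have "continuous_on UNIV (\<lambda>(p::real^'n) x. \<Sum>i\<in>UNIV. kink (axis i 1, p $ i) x)"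
    unfolding kink_def by (intro continuous_on_coordinatewise_then_product continuous_intros)
  moreover have "(\<lambda>x. \<Sum>i\<in>UNIV. kink (axis i 1, p $ i) x) \<in> Conv" for p :: "real^'n"
    by (intro Conv_sum kink_Conv) simp
  ultimately show ?thesis
    unfolding vertex_def[abs_def]
    by (intro continuous_on_compose2[OF continuous]) auto
qed

lemma vertex_Cc: "vertex \<in> Cc"
proof -
  obtain R where R: "\<And>p i. R < \<bar>p $ i\<bar> \<Longrightarrow> vertex p = 0"
    using vertex_support by blast
  have "vertex p = 0" if "p \<notin> cbox (\<chi> i. - R) (\<chi> i. R)" for p
  proof -
    have "\<exists>i. \<not> (- R \<le> p $ i \<and> p $ i \<le> R)" using that by (simp add: mem_box_cart)
    then obtain i where "\<not> (- R \<le> p $ i \<and> p $ i \<le> R)" ..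
    then have "R < \<bar>p $ i\<bar>" by linarith
    then show ?thesis by (rule R)
  qed
  then show ?thesis unfolding Cc_def using vertex_continuous by (auto intro!: exI[of _ "cbox (\<chi> i. - R) (\<chi> i. R)"])
qed

end

section \<open>Sums of convex ridge functions\<close>

inductive_set ridge_sums :: "(real^'n \<Rightarrow> real) set" where
  ridge: "convex_on UNIV h \<Longrightarrow> (\<lambda>x. h (x \<bullet> a)) \<in> ridge_sums"
| add: "f \<in> ridge_sums \<Longrightarrow> g \<in> ridge_sums \<Longrightarrow> (\<lambda>x. f x + g x) \<in> ridge_sums"

text \<open>The closure is taken in the topology of pointwise convergence.\<close>

definition ridge_closure :: "(real^'n \<Rightarrow> real) set" where
  "ridge_closure = {w. \<forall>X e. finite X \<longrightarrow> e > 0 \<longrightarrow> (\<exists>s\<in>ridge_sums. \<forall>x\<in>X. \<bar>s x - w x\<bar> < e)}"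

lemma ridge_sums_scale: "f \<in> ridge_sums \<Longrightarrow> 0 \<le> c \<Longrightarrow> (\<lambda>x. c * f x) \<in> ridge_sums"
proof (induction rule: ridge_sums.induct)
  case (ridge h a)
  then show ?case using ridge_sums.ridge[of "\<lambda>t. c * h t" a] by (auto intro: convex_on_cmul)
next
  case (add f g)
  then show ?case using ridge_sums.add[of "\<lambda>x. c * f x" "\<lambda>x. c * g x"] by (simp add: distrib_left)
qed

lemma ridge_sums_affine: "(\<lambda>x. x \<bullet> a + b) \<in> ridge_sums"
proof -
  have "convex_on UNIV (\<lambda>t. t + b)" by (intro convex_onI) (auto simp: algebra_simps)
  then show ?thesis by (rule ridge_sums.ridge)
qed

lemma ridge_closureD:
  assumes "w \<in> ridge_closure" "finite X" "e > 0"
  obtains s where "s \<in> ridge_sums" "\<forall>x\<in>X. \<bar>s x - w x\<bar> < e"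
  using assms unfolding ridge_closure_def by blast

lemma ridge_closure_approx:
  fixes w :: "real^'n \<Rightarrow> real"
  assumes "\<And>X e. finite X \<Longrightarrow> e > 0 \<Longrightarrow> \<exists>s\<in>ridge_closure. \<forall>x\<in>X. \<bar>s x - w x\<bar> < e"
  shows "w \<in> ridge_closure"
  unfolding ridge_closure_def
proof (intro CollectI allI impI)
  fix X :: "(real^'n) set" and e :: real assume X: "finite X" "e > 0"
  then obtain s where s: "s \<in> ridge_closure" "\<forall>x\<in>X. \<bar>s x - w x\<bar> < e / 2" using assms[of X "e / 2"] by auto
  then obtain r where r: "r \<in> ridge_sums" "\<forall>x\<in>X. \<bar>r x - s x\<bar> < e / 2"
    using ridge_closureD[OF s(1) X(1), of "e / 2"] X(2) by auto
  have "\<bar>r x - w x\<bar> < e" if "x \<in> X" for x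
    using s(2)[rule_format, OF that] r(2)[rule_format, OF that] by linarith
  then show "\<exists>s\<in>ridge_sums. \<forall>x\<in>X. \<bar>s x - w x\<bar> < e" using r by blast
qed

lemma ridge_sums_closure: "f \<in> ridge_sums \<Longrightarrow> f \<in> ridge_closure"
  unfolding ridge_closure_def by force

lemma ridge_closure_affine: "(\<lambda>x. x \<bullet> a + b) \<in> ridge_closure"
  by (intro ridge_sums_closure ridge_sums_affine)

lemma ridge_closure_ridge: "convex_on UNIV h \<Longrightarrow> (\<lambda>x. h (x \<bullet> a)) \<in> ridge_closure"
  by (intro ridge_sums_closure ridge_sums.ridge)

lemma ridge_closure_add:
  fixes f g :: "real^'n \<Rightarrow> real"
  assumes "f \<in> ridge_closure" "g \<in> ridge_closure"
  shows "(\<lambda>x. f x + g x) \<in> ridge_closure"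
  unfolding ridge_closure_def
proof (intro CollectI allI impI)
  fix X :: "(real^'n) set" and e :: real assume X: "finite X" "e > 0"
  then obtain r where r: "r \<in> ridge_sums" "\<forall>x\<in>X. \<bar>r x - f x\<bar> < e / 2"
    using ridge_closureD[OF assms(1) X(1), of "e / 2"] by auto
  obtain s where s: "s \<in> ridge_sums" "\<forall>x\<in>X. \<bar>s x - g x\<bar> < e / 2"
    using ridge_closureD[OF assms(2) X(1), of "e / 2"] X(2) by auto
  have "\<bar>(r x + s x) - (f x + g x)\<bar> < e" if "x \<in> X" for x
    using r(2)[rule_format, OF that] s(2)[rule_format, OF that] by linarith
  then show "\<exists>s\<in>ridge_sums. \<forall>x\<in>X. \<bar>s x - (f x + g x)\<bar> < e"
    using ridge_sums.add[OF r(1) s(1)] by (intro bexI[where x="\<lambda>x. r x + s x"]) auto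
qed

lemma ridge_closure_scale:
  fixes f :: "real^'n \<Rightarrow> real"
  assumes "f \<in> ridge_closure" "0 \<le> c"
  shows "(\<lambda>x. c * f x) \<in> ridge_closure"
  unfolding ridge_closure_def
proof (intro CollectI allI impI)
  fix X :: "(real^'n) set" and e :: real assume X: "finite X" "e > 0"
  have "e / (c + 1) > 0" using X assms by simp
  with X obtain r where r: "r \<in> ridge_sums" "\<forall>x\<in>X. \<bar>r x - f x\<bar> < e / (c + 1)"
    using ridge_closureD[OF assms(1)] by blast
  have "\<bar>c * r x - c * f x\<bar> < e" if "x \<in> X" for x
  proof -
    have "\<bar>c * r x - c * f x\<bar> = c * \<bar>r x - f x\<bar>" using assms by (simp add: abs_mult right_diff_distrib[symmetric])
    also have "\<dots> \<le> c * (e / (c + 1))" using r(2) that assms by (intro mult_left_mono) (auto intro: less_imp_le)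
    also have "\<dots> < e" using assms X by (simp add: field_simps)
    finally show ?thesis .
  qed
  then show "\<exists>s\<in>ridge_sums. \<forall>x\<in>X. \<bar>s x - c * f x\<bar> < e"
    using ridge_sums_scale[OF r(1) assms(2)] by (intro bexI[where x="\<lambda>x. c * r x"]) auto
qed

lemma ridge_closure_sum:
  "finite I \<Longrightarrow> (\<And>i. i \<in> I \<Longrightarrow> f i \<in> ridge_closure) \<Longrightarrow> (\<lambda>x. \<Sum>i\<in>I. f i x) \<in> ridge_closure"
  by (induction I rule: finite_induct) (use ridge_closure_affine[of 0 0] in \<open>auto intro: ridge_closure_add\<close>)

lemma ridge_closure_limit:
  fixes w :: "real^'n \<Rightarrow> real"
  assumes "\<And>n. f n \<in> ridge_closure" "\<And>x. (\<lambda>n::nat. f n x) \<longlonglongrightarrow> w x"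
  shows "w \<in> ridge_closure"
proof (rule ridge_closure_approx)
  fix X :: "(real^'n) set" and e :: real assume X: "finite X" "e > 0"
  have "\<forall>x\<in>X. eventually (\<lambda>n. \<bar>f n x - w x\<bar> < e) sequentially"
    using assms(2) X(2) unfolding tendsto_iff dist_real_def by blast
  then have "eventually (\<lambda>n. \<forall>x\<in>X. \<bar>f n x - w x\<bar> < e) sequentially"
    using X(1) by (simp add: eventually_ball_finite)
  then obtain n where "\<forall>x\<in>X. \<bar>f n x - w x\<bar> < e"
    using eventually_happens[of _ sequentially] by auto
  then show "\<exists>s\<in>ridge_closure. \<forall>x\<in>X. \<bar>s x - w x\<bar> < e" using assms(1) by blast
qed

text \<open>Riemann sums are nonnegative combinations of the \<open>f y\<close>, and one tagged
  division can be fine enough for all points of a finite set simultaneously.\<close>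

lemma ridge_closure_integral:
  fixes a b :: "'b::euclidean_space" and f :: "'b \<Rightarrow> real^'n \<Rightarrow> real"
  assumes "\<And>y. f y \<in> ridge_closure" "\<And>x. ((\<lambda>y. f y x) has_integral w x) (cbox a b)"
  shows "w \<in> ridge_closure"
proof (rule ridge_closure_approx)
  fix X :: "(real^'n) set" and e :: real assume X: "finite X" "e > 0"
  let ?S = "\<lambda>p x. \<Sum>(y, k)\<in>p. measure lborel k *\<^sub>R f y x"
  have "\<forall>x\<in>X. eventually (\<lambda>p. \<bar>?S p x - w x\<bar> < e) (division_filter (cbox a b))"
    using assms(2) X(2) unfolding has_integral_cbox tendsto_iff dist_real_def by blast
  then have "eventually (\<lambda>p. \<forall>x\<in>X. \<bar>?S p x - w x\<bar> < e) (division_filter (cbox a b))"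
    using X(1) by (simp add: eventually_ball_finite)
  then have "eventually (\<lambda>p. (\<forall>x\<in>X. \<bar>?S p x - w x\<bar> < e) \<and> p tagged_division_of (cbox a b)) (division_filter (cbox a b))"
    using eventually_division_filter_tagged_division by (rule eventually_conj)
  from eventually_happens'[OF division_filter_not_empty this]
  obtain p where p: "\<forall>x\<in>X. \<bar>?S p x - w x\<bar> < e" "p tagged_division_of (cbox a b)"
    by (elim exE conjE)
  have "finite p" using p(2) by (rule tagged_division_of_finite)
  then have "(\<lambda>x. \<Sum>q\<in>p. measure lborel (snd q) * f (fst q) x) \<in> ridge_closure"
    by (intro ridge_closure_sum ridge_closure_scale assms(1)) auto
  then have "?S p \<in> ridge_closure" by (simp add: case_prod_beta')
  then show "\<exists>s\<in>ridge_closure. \<forall>x\<in>X. \<bar>s x - w x\<bar> < e"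
    using p(1) by (intro bexI[where x="?S p"])
qed

section \<open>Exact interpolation of ridge functions by kinks\<close>

lemma convex_chord_extrapolation:
  fixes h :: "real \<Rightarrow> real"
  assumes h: "convex_on UNIV h" and "m < b" "b \<le> t"
  shows "h m + (h b - h m) / (b - m) * (t - m) \<le> h t"
proof -
  define u where "u = (b - m) / (t - m)"
  have u: "0 < u" "u \<le> 1" using assms by (auto simp: u_def)
  have "(1 - u) *\<^sub>R m + u *\<^sub>R t = m + u * (t - m)" by (simp add: algebra_simps)
  also have "\<dots> = b" using assms by (simp add: u_def)
  finally have "h b \<le> (1 - u) * h m + u * h t"
    using convex_onD[OF h, of u m t] u by simp
  then have "h b - h m \<le> u * (h t - h m)" by (simp add: algebra_simps)
  then have "(h b - h m) / u \<le> h t - h m" using u by (simp add: divide_le_eq mult.commute)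
  moreover have "(h b - h m) / u = (h b - h m) / (b - m) * (t - m)" using assms by (simp add: u_def)
  ultimately show ?thesis by simp
qed

text \<open>Points are added from left to right. The induction also carries that the interpolant
  stays below \<open>h\<close> to the right of the last point; this makes the next change of slope
  nonnegative.\<close>

lemma convex_interpolate_kinks:
  fixes h :: "real \<Rightarrow> real"
  assumes h: "convex_on UNIV h" and T: "finite T"
  shows "\<exists>\<alpha> \<beta> s. (\<forall>j\<in>T. 0 \<le> s j) \<and>
    (\<forall>t\<in>T. h t = \<alpha> + \<beta> * t + (\<Sum>j\<in>T. s j * max 0 (t - j)))"
proof -
  have "\<exists>\<alpha> \<beta> s. (\<forall>j\<in>T. 0 \<le> s j) \<and> (\<forall>t\<in>T. h t = \<alpha> + \<beta> * t + (\<Sum>j\<in>T. s j * max 0 (t - j)))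
      \<and> (\<forall>t. t \<ge> Max T \<longrightarrow> T \<noteq> {} \<longrightarrow> \<alpha> + \<beta> * t + (\<Sum>j\<in>T. s j * max 0 (t - j)) \<le> h t)"
    using T
  proof (induction T rule: finite_linorder_max_induct)
    case (insert b T)
    show ?case
    proof (cases "T = {}")
      case True
      \<comment> \<open>The second point \<open>b - 1\<close> is arbitrary: the chord through it and
        \<open>b\<close> lies below \<open>h\<close> to the right of \<open>b\<close>.\<close>
      define d where "d = h b - h (b - 1)"
      have "h b - d * b + d * t \<le> h t" if "t \<ge> b" for t
        using convex_chord_extrapolation[OF h, of "b - 1" b t] that by (simp add: d_def algebra_simps)
      then show ?thesis using True
        by (intro exI[of _ "h b - d * b"] exI[of _ d] exI[of _ "\<lambda>_. 0"]) auto
    next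
      case False
      then obtain \<alpha> \<beta> s where s: "\<forall>j\<in>T. 0 \<le> s j"
        "\<forall>t\<in>T. h t = \<alpha> + \<beta> * t + (\<Sum>j\<in>T. s j * max 0 (t - j))"
        "\<forall>t. t \<ge> Max T \<longrightarrow> \<alpha> + \<beta> * t + (\<Sum>j\<in>T. s j * max 0 (t - j)) \<le> h t"
        using insert.IH by auto
      define g where "g = (\<lambda>t. \<alpha> + \<beta> * t + (\<Sum>j\<in>T. s j * max 0 (t - j)))"
      define m where "m = Max T"
      have m: "m \<in> T" "\<And>j. j \<in> T \<Longrightarrow> j \<le> m" using False insert.hyps by (auto simp: m_def)
      have mb: "m < b" using m insert.hyps by auto
      \<comment> \<open>The extra slope is placed at the previous last point \<open>m\<close>:
        values on \<open>T\<close> are unchanged and the value at \<open>b\<close> becomes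
        \<open>h b\<close>. The new point \<open>b\<close> itself receives weight 0.\<close>
      define d where "d = (h b - g b) / (b - m)"
      have d: "d \<ge> 0" using s(3) mb by (auto simp: d_def g_def m_def)
      define s' where "s' = (\<lambda>j. if j = b then 0 else if j = m then s m + d else s j)"
      have sum': "\<alpha> + \<beta> * t + (\<Sum>j\<in>insert b T. s' j * max 0 (t - j)) = g t + d * max 0 (t - m)" for t
      proof -
        have "b \<notin> T" using insert.hyps by auto
        then have "(\<Sum>j\<in>insert b T. s' j * max 0 (t - j)) = (\<Sum>j\<in>T. s' j * max 0 (t - j))"
          using insert.hyps by (simp add: s'_def)
        also have "\<dots> = (\<Sum>j\<in>T. s j * max 0 (t - j) + (if j = m then d * max 0 (t - m) else 0))"
          using \<open>b \<notin> T\<close> by (intro sum.cong) (auto simp: s'_def distrib_right)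
        also have "\<dots> = (\<Sum>j\<in>T. s j * max 0 (t - j)) + d * max 0 (t - m)"
          using m insert.hyps by (simp add: sum.distrib)
        finally show ?thesis by (simp add: g_def)
      qed
      have gaff: "g t = g m + (t - m) * (\<beta> + (\<Sum>j\<in>T. s j))" if "m \<le> t" for t
      proof -
        have "(\<Sum>j\<in>T. s j * max 0 (t - j)) = (\<Sum>j\<in>T. s j * max 0 (m - j) + (t - m) * s j)"
          using m that by (intro sum.cong refl) (auto simp: max_def algebra_simps dest!: m(2))
        also have "\<dots> = (\<Sum>j\<in>T. s j * max 0 (m - j)) + (t - m) * (\<Sum>j\<in>T. s j)"
          by (simp add: sum.distrib sum_distrib_left)
        finally show ?thesis by (simp add: g_def algebra_simps)
      qed
      have gm: "g m = h m" using s(2) m by (simp add: g_def)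
      have at_b: "g b + d * max 0 (b - m) = h b" using mb by (simp add: d_def)
      have "0 \<le> s' j" if "j \<in> insert b T" for j using that s(1) d m by (auto simp: s'_def)
      moreover have "h t = g t + d * max 0 (t - m)" if "t \<in> insert b T" for t
        using that at_b s(2) m(2) by (auto simp: g_def max_absorb1)
      moreover have "g t + d * max 0 (t - m) \<le> h t" if "t \<ge> Max (insert b T)" for t
      proof -
        have "Max (insert b T) = b" using insert.hyps by (intro Max_eqI) (auto intro: less_imp_le)
        with that have t: "b \<le> t" by simp
        have "(h b - h m) / (b - m) = \<beta> + (\<Sum>j\<in>T. s j) + d"
          using at_b gaff[of b] mb gm by (simp add: field_simps)
        then show ?thesis
          using convex_chord_extrapolation[OF h mb t] gaff[of t] gm mb t by (simp add: algebra_simps)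
      qed
      ultimately show ?thesis
        by (intro exI[of _ \<alpha>] exI[of _ \<beta>] exI[of _ s']) (auto simp only: sum')
    qed
  qed simp
  then show ?thesis by (elim exE conjE) (intro exI conjI)
qed

lemma ridge_interpolate_kinks:
  fixes X :: "(real^'n) set" and a :: "real^'n"
  assumes h: "convex_on UNIV h" and X: "finite X"
  shows "\<exists>c b ps. (\<forall>(t, j)\<in>set ps. 0 \<le> t) \<and>
    (\<forall>x\<in>X. h (x \<bullet> a) = x \<bullet> c + b + (\<Sum>(t, j)\<leftarrow>ps. t * kink (a, j) x))"
proof -
  have fin: "finite ((\<lambda>x. x \<bullet> a) ` X)" using X by simp
  from convex_interpolate_kinks[OF h fin]
  obtain \<alpha> \<beta> s where s0: "\<forall>j\<in>(\<lambda>x. x \<bullet> a) ` X. 0 \<le> s j"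
    "\<forall>t\<in>(\<lambda>x. x \<bullet> a) ` X. h t = \<alpha> + \<beta> * t + (\<Sum>j\<in>(\<lambda>x. x \<bullet> a) ` X. s j * max 0 (t - j))"
    by (elim exE conjE)
  note s = s0[rule_format]
  obtain js where js: "set js = (\<lambda>x. x \<bullet> a) ` X" "distinct js" using finite_distinct_list[OF fin] by auto
  show ?thesis
  proof (intro exI[of _ "\<beta> *\<^sub>R a"] exI[of _ \<alpha>] exI[of _ "map (\<lambda>j. (s j, j)) js"] conjI ballI)
    show "case p of (t, j) \<Rightarrow> 0 \<le> t" if "p \<in> set (map (\<lambda>j. (s j, j)) js)" for p using that s(1) js by auto
    show "h (x \<bullet> a) = x \<bullet> \<beta> *\<^sub>R a + \<alpha> + (\<Sum>(t, j)\<leftarrow>map (\<lambda>j. (s j, j)) js. t * kink (a, j) x)" if "x \<in> X" for x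
      using s(2)[OF imageI[OF that]]
      by (simp add: js(1)[symmetric] sum_list_distinct_conv_sum_set[OF js(2)] kink_def o_def)
  qed
qed

lemma ridge_sums_interpolate_kinks:
  fixes X :: "(real^'n) set"
  assumes "f \<in> ridge_sums" "finite X"
  shows "\<exists>c b ks. \<forall>x\<in>X. f x = x \<bullet> c + b + (\<Sum>k\<leftarrow>ks. kink k x)"
  using assms(1)
proof (induction rule: ridge_sums.induct)
  case (ridge h a)
  obtain c b ps where ps: "\<forall>(t, j)\<in>set ps. 0 \<le> t"
    "\<forall>x\<in>X. h (x \<bullet> a) = x \<bullet> c + b + (\<Sum>(t, j)\<leftarrow>ps. t * kink (a, j) x)"
    using ridge_interpolate_kinks[OF ridge assms(2), of a] by (elim exE conjE)
  have "(\<Sum>(t, j)\<leftarrow>ps. t * kink (a, j) x) = (\<Sum>k\<leftarrow>map (\<lambda>(t, j). (t *\<^sub>R a, t * j)) ps. kink k x)" for x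
    using ps(1) by (induction ps) (auto simp: kink_scale)
  then have "\<forall>x\<in>X. h (x \<bullet> a) = x \<bullet> c + b + (\<Sum>k\<leftarrow>map (\<lambda>(t, j). (t *\<^sub>R a, t * j)) ps. kink k x)"
    using ps(2) by simp
  then show ?case by (intro exI)
next
  case (add f g)
  then obtain c b ks c' b' ks' where "\<forall>x\<in>X. f x = x \<bullet> c + b + (\<Sum>k\<leftarrow>ks. kink k x)"
    "\<forall>x\<in>X. g x = x \<bullet> c' + b' + (\<Sum>k\<leftarrow>ks'. kink k x)" by (elim exE)
  then have "\<forall>x\<in>X. f x + g x = x \<bullet> (c + c') + (b + b') + (\<Sum>k\<leftarrow>ks @ ks'. kink k x)"
    by (simp add: inner_add_right)
  then show ?case by (intro exI)
qed

section \<open>Affinity along a convex ridge function\<close>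

context affine_invariant_valuation
begin

text \<open>On the hyperplane of one kink every parallel kink is constant. By locality and affine
  invariance parallel kinks do not interact, so their contributions add up.\<close>

lemma parallel_kinks_linear:
  assumes v: "v \<in> Conv" and "\<And>t j. (t, j) \<in> set ps \<Longrightarrow> 0 \<le> t"
  shows "(\<lambda>x. v x + (\<Sum>(t, j)\<leftarrow>ps. t * kink (a, j) x)) \<in> Conv \<and>
    Z (\<lambda>x. v x + (\<Sum>(t, j)\<leftarrow>ps. t * kink (a, j) x))
    = Z v + (\<Sum>(t, j)\<leftarrow>ps. t * (Z (\<lambda>x. v x + kink (a, j) x) - Z v))"
  using assms(2)
proof (induction ps)
  case (Cons p ps)
  obtain t j where p: "p = (t, j)" by (cases p)
  define S where "S = (\<lambda>x. \<Sum>(t, j)\<leftarrow>ps. t * kink (a, j) x)"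
  define u where "u = (\<lambda>x. v x + S x)"
  have u: "u \<in> Conv" and Zu: "Z u = Z v + (\<Sum>(t, j)\<leftarrow>ps. t * (Z (\<lambda>x. v x + kink (a, j) x) - Z v))"
    using Cons by (auto simp: u_def S_def)
  have t: "0 \<le> t" using Cons.prems p by auto
  define C where "C = (\<Sum>(t, i)\<leftarrow>ps. t * max 0 (j - i))"
  have "Z (\<lambda>x. u x + kink (a, j) x) - Z u = Z (\<lambda>x. (v x + (x \<bullet> 0 + C)) + kink (a, j) x) - Z (\<lambda>x. v x + (x \<bullet> 0 + C))"
  proof (rule kink_local[OF u])
    show "(\<lambda>x. v x + (x \<bullet> 0 + C)) \<in> Conv" by (intro Conv_add v Conv_affine)
    fix x assume "x \<bullet> fst (a, j) = snd (a, j)"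
    then show "u x = v x + (x \<bullet> 0 + C)" by (simp add: u_def S_def C_def kink_def)
  qed
  moreover have "Z (\<lambda>x. v x + (x \<bullet> 0 + C)) = Z v" by (intro affine v)
  moreover have "Z (\<lambda>x. (v x + (x \<bullet> 0 + C)) + kink (a, j) x) = Z (\<lambda>x. v x + kink (a, j) x)"
    by (rule affine'[where a=0 and b=C]) (auto intro: Conv_kink v)
  ultimately have "Z (\<lambda>x. u x + t * kink (a, j) x) = Z u + t * (Z (\<lambda>x. v x + kink (a, j) x) - Z v)"
    using kink_linear[OF u t, of "(a, j)"] by simp
  moreover have "(\<lambda>x. u x + t * kink (a, j) x) \<in> Conv" by (intro Conv_add Conv_scale kink_Conv u t)
  ultimately show ?case using Zu by (simp add: p u_def S_def add_ac)
qed (simp add: v)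

text \<open>On a finite set \<open>h (x \<bullet> a)\<close> is an affine function plus parallel
  kinks with nonnegative weights, for which \<open>Z\<close> is additive. Density then extends
  affinity in \<open>s\<close> from one kink to every convex ridge function.\<close>

lemma ridge_linear:
  assumes v: "v \<in> Conv" and h: "convex_on UNIV h" and s: "0 \<le> s"
  shows "Z (\<lambda>x. v x + s * h (x \<bullet> a)) = Z v + s * (Z (\<lambda>x. v x + h (x \<bullet> a)) - Z v)"
proof -
  define E where "E = (\<lambda>g. Z (\<lambda>x. v x + s * g x) - Z v - s * (Z (\<lambda>x. v x + g x) - Z v))"
  have "E (\<lambda>x. h (x \<bullet> a)) = 0"
  proof (rule Conv_continuous_eq_zero[OF _ Conv_ridge[OF h]])
    show "continuous_on Conv E"
      unfolding E_def using s
      by (intro continuous_intros continuous_map continuous_on_eval Conv_add v Conv_scale)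
    fix X :: "(real^'n) set" and e :: real assume X: "finite X" "e > 0"
    from ridge_interpolate_kinks[OF h X(1), of a] obtain c b ps where ps0: "\<forall>(t, j)\<in>set ps. 0 \<le> t"
      "\<forall>x\<in>X. h (x \<bullet> a) = x \<bullet> c + b + (\<Sum>(t, j)\<leftarrow>ps. t * kink (a, j) x)" by (elim exE conjE)
    define S where "S = (\<lambda>x. \<Sum>(t, j)\<leftarrow>ps. t * kink (a, j) x)"
    define D where "D = (\<Sum>(t, j)\<leftarrow>ps. t * (Z (\<lambda>x. v x + kink (a, j) x) - Z v))"
    define ps' where "ps' = map (\<lambda>(t, j). (s * t, j)) ps"
    have S': "(\<Sum>(t, j)\<leftarrow>ps'. t * kink (a, j) x) = s * S x" for x
      unfolding ps'_def S_def by (induction ps) (auto simp: distrib_left)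
    have D': "(\<Sum>(t, j)\<leftarrow>ps'. t * (Z (\<lambda>x. v x + kink (a, j) x) - Z v)) = s * D"
      unfolding ps'_def D_def by (induction ps) (auto simp: distrib_left)
    have pos: "0 \<le> t" if "(t, j) \<in> set ps" for t j using that ps0(1) by auto
    have pos': "0 \<le> t" if "(t, j) \<in> set ps'" for t j using that pos s by (auto simp: ps'_def)
    have S1: "(\<lambda>x. v x + S x) \<in> Conv" "Z (\<lambda>x. v x + S x) = Z v + D"
      using parallel_kinks_linear[OF v, where ps=ps and a=a, OF pos] unfolding S_def D_def by simp_all
    have S2: "(\<lambda>x. v x + s * S x) \<in> Conv" "Z (\<lambda>x. v x + s * S x) = Z v + s * D"
      using parallel_kinks_linear[OF v, where ps=ps' and a=a, OF pos'] unfolding S' D' by simp_all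
    have "S \<in> Conv"
      using parallel_kinks_linear[OF Conv_const[of 0], where ps=ps and a=a, OF pos] by (simp add: S_def)
    define w where "w = (\<lambda>x. S x + (x \<bullet> c + b))"
    have "Z (\<lambda>x. v x + s * w x) = Z v + s * D"
      unfolding S2(2)[symmetric]
      by (rule affine'[OF S2(1), of _ "s *\<^sub>R c" "s * b"]) (simp add: w_def distrib_left)
    moreover have "Z (\<lambda>x. v x + w x) = Z v + D"
      unfolding S1(2)[symmetric] by (rule affine'[OF S1(1), of _ c b]) (simp add: w_def)
    ultimately have "E w = 0" by (simp add: E_def)
    moreover have "w \<in> Conv" unfolding w_def by (intro Conv_add \<open>S \<in> Conv\<close> Conv_affine)
    moreover have "\<forall>x\<in>X. \<bar>w x - h (x \<bullet> a)\<bar> < e" using ps0(2) X(2) by (simp add: w_def S_def)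
    ultimately show "\<exists>w\<in>Conv. (\<forall>x\<in>X. \<bar>w x - h (x \<bullet> a)\<bar> < e) \<and> E w = 0" by blast
  qed
  then show ?thesis by (simp add: E_def)
qed

end

context simple_valuation
begin

lemma ridge_closure_zero:
  assumes p: "\<And>p. vertex p = 0" and v: "v \<in> Conv" "v \<in> ridge_closure"
  shows "Z v = 0"
proof (rule Conv_continuous_eq_zero[OF continuous v(1)])
  fix X :: "(real^'n) set" and e :: real assume X: "finite X" "e > 0"
  obtain s where s: "s \<in> ridge_sums" "\<forall>x\<in>X. \<bar>s x - v x\<bar> < e" using ridge_closureD[OF v(2) X] .
  from ridge_sums_interpolate_kinks[OF s(1) X(1)] obtain c b ks where
    ks: "\<forall>x\<in>X. s x = x \<bullet> c + b + (\<Sum>k\<leftarrow>ks. kink k x)" by (elim exE)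
  define u where "u = (\<lambda>x. (\<Sum>k\<leftarrow>ks. kink k x) + (x \<bullet> c + b))"
  have C: "(\<lambda>x. \<Sum>k\<leftarrow>ks. kink k x) \<in> Conv"
    by (induction ks) (auto intro: Conv_const Conv_add kink_Conv)
  have "u \<in> Conv" "Z u = 0"
    unfolding u_def affine[OF C] by (intro Conv_add[OF _ Conv_affine] C kink_sum_zero p)+
  moreover have "\<forall>x\<in>X. \<bar>u x - v x\<bar> < e" using s(2) ks by (simp add: u_def add_ac)
  ultimately show "\<exists>w\<in>Conv. (\<forall>x\<in>X. \<bar>w x - v x\<bar> < e) \<and> Z w = 0" by blast
qed

lemma quadratic_cancellation:
  assumes p: "\<And>p. vertex p = 0" and v: "v \<in> Conv"
    and C: "\<And>s. (\<And>i. C \<le> s i) \<Longrightarrow> (\<lambda>x. v x + (\<Sum>i\<in>UNIV. s i * (x $ i)\<^sup>2)) \<in> ridge_closure"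
  shows "Z v = 0"
proof -
  have sq: "convex_on UNIV (\<lambda>t::real. t\<^sup>2)" by (simp add: convex_power_even)
  have term_Conv: "(\<lambda>x::real^'n. c * (x $ i)\<^sup>2) \<in> Conv" if "0 \<le> c" for c i
    using Conv_scale[OF Conv_ridge[OF sq, of "axis i 1"] that] by (simp add: inner_axis)
  \<comment> \<open>The set \<open>I\<close> collects the coefficients already released from the
    bound \<open>C\<close>. Releasing one more uses that an affine function with zeros at two points
    \<open>m\<close> and \<open>m + 1\<close> is zero; \<open>I = UNIV\<close> allows all
    coefficients to be 0.\<close>
  have "Z (\<lambda>x. v x + (\<Sum>i\<in>UNIV. s i * (x $ i)\<^sup>2)) = 0"
    if "\<And>i. 0 \<le> s i" "\<And>i. i \<notin> I \<Longrightarrow> C \<le> s i" for I :: "'n set" and s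
  proof -
    have "finite I" by simp
    then show ?thesis using that
    proof (induction I arbitrary: s rule: finite_induct)
      case empty
      then show ?case
        by (intro ridge_closure_zero[OF p] C Conv_add v Conv_sum term_Conv) auto
    next
      case (insert j I)
      define u where "u = (\<lambda>x. v x + (\<Sum>i\<in>UNIV - {j}. s i * (x $ i)\<^sup>2))"
      have u: "u \<in> Conv" unfolding u_def using insert.prems by (intro Conv_add v Conv_sum term_Conv) auto
      define f where "f = (\<lambda>t. Z (\<lambda>x. u x + t * (x $ j)\<^sup>2))"
      have f_upd: "f t = Z (\<lambda>x. v x + (\<Sum>i\<in>UNIV. (s(j := t)) i * (x $ i)\<^sup>2))" for t
        by (simp add: f_def u_def sum.remove[of UNIV j] algebra_simps)
      have lin: "f t = f 0 + t * (f 1 - f 0)" if "0 \<le> t" for t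
        using ridge_linear[OF u sq that, of "axis j 1"] by (simp add: f_def inner_axis)
      have zero: "f t = 0" if "max 0 C \<le> t" for t
        unfolding f_upd by (rule insert.IH) (use insert.prems that in auto)
      define m where "m = max 0 C"
      have "f 0 + m * (f 1 - f 0) = 0" "f 0 + (m + 1) * (f 1 - f 0) = 0"
        using lin[of m] lin[of "m + 1"] zero[of m] zero[of "m + 1"] by (auto simp: m_def)
      then have "f 1 - f 0 = 0" by (simp add: algebra_simps)
      moreover from this \<open>f 0 + m * (f 1 - f 0) = 0\<close> have "f 0 = 0" by simp
      ultimately have "f (s j) = 0" using lin[of "s j"] insert.prems by simp
      then show ?case unfolding f_upd by simp
    qed
  qed
  from this[of "\<lambda>_. 0" UNIV] show ?thesis by simp
qed

end

section \<open>Gaussian mollification\<close>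

lemma integrable_exp_neg_square:
  fixes c :: real
  assumes c: "c > 0"
  shows "integrable lborel (\<lambda>t::real. exp (- c * t\<^sup>2))"
proof -
  have "integrable lborel (\<lambda>x. sqrt (pi / c) * (normal_density 0 (sqrt (1 / (2 * c))) x * (x - 0) ^ 0))"
    using c by (intro integrable_mult_right integrable_normal_moment) simp
  also have "(\<lambda>x. sqrt (pi / c) * (normal_density 0 (sqrt (1 / (2 * c))) x * (x - 0) ^ 0)) = (\<lambda>t::real. exp (- c * t\<^sup>2))"
    using c by (simp add: normal_density_def field_simps)
  finally show ?thesis .
qed

lemma integrable_gaussian:
  fixes c :: real
  assumes c: "c > 0"
  shows "integrable lborel (\<lambda>x::'a::euclidean_space. exp (- c * (norm x)\<^sup>2))"
proof (rule integrableI_bounded)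
  define I where "I = (\<integral>t. exp (- c * t\<^sup>2) \<partial>(lborel :: real measure))"
  have I: "(\<integral>\<^sup>+t. ennreal (exp (- c * t\<^sup>2)) \<partial>(lborel :: real measure)) = ennreal I"
    unfolding I_def by (intro nn_integral_eq_integral integrable_exp_neg_square c) simp
  have "(norm x)\<^sup>2 = (\<Sum>b\<in>Basis. (x \<bullet> b)\<^sup>2)" for x :: 'a
    unfolding power2_norm_eq_inner by (subst euclidean_inner) (simp add: power2_eq_square)
  then have "exp (- c * (norm x)\<^sup>2) = (\<Prod>b\<in>Basis. exp (- c * (x \<bullet> b)\<^sup>2))" for x :: 'a
    by (simp add: exp_sum[symmetric] sum_distrib_left sum_negf)
  then have "(\<integral>\<^sup>+x. ennreal (norm (exp (- c * (norm x)\<^sup>2))) \<partial>(lborel :: 'a measure))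
      = (\<integral>\<^sup>+x. (\<Prod>b\<in>Basis. ennreal (exp (- c * (x \<bullet> b)\<^sup>2))) \<partial>(lborel :: 'a measure))"
    by (simp add: prod_ennreal abs_prod)
  also have "\<dots> = (\<Prod>b\<in>(Basis::'a set). ennreal I)"
    by (subst nn_integral_lborel_prod) (simp_all add: I[simplified])
  also have "\<dots> < \<infinity>" by (simp add: ennreal_power[symmetric] I_def power_less_top_ennreal)
  finally show "(\<integral>\<^sup>+x. ennreal (norm (exp (- c * (norm x)\<^sup>2))) \<partial>(lborel :: 'a measure)) < \<infinity>" .
qed simp

definition gauss :: "'a::euclidean_space \<Rightarrow> real" where
  "gauss y = exp (- (norm y)\<^sup>2 / 2)"

lemma gauss_measurable [measurable]: "gauss \<in> borel_measurable borel"
  unfolding gauss_def by measurable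

lemma gauss_nonneg: "0 \<le> gauss y"
  by (simp add: gauss_def)

lemma integrable_gauss: "integrable lborel (gauss :: 'a::euclidean_space \<Rightarrow> real)"
  using integrable_gaussian[of "1 / 2", where 'a='a] by (simp add: gauss_def[abs_def])

lemma integrable_norm_gauss: "integrable lborel (\<lambda>x::'a::euclidean_space. norm x * gauss x)"
proof (rule Bochner_Integration.integrable_bound)
  \<comment> \<open>With \<open>t = norm x\<close>, use \<open>t \<le> exp t\<close> and
    \<open>t - t^2 / 2 \<le> 1 - t^2 / 4\<close>, which is
    \<open>(t / 2 - 1)^2 \<ge> 0\<close>.\<close>
  show "integrable lborel (\<lambda>x::'a. exp 1 * exp (- (1 / 4) * (norm x)\<^sup>2))"
    by (intro integrable_mult_right integrable_gaussian) simp
  have "norm x * gauss x \<le> exp 1 * exp (- (1 / 4) * (norm x)\<^sup>2)" for x :: 'a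
  proof -
    have "norm x \<le> exp (norm x)" using exp_ge_add_one_self[of "norm x"] by linarith
    then have "norm x * gauss x \<le> exp (norm x) * gauss x"
      by (rule mult_right_mono) (rule gauss_nonneg)
    also have "\<dots> = exp (norm x - (norm x)\<^sup>2 / 2)" by (simp add: gauss_def exp_add[symmetric])
    also have "\<dots> \<le> exp (1 + - (1 / 4) * (norm x)\<^sup>2)"
    proof -
      have "0 \<le> (norm x / 2 - 1)\<^sup>2" by simp
      then show ?thesis by (simp add: power2_eq_square algebra_simps)
    qed
    finally show ?thesis by (simp only: exp_add)
  qed
  then show "AE x::'a in lborel. norm (norm x * gauss x) \<le> norm (exp 1 * exp (- (1 / 4) * (norm x)\<^sup>2))"
    by (auto simp: abs_mult gauss_nonneg)
qed simp

lemma gauss_integral_pos: "(\<integral>y. gauss y \<partial>(lborel :: 'a::euclidean_space measure)) > 0"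
proof -
  have "(\<integral>y. gauss y \<partial>(lborel :: 'a measure)) \<noteq> 0"
  proof
    assume "(\<integral>y. gauss y \<partial>(lborel :: 'a measure)) = 0"
    then have "AE y in (lborel :: 'a measure). gauss y = 0"
      using integral_nonneg_eq_0_iff_AE[OF integrable_gauss[where 'a='a]] by (simp add: gauss_nonneg)
    then have "AE y in (lborel :: 'a measure). False" by (simp add: gauss_def)
    then show False
      using AE_iff_measurable[where N=UNIV and M="lborel :: 'a measure" and P="\<lambda>_. False"]
      by (simp add: emeasure_lborel_UNIV)
  qed
  moreover have "(\<integral>y. gauss y \<partial>(lborel :: 'a measure)) \<ge> 0" by (simp add: gauss_nonneg)
  ultimately show ?thesis by simp
qed

text \<open>Expanding the product into an average of cosines, each summand is made convex by half the square
  of its argument, and these squares average to the sum of the squares of the factors.\<close>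

lemma cos_prod_ridge:
  assumes "\<bar>\<epsilon>\<bar> \<le> 1"
  shows "(\<lambda>x. \<epsilon> * (cos (x \<bullet> c + \<theta>) * (\<Prod>(b, \<phi>)\<leftarrow>bs. cos (x \<bullet> b + \<phi>)))
    + ((x \<bullet> c + \<theta>)\<^sup>2 + (\<Sum>(b, \<phi>)\<leftarrow>bs. (x \<bullet> b + \<phi>)\<^sup>2)) / 2) \<in> ridge_sums"
proof (induction bs arbitrary: c \<theta>)
  case Nil
  have "convex_on UNIV (\<lambda>t. \<epsilon> * cos (t + \<theta>) + (t + \<theta>)\<^sup>2 / 2)"
  proof (rule f''_ge0_imp_convex)
    show "((\<lambda>t. \<epsilon> * cos (t + \<theta>) + (t + \<theta>)\<^sup>2 / 2) has_real_derivative - \<epsilon> * sin (t + \<theta>) + (t + \<theta>)) (at t)" for t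
      by (auto intro!: derivative_eq_intros)
    show "((\<lambda>t. - \<epsilon> * sin (t + \<theta>) + (t + \<theta>)) has_real_derivative - \<epsilon> * cos (t + \<theta>) + 1) (at t)" for t
      by (auto intro!: derivative_eq_intros)
    show "0 \<le> - \<epsilon> * cos (t + \<theta>) + 1" for t
    proof -
      have "\<bar>\<epsilon> * cos (t + \<theta>)\<bar> \<le> 1 * 1" unfolding abs_mult using assms by (intro mult_mono) auto
      then show ?thesis by linarith
    qed
  qed simp
  from ridge_sums.ridge[OF this, of c] show ?case by simp
next
  case (Cons p bs)
  obtain b \<phi> where p: "p = (b, \<phi>)" by (cases p)
  let ?P = "\<lambda>x. \<Prod>(b, \<phi>)\<leftarrow>bs. cos (x \<bullet> b + \<phi>)" and ?S = "\<lambda>x. \<Sum>(b, \<phi>)\<leftarrow>bs. (x \<bullet> b + \<phi>)\<^sup>2"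
  have eq: "\<epsilon> * (cos A * (cos B * P)) + (A\<^sup>2 + (B\<^sup>2 + S)) / 2
      = 1/2 * (\<epsilon> * (cos (A + B) * P) + ((A + B)\<^sup>2 + S) / 2) + 1/2 * (\<epsilon> * (cos (A - B) * P) + ((A - B)\<^sup>2 + S) / 2)"
    for A B P S :: real
    by (simp add: cos_add cos_diff power2_eq_square field_simps)
  have "(\<lambda>x. 1/2 * (\<epsilon> * (cos (x \<bullet> (c + b) + (\<theta> + \<phi>)) * ?P x) + ((x \<bullet> (c + b) + (\<theta> + \<phi>))\<^sup>2 + ?S x) / 2)
      + 1/2 * (\<epsilon> * (cos (x \<bullet> (c - b) + (\<theta> - \<phi>)) * ?P x) + ((x \<bullet> (c - b) + (\<theta> - \<phi>))\<^sup>2 + ?S x) / 2)) \<in> ridge_sums"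
    by (intro ridge_sums.add ridge_sums_scale Cons.IH) auto
  also have "(\<lambda>x. 1/2 * (\<epsilon> * (cos (x \<bullet> (c + b) + (\<theta> + \<phi>)) * ?P x) + ((x \<bullet> (c + b) + (\<theta> + \<phi>))\<^sup>2 + ?S x) / 2)
      + 1/2 * (\<epsilon> * (cos (x \<bullet> (c - b) + (\<theta> - \<phi>)) * ?P x) + ((x \<bullet> (c - b) + (\<theta> - \<phi>))\<^sup>2 + ?S x) / 2))
    = (\<lambda>x. \<epsilon> * (cos (x \<bullet> c + \<theta>) * (cos (x \<bullet> b + \<phi>) * ?P x)) + ((x \<bullet> c + \<theta>)\<^sup>2 + ((x \<bullet> b + \<phi>)\<^sup>2 + ?S x)) / 2)"
    unfolding eq by (simp add: inner_add_right inner_diff_right add_ac diff_add_eq add_diff_eq diff_diff_eq)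
  finally show ?case by (simp add: p)
qed

text \<open>The central limit theorem for random signs, whose characteristic function is the cosine.
  Evenness reduces it to positive \<open>t\<close>.\<close>

lemma cos_power_limit: "(\<lambda>N. cos (t / sqrt (real (Suc N))) ^ Suc N) \<longlonglongrightarrow> exp (- t\<^sup>2 / 2)"
proof -
  have *: "(\<lambda>N. cos (t / sqrt (real (Suc N))) ^ Suc N) \<longlonglongrightarrow> exp (- t\<^sup>2 / 2)" if "t > 0" for t :: real
  proof -
    have "(\<lambda>N. cos (t / sqrt (real (Suc N))) ^ Suc N) \<longlonglongrightarrow> exp (- (t * t / 2))"
      using that by real_asymp
    then show ?thesis by (simp add: power2_eq_square)
  qed
  consider "t > 0" | "t = 0" | "- t > 0" by linarith
  then show ?thesis
  proof cases
    case 3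
    from *[OF this] show ?thesis by simp
  qed (use * in auto)
qed

text \<open>Each coordinate contributes \<open>Suc N\<close> equal cosines with argument
  \<open>d x i / sqrt (Suc N)\<close>. The squared arguments sum to
  \<open>(k * norm (x - y))^2\<close> for every \<open>N\<close>, so the quadratic correction is
  fixed while the product tends to the Gaussian.\<close>

lemma gaussian_ridge_closure:
  assumes "\<bar>\<epsilon>\<bar> \<le> 1"
  shows "(\<lambda>x::real^'n. \<epsilon> * exp (- (k * norm (x - y))\<^sup>2 / 2) + (k * norm (x - y))\<^sup>2 / 2) \<in> ridge_closure"
proof (rule ridge_closure_limit)
  obtain js :: "'n list" where js: "set js = UNIV" "distinct js"
    using finite_distinct_list[of "UNIV :: 'n set"] by auto
  define d where "d = (\<lambda>(x::real^'n) i. k * (x $ i - y $ i))"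
  have nrm: "(k * norm (x - y))\<^sup>2 = (\<Sum>i\<in>UNIV. (d x i)\<^sup>2)" for x
    unfolding power_mult_distrib power2_norm_eq_inner inner_vec_def d_def
    by (simp add: power2_eq_square sum_distrib_left)
  define f where "f = (\<lambda>N x. \<epsilon> * (\<Prod>i\<in>UNIV. cos (d x i / sqrt (real (Suc N))) ^ Suc N) + (k * norm (x - y))\<^sup>2 / 2)"
  show "f N \<in> ridge_closure" for N
  proof -
    define r where "r = sqrt (real (Suc N))"
    have r: "r > 0" "r\<^sup>2 = real (Suc N)" by (auto simp: r_def)
    define g where "g = (\<lambda>i. (axis i (k / r), - k * y $ i / r) :: (real^'n) \<times> real)"
    define bs where "bs = concat (map (\<lambda>i. replicate (Suc N) (g i)) js)"
    have dx: "x \<bullet> fst (g i) + snd (g i) = d x i / r" for x i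
      by (simp add: g_def inner_axis d_def algebra_simps diff_divide_distrib)
    have "(\<Prod>(b, \<phi>)\<leftarrow>bs. cos (x \<bullet> b + \<phi>)) = (\<Prod>i\<leftarrow>js. cos (d x i / r) ^ Suc N)" for x
      unfolding bs_def by (induction js) (auto simp: case_prod_beta' dx prod_list_replicate map_replicate simp del: replicate_Suc)
    then have P: "(\<Prod>(b, \<phi>)\<leftarrow>bs. cos (x \<bullet> b + \<phi>)) = (\<Prod>i\<in>UNIV. cos (d x i / r) ^ Suc N)" for x
      using prod.distinct_set_conv_list[OF js(2)] js(1) by metis
    have "(\<Sum>(b, \<phi>)\<leftarrow>bs. (x \<bullet> b + \<phi>)\<^sup>2) = (\<Sum>i\<leftarrow>js. real (Suc N) * (d x i / r)\<^sup>2)" for x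
      unfolding bs_def by (induction js) (auto simp: case_prod_beta' dx sum_list_replicate map_replicate simp del: replicate_Suc)
    also have "(\<Sum>i\<leftarrow>js. real (Suc N) * (d x i / r)\<^sup>2) = (\<Sum>i\<leftarrow>js. (d x i)\<^sup>2)" for x
      using r by (simp add: power_divide del: of_nat_Suc)
    finally have S: "(\<Sum>(b, \<phi>)\<leftarrow>bs. (x \<bullet> b + \<phi>)\<^sup>2) = (k * norm (x - y))\<^sup>2" for x
      using sum.distinct_set_conv_list[OF js(2)] js(1) nrm by metis
    from cos_prod_ridge[OF assms, of 0 0 bs] have "f N \<in> ridge_sums"
      by (simp add: P S f_def r_def)
    then show ?thesis by (rule ridge_sums_closure)
  qed
  show "(\<lambda>N. f N x) \<longlonglongrightarrow> \<epsilon> * exp (- (k * norm (x - y))\<^sup>2 / 2) + (k * norm (x - y))\<^sup>2 / 2" for x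
  proof -
    have "exp (- (k * norm (x - y))\<^sup>2 / 2) = (\<Prod>i\<in>UNIV. exp (- (d x i)\<^sup>2 / 2))"
      by (simp add: exp_sum[symmetric] nrm sum_negf sum_divide_distrib)
    then show ?thesis
      unfolding f_def by (simp only:) (intro tendsto_intros cos_power_limit)
  qed
qed

text \<open>The previous lemma is applied at each \<open>z\<close> with sign
  \<open>sgn (\<psi> z)\<close> and weight \<open>\<bar>\<psi> z\<bar>\<close>, then integrated over
  \<open>z\<close>. The corrections integrate to a quadratic polynomial whose leading part is a
  multiple of \<open>(norm x)\<^sup>2\<close>, hence a combination of coordinate squares.\<close>

lemma gaussian_convolution_ridge_closure:
  fixes \<psi> :: "real^'n \<Rightarrow> real"
  assumes \<psi>: "continuous_on UNIV \<psi>"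
  obtains P m c where "(\<lambda>x. integral (cbox a b) (\<lambda>z. \<psi> z * exp (- (k * norm (x - z))\<^sup>2 / 2))
    + (P * (norm x)\<^sup>2 + (x \<bullet> m + c))) \<in> ridge_closure"
proof -
  define F where "F = (\<lambda>z x. \<psi> z * exp (- (k * norm (x - z))\<^sup>2 / 2) + k\<^sup>2 / 2 * (\<bar>\<psi> z\<bar> * (norm (x - z))\<^sup>2))"
  have F: "F z \<in> ridge_closure" for z
  proof -
    have "(\<lambda>x. \<bar>\<psi> z\<bar> * (sgn (\<psi> z) * exp (- (k * norm (x - z))\<^sup>2 / 2) + (k * norm (x - z))\<^sup>2 / 2)) \<in> ridge_closure"
      by (intro ridge_closure_scale gaussian_ridge_closure) (auto simp: sgn_if)
    also have "(\<lambda>x. \<bar>\<psi> z\<bar> * (sgn (\<psi> z) * exp (- (k * norm (x - z))\<^sup>2 / 2) + (k * norm (x - z))\<^sup>2 / 2)) = F z"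
      by (auto simp: F_def algebra_simps power_mult_distrib sgn_if)
    finally show ?thesis .
  qed
  note cont = continuous_on_subset[OF \<psi> subset_UNIV]
  define P where "P = integral (cbox a b) (\<lambda>z. \<bar>\<psi> z\<bar>)"
  define m where "m = integral (cbox a b) (\<lambda>z. \<bar>\<psi> z\<bar> *\<^sub>R z)"
  define c where "c = integral (cbox a b) (\<lambda>z. \<bar>\<psi> z\<bar> * (norm z)\<^sup>2)"
  have hP: "((\<lambda>z. \<bar>\<psi> z\<bar>) has_integral P) (cbox a b)"
    and hm: "((\<lambda>z. \<bar>\<psi> z\<bar> *\<^sub>R z) has_integral m) (cbox a b)"
    and hc: "((\<lambda>z. \<bar>\<psi> z\<bar> * (norm z)\<^sup>2) has_integral c) (cbox a b)"
    unfolding P_def m_def c_def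
    by (intro integrable_integral integrable_continuous continuous_intros cont)+
  have "((\<lambda>z. \<bar>\<psi> z\<bar> * (norm (x - z))\<^sup>2) has_integral (norm x)\<^sup>2 * P - 2 * (x \<bullet> m) + c) (cbox a b)" for x
  proof -
    have "((\<lambda>z. (norm x)\<^sup>2 * \<bar>\<psi> z\<bar> - 2 * (x \<bullet> (\<bar>\<psi> z\<bar> *\<^sub>R z)) + \<bar>\<psi> z\<bar> * (norm z)\<^sup>2) has_integral
       (norm x)\<^sup>2 * P - 2 * (x \<bullet> m) + c) (cbox a b)"
      using has_integral_linear[OF hm bounded_linear_inner_right[of x]]
      by (intro has_integral_add has_integral_diff has_integral_mult_right hP hc) (simp add: o_def)
    then show ?thesis
      by (rule has_integral_eq[rotated])
        (simp add: power2_norm_eq_inner inner_diff_left inner_diff_right inner_commute algebra_simps)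
  qed
  from has_integral_mult_right[OF this, of "k\<^sup>2 / 2"]
  have "((\<lambda>z. F z x) has_integral integral (cbox a b) (\<lambda>z. \<psi> z * exp (- (k * norm (x - z))\<^sup>2 / 2))
      + k\<^sup>2 / 2 * ((norm x)\<^sup>2 * P - 2 * (x \<bullet> m) + c)) (cbox a b)" for x
    unfolding F_def
    by (intro has_integral_add integrable_integral integrable_continuous continuous_intros cont) auto
  from ridge_closure_integral[OF F this] 
  have *: "(\<lambda>x. integral (cbox a b) (\<lambda>z. \<psi> z * exp (- (k * norm (x - z))\<^sup>2 / 2))
      + k\<^sup>2 / 2 * ((norm x)\<^sup>2 * P - 2 * (x \<bullet> m) + c)) \<in> ridge_closure" .
  have "k\<^sup>2 / 2 * ((norm x)\<^sup>2 * P - 2 * (x \<bullet> m) + c)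
    = (k\<^sup>2 / 2 * P) * (norm x)\<^sup>2 + (x \<bullet> (- k\<^sup>2 *\<^sub>R m) + k\<^sup>2 / 2 * c)" for x
    by (simp add: algebra_simps)
  with * have "(\<lambda>x. integral (cbox a b) (\<lambda>z. \<psi> z * exp (- (k * norm (x - z))\<^sup>2 / 2))
    + ((k\<^sup>2 / 2 * P) * (norm x)\<^sup>2 + (x \<bullet> (- k\<^sup>2 *\<^sub>R m) + k\<^sup>2 / 2 * c))) \<in> ridge_closure" by (simp only:)
  then show ?thesis by (rule that)
qed

lemma lborel_integral_affine:
  fixes F :: "'a::euclidean_space \<Rightarrow> real"
  assumes [measurable]: "F \<in> borel_measurable borel" and "c \<noteq> 0"
  shows "(\<integral>x. F x \<partial>lborel) = \<bar>c\<bar> ^ DIM('a) * (\<integral>x. F (t + c *\<^sub>R x) \<partial>lborel)"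
  by (subst lborel_affine[OF assms(2), of t]) (simp add: integral_density integral_distr)

lemma convex_on_integral:
  fixes f :: "'b \<Rightarrow> 'a::real_vector \<Rightarrow> real"
  assumes "\<And>y. convex_on UNIV (f y)" "\<And>y. 0 \<le> G y" and int: "\<And>t. integrable M (\<lambda>y. f y t * G y)"
  shows "convex_on UNIV (\<lambda>t. \<integral>y. f y t * G y \<partial>M)"
proof (rule convex_onI)
  fix t :: real and x y :: 'a assume t: "0 < t" "t < 1"
  have "(\<integral>z. f z ((1 - t) *\<^sub>R x + t *\<^sub>R y) * G z \<partial>M) \<le> (\<integral>z. (1 - t) * (f z x * G z) + t * (f z y * G z) \<partial>M)"
  proof (rule integral_mono)
    fix z
    have "f z ((1 - t) *\<^sub>R x + t *\<^sub>R y) * G z \<le> ((1 - t) * f z x + t * f z y) * G z"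
      using convex_onD[OF assms(1)] assms(2) t by (intro mult_right_mono) auto
    then show "f z ((1 - t) *\<^sub>R x + t *\<^sub>R y) * G z \<le> (1 - t) * (f z x * G z) + t * (f z y * G z)"
      by (simp add: algebra_simps)
  qed (intro int Bochner_Integration.integrable_add integrable_mult_right)+
  also have "\<dots> = (1 - t) * (\<integral>z. f z x * G z \<partial>M) + t * (\<integral>z. f z y * G z \<partial>M)"
    by (simp add: int)
  finally show "(\<integral>z. f z ((1 - t) *\<^sub>R x + t *\<^sub>R y) * G z \<partial>M)
    \<le> (1 - t) * (\<integral>z. f z x * G z \<partial>M) + t * (\<integral>z. f z y * G z \<partial>M)" .
qed simp

lemma convex_on_abs_affine: "convex_on UNIV (\<lambda>t::real. \<bar>t - c\<bar>)"
proof (rule convex_onI)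
  fix t x y :: real assume t: "0 < t" "t < 1"
  have "(1 - t) *\<^sub>R x + t *\<^sub>R y - c = (1 - t) * (x - c) + t * (y - c)" by (simp add: algebra_simps)
  also have "\<bar>\<dots>\<bar> \<le> (1 - t) * \<bar>x - c\<bar> + t * \<bar>y - c\<bar>"
    using abs_triangle_ineq[of "(1 - t) * (x - c)" "t * (y - c)"] t by (simp add: abs_mult)
  finally show "\<bar>(1 - t) *\<^sub>R x + t *\<^sub>R y - c\<bar> \<le> (1 - t) * \<bar>x - c\<bar> + t * \<bar>y - c\<bar>" .
qed simp

lemma integrable_Lipschitz_gauss:
  fixes f :: "'a::euclidean_space \<Rightarrow> real"
  assumes f: "f \<in> borel_measurable borel" and lip: "\<And>x y. \<bar>f x - f y\<bar> \<le> K * norm (x - y)"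
  shows "integrable lborel (\<lambda>y. f (x - c *\<^sub>R y) * gauss y)"
proof (rule Bochner_Integration.integrable_bound)
  show "integrable lborel (\<lambda>y::'a. \<bar>f x\<bar> * gauss y + K * \<bar>c\<bar> * (norm y * gauss y))"
    by (intro Bochner_Integration.integrable_add integrable_mult_right integrable_gauss integrable_norm_gauss)
  show "(\<lambda>y. f (x - c *\<^sub>R y) * gauss y) \<in> borel_measurable lborel"
    using f by measurable
  have "norm (f (x - c *\<^sub>R y) * gauss y) \<le> norm (\<bar>f x\<bar> * gauss y + K * \<bar>c\<bar> * (norm y * gauss y))" for y
  proof -
    have "\<bar>f (x - c *\<^sub>R y)\<bar> \<le> \<bar>f x\<bar> + K * \<bar>c\<bar> * norm y"
      using lip[of "x - c *\<^sub>R y" x] by (simp add: mult.assoc)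
    then have "\<bar>f (x - c *\<^sub>R y)\<bar> * gauss y \<le> (\<bar>f x\<bar> + K * \<bar>c\<bar> * norm y) * gauss y"
      by (rule mult_right_mono) (rule gauss_nonneg)
    then show ?thesis by (simp add: abs_mult gauss_nonneg distrib_right mult.assoc)
  qed
  then show "AE y in lborel. norm (f (x - c *\<^sub>R y) * gauss y)
    \<le> norm (\<bar>f x\<bar> * gauss y + K * \<bar>c\<bar> * (norm y * gauss y))" by simp
qed

text \<open>Convolution with a normalised Gaussian of width \<open>1 / k\<close>. The shift is put
  on \<open>v\<close>, so that convexity passes through the integral directly.\<close>

definition mollify :: "real \<Rightarrow> ('a::euclidean_space \<Rightarrow> real) \<Rightarrow> 'a \<Rightarrow> real" where
  "mollify k v x = (\<integral>y. v (x - (1 / k) *\<^sub>R y) * gauss y \<partial>lborel) / (\<integral>y. gauss y \<partial>(lborel :: 'a measure))"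

lemma mollify_Conv:
  fixes v :: "real^'n \<Rightarrow> real"
  assumes v: "v \<in> Conv" and lip: "\<And>x y. \<bar>v x - v y\<bar> \<le> K * norm (x - y)"
  shows "mollify k v \<in> Conv"
proof -
  have "v \<in> borel_measurable borel" using Conv_continuous[OF v] by (rule borel_measurable_continuous_onI)
  then have "convex_on UNIV (\<lambda>x. \<integral>y. v (x - (1 / k) *\<^sub>R y) * gauss y \<partial>lborel)"
    using Conv_translate[OF v] unfolding Conv_def
    by (intro convex_on_integral[where f="\<lambda>y x. v (x - (1 / k) *\<^sub>R y)"] gauss_nonneg
        integrable_Lipschitz_gauss[OF _ lip]) auto
  then show ?thesis
    unfolding mollify_def[abs_def] Conv_def using gauss_integral_pos[where 'a="real^'n"] by (auto intro!: convex_on_cdiv)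
qed

lemma mollify_tendsto:
  fixes v :: "'a::euclidean_space \<Rightarrow> real"
  assumes m: "v \<in> borel_measurable borel" and lip: "\<And>x y. \<bar>v x - v y\<bar> \<le> K * norm (x - y)"
  shows "(\<lambda>n. mollify (real (Suc n)) v x) \<longlonglongrightarrow> v x"
proof -
  define \<gamma> where "\<gamma> = (\<integral>y. gauss y \<partial>(lborel :: 'a measure))"
  define m1 where "m1 = (\<integral>y. norm y * gauss y \<partial>(lborel :: 'a measure))"
  have \<gamma>: "\<gamma> > 0" unfolding \<gamma>_def by (rule gauss_integral_pos)
  have close: "\<bar>mollify k v x - v x\<bar> \<le> (K * m1 / \<gamma>) / k" if k: "k > 0" for k
  proof -
    note int = integrable_Lipschitz_gauss[OF m lip]
    have "mollify k v x - v x = ((\<integral>y. v (x - (1 / k) *\<^sub>R y) * gauss y \<partial>lborel) - (\<integral>y. v x * gauss y \<partial>(lborel :: 'a measure))) / \<gamma>"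
      using \<gamma> by (simp add: mollify_def \<gamma>_def[symmetric] diff_divide_distrib)
    also have "(\<integral>y. v (x - (1 / k) *\<^sub>R y) * gauss y \<partial>lborel) - (\<integral>y. v x * gauss y \<partial>(lborel :: 'a measure))
      = (\<integral>y. v (x - (1 / k) *\<^sub>R y) * gauss y - v x * gauss y \<partial>lborel)"
      by (intro Bochner_Integration.integral_diff[symmetric] int integrable_mult_right integrable_gauss)
    finally have "\<bar>mollify k v x - v x\<bar> = \<bar>\<integral>y. v (x - (1 / k) *\<^sub>R y) * gauss y - v x * gauss y \<partial>lborel\<bar> / \<gamma>"
      using \<gamma> by simp
    also have "\<bar>\<integral>y. v (x - (1 / k) *\<^sub>R y) * gauss y - v x * gauss y \<partial>lborel\<bar> \<le> (\<integral>y. (K / k) * (norm y * gauss y) \<partial>(lborel :: 'a measure))"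
    proof -
      have "norm (v (x - (1 / k) *\<^sub>R y) * gauss y - v x * gauss y) \<le> (K / k) * (norm y * gauss y)" for y
      proof -
        have "\<bar>v (x - (1 / k) *\<^sub>R y) - v x\<bar> * gauss y \<le> (K * norm ((x - (1 / k) *\<^sub>R y) - x)) * gauss y"
          by (intro mult_right_mono lip gauss_nonneg)
        then show ?thesis using k gauss_nonneg[of y] by (simp add: abs_mult left_diff_distrib[symmetric])
      qed
      then show ?thesis
        using Bochner_Integration.integral_norm_bound_integral[where M=lborel and g="\<lambda>y. (K / k) * (norm y * gauss y)"
            and f="\<lambda>y. v (x - (1 / k) *\<^sub>R y) * gauss y - v x * gauss y"]
        by (simp add: int integrable_gauss integrable_norm_gauss integrable_mult_right)
    qed
    also have "(\<integral>y. (K / k) * (norm y * gauss y) \<partial>(lborel :: 'a measure)) = K / k * m1" by (simp add: m1_def)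
    finally show ?thesis using \<gamma> by (simp add: divide_right_mono field_simps)
  qed
  have "(\<lambda>n. (K * m1 / \<gamma>) * inverse (real (Suc n))) \<longlonglongrightarrow> (K * m1 / \<gamma>) * 0"
    by (intro tendsto_mult tendsto_const LIMSEQ_inverse_real_of_nat)
  then have "(\<lambda>n. (K * m1 / \<gamma>) / real (Suc n)) \<longlonglongrightarrow> 0" by (simp add: divide_inverse)
  then have "(\<lambda>n. mollify (real (Suc n)) v x - v x) \<longlonglongrightarrow> 0"
    by (rule Lim_null_comparison[rotated]) (use close in \<open>auto intro!: always_eventually\<close>)
  then show ?thesis by (rule LIM_zero_cancel)
qed

text \<open>The substitution \<open>z = x - y / k\<close> moves the dependence on \<open>x\<close>
  from \<open>\<psi>\<close> to the Gaussian, and the domain shrinks to the box. This is the form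
  that \<open>gaussian_convolution_ridge_closure\<close> handles.\<close>

lemma mollify_compact_support:
  fixes \<psi> :: "'a::euclidean_space \<Rightarrow> real"
  assumes \<psi>: "continuous_on UNIV \<psi>" "\<And>x. x \<notin> cbox a b \<Longrightarrow> \<psi> x = 0" and k: "k > 0"
  shows "mollify k \<psi> x = k ^ DIM('a) / (\<integral>y. gauss y \<partial>(lborel :: 'a measure))
    * integral (cbox a b) (\<lambda>z. \<psi> z * exp (- (k * norm (x - z))\<^sup>2 / 2))"
proof -
  define F where "F = (\<lambda>z. \<psi> z * exp (- (k * norm (x - z))\<^sup>2 / 2))"
  have contF: "continuous_on UNIV F" unfolding F_def by (intro continuous_intros \<psi>) auto
  have F0: "F z = 0" if "z \<notin> cbox a b" for z using \<psi>(2)[OF that] by (simp add: F_def)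
  have "integrable lborel (\<lambda>z. indicator (cbox a b) z *\<^sub>R F z)"
    by (rule borel_integrable_compact[OF compact_cbox continuous_on_subset[OF contF]]) simp
  moreover have "(\<lambda>z. indicator (cbox a b) z *\<^sub>R F z) = F"
    using F0 by (auto simp: indicator_def fun_eq_iff)
  ultimately have "(\<integral>z. F z \<partial>lborel) = integral UNIV F" by (simp add: integral_lborel)
  also have "\<dots> = integral (cbox a b) F"
  proof -
    have "F = (\<lambda>z. if z \<in> cbox a b then F z else 0)" using F0 by (auto simp: fun_eq_iff)
    then show ?thesis by (metis integral_restrict_UNIV)
  qed
  also have "(\<integral>z. F z \<partial>lborel) = (1 / k) ^ DIM('a) * (\<integral>y. F (x + (- 1 / k) *\<^sub>R y) \<partial>lborel)"
    using k by (subst lborel_integral_affine[of F "- 1 / k" x])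
      (auto intro: borel_measurable_continuous_onI contF)
  also have "(\<lambda>y. F (x + (- 1 / k) *\<^sub>R y)) = (\<lambda>y. \<psi> (x - (1 / k) *\<^sub>R y) * gauss y)"
    using k by (simp add: F_def gauss_def)
  finally have "k ^ DIM('a) * ((1 / k) ^ DIM('a) * (\<integral>y. \<psi> (x - (1 / k) *\<^sub>R y) * gauss y \<partial>lborel))
      = k ^ DIM('a) * integral (cbox a b) F" by simp
  then have "(\<integral>y. \<psi> (x - (1 / k) *\<^sub>R y) * gauss y \<partial>lborel) = k ^ DIM('a) * integral (cbox a b) F"
    using k by (simp add: power_one_over)
  then show ?thesis by (simp add: mollify_def F_def)
qed

text \<open>Averaging translates of \<open>\<bar>x $ i\<bar>\<close> yields a convex function of
  \<open>x $ i\<close> alone, so the mollified l1-norm remains a sum of ridge functions along the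
  axes.\<close>

lemma mollify_l1:
  fixes L M k :: real
  obtains h where "\<And>i::'n. convex_on UNIV (h i)"
    "\<And>x::real^'n. mollify k (\<lambda>x. L * (\<Sum>i\<in>UNIV. \<bar>x $ i\<bar>) - M) x = L * (\<Sum>i\<in>UNIV. h i (x $ i)) - M"
    "\<And>x::real^'n. integrable lborel (\<lambda>y. (L * (\<Sum>i\<in>UNIV. \<bar>(x - (1 / k) *\<^sub>R y) $ i\<bar>) - M) * gauss y)"
proof -
  define \<gamma> where "\<gamma> = (\<integral>y. gauss y \<partial>(lborel :: (real^'n) measure))"
  have \<gamma>: "\<gamma> > 0" unfolding \<gamma>_def by (rule gauss_integral_pos)
  have int: "integrable lborel (\<lambda>y :: real^'n. \<bar>t - (1 / k) * y $ i\<bar> * gauss y)" for t i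
  proof -
    have "\<bar>\<bar>x $ i\<bar> - \<bar>y $ i\<bar>\<bar> \<le> 1 * norm (x - y)" for x y :: "real^'n"
      using component_le_norm_cart[of "x - y" i] by simp
    then have "integrable lborel (\<lambda>y. \<bar>((\<chi> j. t) - (1 / k) *\<^sub>R y) $ i\<bar> * gauss y)"
      by (intro integrable_Lipschitz_gauss[where f="\<lambda>x. \<bar>x $ i\<bar>"]
        borel_measurable_continuous_onI continuous_intros)
    then show ?thesis by simp
  qed
  define h where "h = (\<lambda>i t. (\<integral>y. \<bar>t - (1 / k) * y $ i\<bar> * gauss y \<partial>(lborel :: (real^'n) measure)) / \<gamma>)"
  have eq: "(L * (\<Sum>i\<in>UNIV. \<bar>(x - (1 / k) *\<^sub>R y) $ i\<bar>) - M) * gauss y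
    = L * (\<Sum>i\<in>UNIV. \<bar>x $ i - (1 / k) * y $ i\<bar> * gauss y) - M * gauss y" for x y :: "real^'n"
    by (simp add: left_diff_distrib sum_distrib_right)
  show ?thesis
  proof (rule that[of h])
    show "convex_on UNIV (h i)" for i
      unfolding h_def using \<gamma>
      by (intro convex_on_cdiv convex_on_integral[where f="\<lambda>y t. \<bar>t - (1 / k) * y $ i\<bar>"]
          convex_on_abs_affine gauss_nonneg int) auto
    show "integrable lborel (\<lambda>y. (L * (\<Sum>i\<in>UNIV. \<bar>(x - (1 / k) *\<^sub>R y) $ i\<bar>) - M) * gauss y)" for x :: "real^'n"
      unfolding eq by (intro Bochner_Integration.integrable_diff integrable_mult_right
          Bochner_Integration.integrable_sum int integrable_gauss)
    fix x :: "real^'n"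
    have "(\<integral>y. (L * (\<Sum>i\<in>UNIV. \<bar>(x - (1 / k) *\<^sub>R y) $ i\<bar>) - M) * gauss y \<partial>lborel)
      = (\<integral>y. L * (\<Sum>i\<in>UNIV. \<bar>x $ i - (1 / k) * y $ i\<bar> * gauss y) \<partial>lborel) - (\<integral>y. M * gauss y \<partial>(lborel :: (real^'n) measure))"
      unfolding eq by (intro Bochner_Integration.integral_diff integrable_mult_right
          Bochner_Integration.integrable_sum int integrable_gauss)
    also have "(\<integral>y. L * (\<Sum>i\<in>UNIV. \<bar>x $ i - (1 / k) * y $ i\<bar> * gauss y) \<partial>lborel)
      = L * (\<Sum>i\<in>UNIV. (\<integral>y. \<bar>x $ i - (1 / k) * y $ i\<bar> * gauss y \<partial>lborel))"
      by (subst integral_mult_right_zero, subst Bochner_Integration.integral_sum) (rule int, rule refl)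
    also have "\<dots> = \<gamma> * (L * (\<Sum>i\<in>UNIV. h i (x $ i)))"
      using \<gamma> by (simp add: h_def sum_divide_distrib[symmetric])
    also have "(\<integral>y. M * gauss y \<partial>(lborel :: (real^'n) measure)) = \<gamma> * M" by (simp add: \<gamma>_def)
    finally show "mollify k (\<lambda>x. L * (\<Sum>i\<in>UNIV. \<bar>x $ i\<bar>) - M) x = L * (\<Sum>i\<in>UNIV. h i (x $ i)) - M"
      unfolding mollify_def \<gamma>_def[symmetric] using \<gamma> by (simp add: right_diff_distrib[symmetric])
  qed
qed

context affine_invariant_valuation
begin

lemma sequential:
  assumes "\<And>n. f n \<in> Conv" "v \<in> Conv" "\<And>x. (\<lambda>n. f n x) \<longlonglongrightarrow> v x"
  shows "(\<lambda>n. Z (f n)) \<longlonglongrightarrow> Z v"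
  unfolding tendsto_iff
proof (intro allI impI)
  fix e :: real assume "e > 0"
  from continuous_on_Conv_finite[OF continuous assms(2) this] obtain X d where X: "finite X" "d > 0"
    "\<forall>w\<in>Conv. (\<forall>x\<in>X. \<bar>w x - v x\<bar> < d) \<longrightarrow> dist (Z w) (Z v) < e" by (elim exE conjE)
  have "\<forall>x\<in>X. eventually (\<lambda>n. \<bar>f n x - v x\<bar> < d) sequentially"
    using assms(3) X(2) unfolding tendsto_iff dist_real_def by simp
  then have "eventually (\<lambda>n. \<forall>x\<in>X. \<bar>f n x - v x\<bar> < d) sequentially"
    using X(1) by (simp add: eventually_ball_finite)
  then show "eventually (\<lambda>n. dist (Z (f n)) (Z v) < e) sequentially"
    by (rule eventually_mono) (simp add: X(3) assms(1))
qed

end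

context simple_valuation
begin

text \<open>Split \<open>v\<close> into its l1 part \<open>A\<close> and a compactly supported
  remainder \<open>\<psi>\<close>. Mollification turns the first into a ridge sum and the second
  into \<open>N * J\<close>, which lies in the closure after a quadratic is added. \<open>Z\<close>
  vanishes on every mollification, hence at the limit \<open>v\<close>.\<close>

lemma l1_outside_compact_zero:
  fixes v :: "real^'n \<Rightarrow> real"
  assumes p: "\<And>p. vertex p = 0" and v: "v \<in> Conv"
    and lip: "\<And>x y. \<bar>v x - v y\<bar> \<le> K * norm (x - y)"
    and L: "L \<ge> 0" and out: "\<And>x. x \<notin> cbox a b \<Longrightarrow> v x = L * (\<Sum>i\<in>UNIV. \<bar>x $ i\<bar>) - M"
  shows "Z v = 0"
proof -
  define A where "A = (\<lambda>x::real^'n. L * (\<Sum>i\<in>UNIV. \<bar>x $ i\<bar>) - M)"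
  define \<psi> where "\<psi> = (\<lambda>x. v x - A x)"
  have contv: "continuous_on UNIV v" by (rule Conv_continuous[OF v])
  have cont\<psi>: "continuous_on UNIV \<psi>" unfolding \<psi>_def A_def by (intro continuous_intros contv)
  have v_meas: "v \<in> borel_measurable borel" using contv by (rule borel_measurable_continuous_onI)
  have \<psi>0: "\<psi> x = 0" if "x \<notin> cbox a b" for x using out[OF that] by (simp add: \<psi>_def A_def)
  have Zf: "Z (mollify k v) = 0" if k: "k > 0" for k
  proof -
    define N where "N = k ^ DIM(real^'n) / (\<integral>y. gauss y \<partial>(lborel :: (real^'n) measure))"
    have N: "N \<ge> 0" using k gauss_integral_pos[where 'a="real^'n"] by (simp add: N_def)
    define J where "J = (\<lambda>x. integral (cbox a b) (\<lambda>z. \<psi> z * exp (- (k * norm (x - z))\<^sup>2 / 2)))"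
    obtain h where h: "\<And>i::'n. convex_on UNIV (h i)"
      and h_eq: "\<And>x. mollify k A x = L * (\<Sum>i\<in>UNIV. h i (x $ i)) - M"
      and intA: "\<And>x. integrable lborel (\<lambda>y. A (x - (1 / k) *\<^sub>R y) * gauss y)"
      unfolding A_def using mollify_l1[where 'n='n, of k L M] by blast
    have f_eq: "mollify k v x = N * J x + (L * (\<Sum>i\<in>UNIV. h i (x $ i)) - M)" for x
    proof -
      have "(\<integral>y. v (x - (1 / k) *\<^sub>R y) * gauss y \<partial>lborel) - (\<integral>y. A (x - (1 / k) *\<^sub>R y) * gauss y \<partial>lborel)
        = (\<integral>y. \<psi> (x - (1 / k) *\<^sub>R y) * gauss y \<partial>lborel)"
        unfolding \<psi>_def left_diff_distrib
        by (intro Bochner_Integration.integral_diff[symmetric] integrable_Lipschitz_gauss[OF v_meas lip] intA)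
      then have "mollify k v x - mollify k A x = mollify k \<psi> x"
        by (simp add: mollify_def diff_divide_distrib[symmetric])
      then show ?thesis
        using mollify_compact_support[OF cont\<psi> \<psi>0 k, of a b x] h_eq[of x] by (simp add: N_def J_def)
    qed
    obtain P m c where Pmc: "(\<lambda>x. J x + (P * (norm x)\<^sup>2 + (x \<bullet> m + c))) \<in> ridge_closure"
      unfolding J_def using gaussian_convolution_ridge_closure[OF cont\<psi>] .
    show ?thesis
    proof (rule quadratic_cancellation[OF p mollify_Conv[OF v lip], where C="N * P"])
      fix s :: "'n \<Rightarrow> real" assume s: "\<And>i. N * P \<le> s i"
      have sq: "(\<lambda>x::real^'n. (s i - N * P) * (x $ i)\<^sup>2) \<in> ridge_closure" for i
        using ridge_closure_scale[OF ridge_closure_ridge[of "\<lambda>t. t\<^sup>2" "axis i 1"], of "s i - N * P"] s[of i]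
        by (simp add: convex_power_even inner_axis)
      have hi: "(\<lambda>x::real^'n. h i (x $ i)) \<in> ridge_closure" for i
        using ridge_closure_ridge[OF h, of i "axis i 1"] by (simp add: inner_axis)
      \<comment> \<open>The threshold \<open>N * P\<close> is the curvature consumed by the
        correction of \<open>N * J\<close>; the surplus \<open>s i - N * P\<close> is nonnegative
        and contributes ridge functions. The last affine term compensates \<open>m\<close>,
        \<open>c\<close> and \<open>M\<close>.\<close>
      have "(\<lambda>x. (N * (J x + (P * (norm x)\<^sup>2 + (x \<bullet> m + c))) + (\<Sum>i\<in>UNIV. (s i - N * P) * (x $ i)\<^sup>2))
         + (L * (\<Sum>i\<in>UNIV. h i (x $ i)) + (x \<bullet> (- N *\<^sub>R m) + (- N * c - M)))) \<in> ridge_closure"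
        by (intro ridge_closure_add ridge_closure_scale ridge_closure_sum Pmc sq hi ridge_closure_affine N L) auto
      also have "(\<lambda>x. (N * (J x + (P * (norm x)\<^sup>2 + (x \<bullet> m + c))) + (\<Sum>i\<in>UNIV. (s i - N * P) * (x $ i)\<^sup>2))
         + (L * (\<Sum>i\<in>UNIV. h i (x $ i)) + (x \<bullet> (- N *\<^sub>R m) + (- N * c - M))))
        = (\<lambda>x. mollify k v x + (\<Sum>i\<in>UNIV. s i * (x $ i)\<^sup>2))"
      proof
        fix x :: "real^'n"
        have "(norm x)\<^sup>2 = (\<Sum>i\<in>UNIV. (x $ i)\<^sup>2)"
          unfolding power2_norm_eq_inner inner_vec_def by (simp add: power2_eq_square)
        then have "(\<Sum>i\<in>UNIV. (s i - N * P) * (x $ i)\<^sup>2) = (\<Sum>i\<in>UNIV. s i * (x $ i)\<^sup>2) - N * P * (norm x)\<^sup>2"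
          by (simp add: left_diff_distrib sum_subtractf sum_distrib_left)
        then show "(N * (J x + (P * (norm x)\<^sup>2 + (x \<bullet> m + c))) + (\<Sum>i\<in>UNIV. (s i - N * P) * (x $ i)\<^sup>2))
         + (L * (\<Sum>i\<in>UNIV. h i (x $ i)) + (x \<bullet> (- N *\<^sub>R m) + (- N * c - M)))
         = mollify k v x + (\<Sum>i\<in>UNIV. s i * (x $ i)\<^sup>2)"
          unfolding f_eq by (simp add: algebra_simps)
      qed
      finally show "(\<lambda>x. mollify k v x + (\<Sum>i\<in>UNIV. s i * (x $ i)\<^sup>2)) \<in> ridge_closure" .
    qed
  qed
  have "(\<lambda>n. Z (mollify (real (Suc n)) v)) \<longlonglongrightarrow> Z v"
    by (rule sequential[OF mollify_Conv[OF v lip] v mollify_tendsto[OF v_meas lip]])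
  then show ?thesis using Zf by (simp add: LIMSEQ_const_iff)
qed

theorem vertex_zero_imp_zero:
  assumes p: "\<And>p. vertex p = 0" and v: "v \<in> Conv"
  shows "Z v = 0"
proof (rule Conv_continuous_eq_zero[OF continuous v])
  fix X :: "(real^'n) set" and e :: real assume X: "finite X" "e > 0"
  obtain w K where w: "w \<in> Conv" "\<And>x. x \<in> X \<Longrightarrow> w x = v x" "K \<ge> 0"
    "\<And>x y. \<bar>w x - w y\<bar> \<le> K * norm (x - y)"
    using Conv_interpolate_Lipschitz[OF v X(1)] by metis
  define S where "S = (\<lambda>x::real^'n. \<Sum>i\<in>UNIV. \<bar>x $ i\<bar>)"
  \<comment> \<open>The slope exceeds the Lipschitz constant of \<open>w\<close>, so
    \<open>L * S x - M\<close> wins far out, as \<open>norm x \<le> S x\<close>. The size of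
    \<open>M\<close> pushes it below \<open>w\<close> on \<open>X\<close>, where the maximum
    therefore keeps the prescribed values.\<close>
  define L where "L = K + 1"
  define M where "M = (\<Sum>x\<in>X. \<bar>L * S x - w x\<bar>)"
  define u where "u = (\<lambda>x. max (w x) (L * S x - M))"
  have S: "norm x \<le> S x" for x unfolding S_def by (rule norm_le_l1_cart)
  have Slip: "\<bar>S x - S y\<bar> \<le> real CARD('n) * norm (x - y)" for x y
  proof -
    have "\<bar>S x - S y\<bar> \<le> (\<Sum>i\<in>UNIV. \<bar>\<bar>x $ i\<bar> - \<bar>y $ i\<bar>\<bar>)"
      unfolding S_def sum_subtractf[symmetric] by (rule sum_abs)
    also have "\<dots> \<le> (\<Sum>i\<in>(UNIV::'n set). norm (x - y))"
    proof (rule sum_mono)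
      show "\<bar>\<bar>x $ i\<bar> - \<bar>y $ i\<bar>\<bar> \<le> norm (x - y)" for i
        using component_le_norm_cart[of "x - y" i] by simp
    qed
    finally show ?thesis by simp
  qed
  have SC: "S \<in> Conv"
    unfolding S_def
  proof (rule Conv_sum)
    show "(\<lambda>x::real^'n. \<bar>x $ i\<bar>) \<in> Conv" for i
      using Conv_ridge[OF convex_on_abs_affine[of 0], of "axis i 1"] by (simp add: inner_axis)
  qed simp
  have u: "u \<in> Conv"
    unfolding u_def using Conv_add[OF Conv_scale[OF SC, of L] Conv_const[of "- M"]] w(3)
    by (intro Conv_max w(1)) (auto simp: L_def)
  have "u x = v x" if "x \<in> X" for x
  proof -
    have "\<bar>L * S x - w x\<bar> \<le> M" unfolding M_def using X(1) that by (intro member_le_sum) auto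
    then show ?thesis using w(2)[OF that] by (simp add: u_def)
  qed
  moreover have "Z u = 0"
  proof -
    define R where "R = \<bar>w 0\<bar> + M"
    have "u x = L * S x - M" if "x \<notin> cbox (\<chi> i. - R) (\<chi> i. R)" for x
    proof -
      have "\<exists>i. \<not> (- R \<le> x $ i \<and> x $ i \<le> R)" using that by (simp add: mem_box_cart)
      then obtain i where "\<not> (- R \<le> x $ i \<and> x $ i \<le> R)" ..
      then have "R < \<bar>x $ i\<bar>" by linarith
      also have "\<bar>x $ i\<bar> \<le> S x" unfolding S_def by (intro member_le_sum) auto
      finally have "R < S x" .
      moreover have "w x \<le> \<bar>w 0\<bar> + K * S x"
        using w(4)[of x 0] mult_left_mono[OF S w(3), of x] by simp
      ultimately show ?thesis by (simp add: u_def L_def R_def distrib_right)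
    qed
    moreover have "\<bar>u x - u y\<bar> \<le> (K + L * real CARD('n)) * norm (x - y)" for x y
    proof -
      have "\<bar>L * S x - L * S y\<bar> \<le> L * (real CARD('n) * norm (x - y))"
        using Slip[of x y] w(3) by (simp add: L_def abs_mult right_diff_distrib[symmetric] mult_left_mono)
      moreover have "0 \<le> L * (real CARD('n) * norm (x - y))" "0 \<le> K * norm (x - y)"
        using w(3) by (auto simp: L_def)
      moreover note w(4)[of x y]
      ultimately show ?thesis unfolding u_def distrib_right mult.assoc by linarith
    qed
    ultimately show ?thesis
      using w(3) by (intro l1_outside_compact_zero[OF p u, of "K + L * real CARD('n)" L]) (auto simp: S_def L_def)
  qed
  ultimately show "\<exists>w\<in>Conv. (\<forall>x\<in>X. \<bar>w x - v x\<bar> < e) \<and> Z w = 0" using u X(2) by force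
qed

end

section \<open>Monge--Ampere measures as image measures\<close>

text \<open>A unit step from \<open>x\<close> in direction \<open>y\<close> raises \<open>v\<close>
  by at least \<open>norm y\<close>; the additional 1 in the radius makes room for it.\<close>

lemma subgrad_bound:
  assumes B: "\<And>z. z \<in> cball 0 (r + 1) \<Longrightarrow> \<bar>v z\<bar> \<le> B" and x: "norm x \<le> r" and y: "y \<in> subgrad v x"
  shows "norm y \<le> 2 * B"
proof (cases "y = 0")
  case True
  have "x \<in> cball 0 (r + 1)" using x by simp
  with B[OF this] True show ?thesis by simp
next
  case False
  define z where "z = x + (1 / norm y) *\<^sub>R y"
  have "norm z \<le> norm x + norm ((1 / norm y) *\<^sub>R y)" unfolding z_def by (rule norm_triangle_ineq)
  also have "norm ((1 / norm y) *\<^sub>R y) = 1" using False by simp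
  finally have z: "z \<in> cball 0 (r + 1)" using x by simp
  have "y \<bullet> (z - x) = norm y" using False by (simp add: z_def power2_norm_eq_inner[symmetric] power2_eq_square)
  with subgradD[OF y, of z] have "norm y \<le> v z - v x" by simp
  then show ?thesis using B[OF z] B[of x] x by simp
qed

lemma Conv_bounded:
  fixes v :: "real^'n \<Rightarrow> real"
  assumes "v \<in> Conv"
  shows "\<exists>B. \<forall>z\<in>cball 0 r. \<bar>v z\<bar> \<le> B"
proof -
  have "bounded (v ` cball 0 r)"
    by (intro compact_imp_bounded compact_continuous_image Conv_continuous assms compact_cball)
  then show ?thesis unfolding bounded_iff by simp
qed

lemma closed_subgrad_graph:
  fixes v :: "real^'n \<Rightarrow> real"
  assumes v: "v \<in> Conv"
  shows "closed {p. snd p \<in> subgrad v (fst p)}"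
proof -
  have "{p. snd p \<in> subgrad v (fst p)} = (\<Inter>z. {p. v (fst p) + snd p \<bullet> (z - fst p) \<le> v z})"
    by (auto simp: subgrad_def)
  also have "closed \<dots>"
    by (intro closed_INT ballI closed_Collect_le continuous_intros
        continuous_on_compose2[OF Conv_continuous[OF v, of UNIV]]) auto
  finally show ?thesis .
qed

lemma compact_subgrad_image:
  fixes v :: "real^'n \<Rightarrow> real"
  assumes v: "v \<in> Conv" and C: "compact C"
  shows "compact {y. \<exists>x\<in>C. y \<in> subgrad v x}"
proof -
  obtain r where r: "\<And>x. x \<in> C \<Longrightarrow> norm x \<le> r" using compact_imp_bounded[OF C] by (auto simp: bounded_iff)
  obtain B where B: "\<And>z. z \<in> cball 0 (r + 1) \<Longrightarrow> \<bar>v z\<bar> \<le> B" using Conv_bounded[OF v] by blast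
  have "{y. \<exists>x\<in>C. y \<in> subgrad v x} = snd ` ((C \<times> cball 0 (2 * B)) \<inter> {p. snd p \<in> subgrad v (fst p)})"
    using subgrad_bound[OF B r] by force
  also have "compact \<dots>"
    by (intro compact_continuous_image continuous_intros compact_Int_closed compact_Times C compact_cball
        closed_subgrad_graph v)
  finally show ?thesis .
qed

lemma subgrad_monotone:
  assumes "y \<in> subgrad v x" "y' \<in> subgrad v x'"
  shows "0 \<le> (y' - y) \<bullet> (x' - x)"
  using subgradD[OF assms(1), of x'] subgradD[OF assms(2), of x]
  by (simp add: inner_diff_left inner_diff_right)

text \<open>Compact pieces exhausting \<open>multi v\<close>: two bounded points with common
  subgradient \<open>y\<close> whose coordinates \<open>i\<close> are at least \<open>1 / k\<close>
  apart, written without division so that \<open>k = 0\<close> gives the empty set.\<close>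

definition wide :: "(real^'n \<Rightarrow> real) \<Rightarrow> 'n \<Rightarrow> nat \<Rightarrow> (real^'n) set" where
  "wide v i k = {y. \<exists>x x'. norm x \<le> real k \<and> norm x' \<le> real k \<and> y \<in> subgrad v x \<and> y \<in> subgrad v x'
     \<and> 1 \<le> real k * (x' $ i - x $ i)}"

lemma compact_wide:
  fixes v :: "real^'n \<Rightarrow> real"
  assumes v: "v \<in> Conv"
  shows "compact (wide v i k)"
proof -
  let ?C = "{y. \<exists>x\<in>cball 0 (real k). y \<in> subgrad v x}"
  let ?S = "{p :: (real^'n) \<times> (real^'n) \<times> (real^'n). snd (snd p) \<in> subgrad v (fst p)}
    \<inter> {p. snd (snd p) \<in> subgrad v (fst (snd p))} \<inter> {p. 1 \<le> real k * (fst (snd p) $ i - fst p $ i)}"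
  have 1: "closed {p :: (real^'n) \<times> (real^'n) \<times> (real^'n). snd (snd p) \<in> subgrad v (fst p)}"
  proof -
    have "closed ((\<lambda>p :: (real^'n) \<times> (real^'n) \<times> (real^'n). (fst p, snd (snd p))) -` {p. snd p \<in> subgrad v (fst p)})"
      by (intro closed_vimage closed_subgrad_graph v continuous_intros)
    then show ?thesis by (simp add: vimage_def)
  qed
  have 2: "closed {p :: (real^'n) \<times> (real^'n) \<times> (real^'n). snd (snd p) \<in> subgrad v (fst (snd p))}"
  proof -
    have "closed ((\<lambda>p :: (real^'n) \<times> (real^'n) \<times> (real^'n). snd p) -` {p. snd p \<in> subgrad v (fst p)})"
      by (intro closed_vimage closed_subgrad_graph v continuous_intros)
    then show ?thesis by (simp add: vimage_def)
  qed
  have "wide v i k = (snd \<circ> snd) ` ((cball 0 (real k) \<times> cball 0 (real k) \<times> ?C) \<inter> ?S)"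
  proof (intro equalityI subsetI)
    fix y assume "y \<in> wide v i k"
    then obtain x x' where "norm x \<le> real k" "norm x' \<le> real k" "y \<in> subgrad v x" "y \<in> subgrad v x'"
      "1 \<le> real k * (x' $ i - x $ i)" by (auto simp: wide_def)
    then have "(x, x', y) \<in> (cball 0 (real k) \<times> cball 0 (real k) \<times> ?C) \<inter> ?S" by auto
    then show "y \<in> (snd \<circ> snd) ` ((cball 0 (real k) \<times> cball 0 (real k) \<times> ?C) \<inter> ?S)"
      by (rule rev_image_eqI) simp
  next
    fix y assume "y \<in> (snd \<circ> snd) ` ((cball 0 (real k) \<times> cball 0 (real k) \<times> ?C) \<inter> ?S)"
    then obtain p where "p \<in> (cball 0 (real k) \<times> cball 0 (real k) \<times> ?C) \<inter> ?S" "y = snd (snd p)" by auto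
    then show "y \<in> wide v i k"
      unfolding wide_def by (intro CollectI exI[of _ "fst p"] exI[of _ "fst (snd p)"]) auto
  qed
  also have "compact \<dots>"
    by (intro compact_continuous_image continuous_intros compact_Int_closed compact_Times compact_cball
        compact_subgrad_image v closed_Int 1 2 closed_Collect_le)
  finally show ?thesis .
qed

text \<open>Along a line in direction \<open>axis i 1\<close> monotonicity orders the intervals \<open>[x $ i, x' $ i]\<close>
  belonging to different points of \<open>wide v i k\<close>, so a line meets this set in boundedly many
  points, and arbitrarily many translates of it fit into a bounded set with bounded overlap.\<close>

lemma null_wide:
  fixes v :: "real^'n \<Rightarrow> real"
  assumes v: "v \<in> Conv"
  shows "wide v i k \<in> null_sets lborel"
proof -
  let ?S = "wide v i k"
  have comp: "compact ?S" by (rule compact_wide[OF v])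
  then have S[measurable]: "?S \<in> sets borel" by (simp add: borel_compact)
  obtain R where R: "\<And>y. y \<in> ?S \<Longrightarrow> norm y \<le> R" using compact_imp_bounded[OF comp] by (auto simp: bounded_iff)
  \<comment> \<open>The number of integers in \<open>{- k^2..k^2}\<close>. If translates
    \<open>j < l\<close> both hit \<open>z\<close>, then \<open>real k * x j $ i\<close> and
    \<open>real k * x l $ i\<close> differ by at least 1, so their floors are distinct members of
    that interval.\<close>
  define M where "M = 2 * k\<^sup>2 + 1"
  define e where "e = (axis i 1 :: real^'n)"
  have count: "card {j. j < J \<and> z - (real j / real J) *\<^sub>R e \<in> ?S} \<le> M" for J z
  proof -
    define A where "A = {j. j < J \<and> z - (real j / real J) *\<^sub>R e \<in> ?S}"
    have "\<forall>j\<in>A. \<exists>x x'. norm x \<le> real k \<and> norm x' \<le> real k \<and> z - (real j / real J) *\<^sub>R e \<in> subgrad v x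
      \<and> z - (real j / real J) *\<^sub>R e \<in> subgrad v x' \<and> 1 \<le> real k * (x' $ i - x $ i)"
      by (auto simp: A_def wide_def)
    then obtain x x' where x: "\<And>j. j \<in> A \<Longrightarrow> norm (x j) \<le> real k"
      "\<And>j. j \<in> A \<Longrightarrow> z - (real j / real J) *\<^sub>R e \<in> subgrad v (x j)"
      "\<And>j. j \<in> A \<Longrightarrow> z - (real j / real J) *\<^sub>R e \<in> subgrad v (x' j)"
      "\<And>j. j \<in> A \<Longrightarrow> 1 \<le> real k * (x' j $ i - x j $ i)" by metis
    have less: "real k * (x l $ i) \<le> real k * (x j $ i) - 1" if "j \<in> A" "l \<in> A" "j < l" for j l
    proof -
      have J: "J > 0" using that by (auto simp: A_def)
      have "(z - (real l / real J) *\<^sub>R e) - (z - (real j / real J) *\<^sub>R e) = ((real j - real l) / real J) *\<^sub>R e"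
        by (simp add: diff_divide_distrib algebra_simps)
      then have "0 \<le> (((real j - real l) / real J) *\<^sub>R e) \<bullet> (x' l - x j)"
        using subgrad_monotone[OF x(2)[OF that(1)] x(3)[OF that(2)]] by simp
      then have "0 \<le> ((real j - real l) / real J) * (x' l $ i - x j $ i)"
        by (simp add: e_def inner_axis')
      then have "x' l $ i \<le> x j $ i"
        using that(3) J by (simp add: zero_le_mult_iff zero_le_divide_iff divide_le_0_iff)
      then have "real k * (x' l $ i) \<le> real k * (x j $ i)" by (intro mult_left_mono) auto
      then show ?thesis using x(4)[OF that(2)] by (simp add: right_diff_distrib)
    qed
    have "inj_on (\<lambda>j. \<lfloor>real k * (x j $ i)\<rfloor>) A"
    proof (rule inj_onI)
      fix j l assume *: "j \<in> A" "l \<in> A" "\<lfloor>real k * (x j $ i)\<rfloor> = \<lfloor>real k * (x l $ i)\<rfloor>"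
      show "j = l"
        using less[OF *(1,2)] less[OF *(2,1)] *(3) by (cases j l rule: linorder_cases) linarith+
    qed
    then have "card A = card ((\<lambda>j. \<lfloor>real k * (x j $ i)\<rfloor>) ` A)" by (simp add: card_image)
    also have "\<dots> \<le> card {- (int k)\<^sup>2..(int k)\<^sup>2}"
    proof (intro card_mono)
      show "(\<lambda>j. \<lfloor>real k * (x j $ i)\<rfloor>) ` A \<subseteq> {- (int k)\<^sup>2..(int k)\<^sup>2}"
      proof
        fix t assume "t \<in> (\<lambda>j. \<lfloor>real k * (x j $ i)\<rfloor>) ` A"
        then obtain j where j: "j \<in> A" "t = \<lfloor>real k * (x j $ i)\<rfloor>" by auto
        have "\<bar>x j $ i\<bar> \<le> real k" using x(1)[OF j(1)] component_le_norm_cart[of "x j" i] by linarith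
        then have "\<bar>real k * (x j $ i)\<bar> \<le> real k * real k" by (simp add: abs_mult mult_left_mono)
        then have "\<bar>real k * (x j $ i)\<bar> \<le> real_of_int ((int k)\<^sup>2)" by (simp add: power2_eq_square)
        then show "t \<in> {- (int k)\<^sup>2..(int k)\<^sup>2}" unfolding j(2) atLeastAtMost_iff by linarith
      qed
    qed simp
    also have "\<dots> = M" by (simp add: M_def nat_add_distrib nat_mult_distrib nat_power_eq)
    finally show ?thesis by (simp add: A_def)
  qed
  have fin: "emeasure lborel ?S < \<infinity>" using comp by (rule emeasure_compact_finite)
  define b where "b = emeasure lborel (cball (0::real^'n) (R + 1))"
  have b: "b < \<infinity>" unfolding b_def by (rule emeasure_lborel_cball_finite)
  have le: "of_nat J * emeasure lborel ?S \<le> of_nat M * b" for J :: nat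
  proof -
    have shift: "(\<integral>\<^sup>+z. indicator ?S (z - c) \<partial>lborel) = emeasure lborel ?S" for c
    proof -
      have "(\<integral>\<^sup>+z. indicator ?S (z - c) \<partial>lborel) = (\<integral>\<^sup>+z. indicator ?S z \<partial>(distr lborel borel ((+) (- c))))"
        by (subst nn_integral_distr) (auto simp: algebra_simps)
      then show ?thesis by (simp add: lborel_distr_plus)
    qed
    have "of_nat J * emeasure lborel ?S = (\<Sum>j<J. (\<integral>\<^sup>+z. indicator ?S (z - (real j / real J) *\<^sub>R e) \<partial>lborel))"
      by (simp add: shift)
    also have "\<dots> = (\<integral>\<^sup>+z. (\<Sum>j<J. indicator ?S (z - (real j / real J) *\<^sub>R e)) \<partial>lborel)"
      by (subst nn_integral_sum) auto
    also have "\<dots> \<le> (\<integral>\<^sup>+z. of_nat M * indicator (cball (0::real^'n) (R + 1)) z \<partial>lborel)"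
    proof (rule nn_integral_mono)
      fix z :: "real^'n"
      have *: "(\<Sum>j<J. indicator ?S (z - (real j / real J) *\<^sub>R e)) = (of_nat (card {j. j < J \<and> z - (real j / real J) *\<^sub>R e \<in> ?S}) :: ennreal)"
        by (simp add: indicator_def sum.If_cases Int_def of_bool_def)
      show "(\<Sum>j<J. indicator ?S (z - (real j / real J) *\<^sub>R e)) \<le> (of_nat M * indicator (cball 0 (R + 1)) z :: ennreal)"
      proof (cases "z \<in> cball 0 (R + 1)")
        case True
        then show ?thesis unfolding * using count[of J z] by (simp add: of_nat_mono)
      next
        case False
        have "z - (real j / real J) *\<^sub>R e \<notin> ?S" if "j < J" for j
        proof
          assume "z - (real j / real J) *\<^sub>R e \<in> ?S"
          then have "norm (z - (real j / real J) *\<^sub>R e) \<le> R" by (rule R)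
          moreover have "norm ((real j / real J) *\<^sub>R e) \<le> 1" using that by (simp add: e_def)
          moreover have "norm z \<le> norm (z - (real j / real J) *\<^sub>R e) + norm ((real j / real J) *\<^sub>R e)"
            using norm_triangle_ineq[of "z - (real j / real J) *\<^sub>R e" "(real j / real J) *\<^sub>R e"] by simp
          ultimately show False using False by simp
        qed
        then show ?thesis by simp
      qed
    qed
    also have "\<dots> = of_nat M * b" by (simp add: nn_integral_cmult_indicator b_def)
    finally show ?thesis .
  qed
  have "emeasure lborel ?S = 0"
  proof (rule ccontr)
    assume ne: "emeasure lborel ?S \<noteq> 0"
    obtain s where s: "emeasure lborel ?S = ennreal s" "s \<ge> 0" using fin by (cases "emeasure lborel ?S") auto
    obtain t where t: "b = ennreal t" "t \<ge> 0" using b by (cases b) auto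
    have "s > 0" using ne s by (auto simp: less_le)
    have "real J * s \<le> real M * t" for J
      using le[of J] s t by (simp add: ennreal_of_nat_eq_real_of_nat ennreal_mult[symmetric])
    moreover obtain J where "real M * t < real J * s" using reals_Archimedean3[OF \<open>s > 0\<close>] by blast
    ultimately show False by (meson not_le)
  qed
  then show ?thesis by (simp add: null_sets_def)
qed

text \<open>The slopes at which the convex conjugate of \<open>v\<close> has more than one
  subgradient.\<close>

definition multi :: "(real^'n \<Rightarrow> real) \<Rightarrow> (real^'n) set" where
  "multi v = {y. \<exists>x x'. x \<noteq> x' \<and> y \<in> subgrad v x \<and> y \<in> subgrad v x'}"

lemma multi_eq: "multi v = (\<Union>i. \<Union>k. wide v i k)"
proof
  show "multi v \<subseteq> (\<Union>i. \<Union>k. wide v i k)"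
  proof
    fix y assume "y \<in> multi v"
    then obtain x x' where x: "x \<noteq> x'" "y \<in> subgrad v x" "y \<in> subgrad v x'" by (auto simp: multi_def)
    then obtain i where i: "x $ i \<noteq> x' $ i" by (auto simp: vec_eq_iff)
    have *: "y \<in> (\<Union>i. \<Union>k. wide v i k)" if "y \<in> subgrad v x" "y \<in> subgrad v x'" "x $ i < x' $ i" for x x'
    proof -
      obtain k where k: "max (max (norm x) (norm x')) (1 / (x' $ i - x $ i)) < real k"
        using reals_Archimedean2 by blast
      then have "1 \<le> real k * (x' $ i - x $ i)" using that(3) by (simp add: divide_less_eq)
      with k that have "y \<in> wide v i k"
        unfolding wide_def by (intro CollectI exI[of _ x] exI[of _ x']) auto
      then show ?thesis by blast
    qed
    show "y \<in> (\<Union>i. \<Union>k. wide v i k)" using *[OF x(2,3)] *[OF x(3,2)] i by (cases "x $ i < x' $ i") auto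
  qed
  show "(\<Union>i. \<Union>k. wide v i k) \<subseteq> multi v"
  proof clarify
    fix y i k assume "y \<in> wide v i k"
    then obtain x x' where x: "y \<in> subgrad v x" "y \<in> subgrad v x'" "1 \<le> real k * (x' $ i - x $ i)"
      by (auto simp: wide_def)
    then have "x \<noteq> x'" by auto
    with x show "y \<in> multi v" unfolding multi_def by blast
  qed
qed

lemma null_multi: "v \<in> Conv \<Longrightarrow> multi v \<in> null_sets lborel"
  unfolding multi_eq by (intro null_sets_UN' null_wide) auto

lemma AE_not_multi: "v \<in> Conv \<Longrightarrow> AE y in lborel. y \<notin> multi v"
  by (intro AE_not_in null_multi)

text \<open>The points of differentiability of the convex conjugate of \<open>v\<close>, where its
  gradient is \<open>preim v\<close>.\<close>

definition uniq :: "(real^'n \<Rightarrow> real) \<Rightarrow> (real^'n) set" where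
  "uniq v = {y. \<exists>!x. y \<in> subgrad v x}"

text \<open>Outside \<open>uniq v\<close> the value of \<open>preim v\<close> is meaningless.\<close>

definition preim :: "(real^'n \<Rightarrow> real) \<Rightarrow> real^'n \<Rightarrow> real^'n" where
  "preim v y = (THE x. y \<in> subgrad v x)"

lemma preim_eq: "y \<notin> multi v \<Longrightarrow> y \<in> subgrad v x \<Longrightarrow> preim v y = x"
  unfolding preim_def multi_def by (intro the_equality) auto

lemma uniqI: "y \<notin> multi v \<Longrightarrow> y \<in> subgrad v x \<Longrightarrow> y \<in> uniq v"
  unfolding uniq_def multi_def by auto

lemma uniq_subgrad: "y \<in> uniq v \<Longrightarrow> y \<in> subgrad v (preim v y)"
  using theI'[of "\<lambda>x. y \<in> subgrad v x"] unfolding uniq_def preim_def by simp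

lemma uniq_not_multi: "y \<in> uniq v \<Longrightarrow> y \<notin> multi v"
  unfolding uniq_def multi_def by auto

text \<open>A closed set is a countable union of compact ones, whose subgradient images are compact;
  removing the null set \<open>multi v\<close> leaves the slopes with a unique preimage.\<close>

lemma preim_vimage_measurable:
  fixes v :: "real^'n \<Rightarrow> real"
  assumes v: "v \<in> Conv" and C: "closed C"
  shows "{y\<in>uniq v. preim v y \<in> C} \<in> sets borel"
proof -
  have "{y\<in>uniq v. preim v y \<in> C} = (\<Union>k::nat. {y. \<exists>x\<in>C \<inter> cball 0 (real k). y \<in> subgrad v x}) - multi v"
  proof (intro equalityI subsetI)
    fix y assume y: "y \<in> {y\<in>uniq v. preim v y \<in> C}"
    obtain k where "norm (preim v y) \<le> real k" using real_arch_simple by blast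
    with y show "y \<in> (\<Union>k::nat. {y. \<exists>x\<in>C \<inter> cball 0 (real k). y \<in> subgrad v x}) - multi v"
      using uniq_subgrad[of y v] uniq_not_multi[of y v]
      by (intro DiffI UN_I[of k] CollectI bexI[of _ "preim v y"]) auto
  next
    fix y assume "y \<in> (\<Union>k::nat. {y. \<exists>x\<in>C \<inter> cball 0 (real k). y \<in> subgrad v x}) - multi v"
    then obtain x where "x \<in> C" "y \<in> subgrad v x" "y \<notin> multi v" by auto
    then show "y \<in> {y\<in>uniq v. preim v y \<in> C}" using uniqI[of y v x] preim_eq[of y v x] by simp
  qed
  also have "\<dots> \<in> sets borel"
  proof (intro sets.Diff sets.countable_UN)
    show "range (\<lambda>k::nat. {y. \<exists>x\<in>C \<inter> cball 0 (real k). y \<in> subgrad v x}) \<subseteq> sets borel"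
      by (auto intro!: borel_compact compact_subgrad_image v closed_Int_compact C)
    show "multi v \<in> sets borel" using null_setsD2[OF null_multi[OF v]] by simp
  qed
  finally show ?thesis .
qed

lemma uniq_measurable: "v \<in> Conv \<Longrightarrow> uniq v \<in> sets borel"
  using preim_vimage_measurable[of v UNIV] by simp

lemma preim_measurable:
  fixes v :: "real^'n \<Rightarrow> real"
  assumes v: "v \<in> Conv"
  shows "preim v \<in> borel_measurable (restrict_space lborel (uniq v))"
proof (rule borel_measurableI)
  fix S :: "(real^'n) set" assume "open S"
  then have "{y\<in>uniq v. preim v y \<in> - S} \<in> sets borel" by (intro preim_vimage_measurable v) auto
  moreover have "preim v -` S \<inter> uniq v = uniq v - {y\<in>uniq v. preim v y \<in> - S}" by auto
  ultimately have "preim v -` S \<inter> uniq v \<in> sets borel" using uniq_measurable[OF v] by auto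
  then show "preim v -` S \<inter> space (restrict_space lborel (uniq v)) \<in> sets (restrict_space lborel (uniq v))"
    using uniq_measurable[OF v] by (auto simp: space_restrict_space sets_restrict_space_iff)
qed

text \<open>The set on the left differs from the Borel set of \<open>y\<close> in
  \<open>uniq v\<close> with \<open>(preim v y, y)\<close> in \<open>A\<close> only inside
  \<open>multi v\<close>. It is thus Lebesgue measurable with the same measure.\<close>

lemma emeasure_subgrad_selection:
  fixes v :: "real^'n \<Rightarrow> real"
  assumes v: "v \<in> Conv" and A: "A \<in> sets (borel :: ((real^'n) \<times> (real^'n)) measure)"
  shows "emeasure lebesgue {y. \<exists>x. (x, y) \<in> A \<and> y \<in> subgrad v x}
    = emeasure (distr (restrict_space lborel (uniq v)) borel (\<lambda>y. (preim v y, y))) A"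
proof -
  let ?E = "{y\<in>uniq v. (preim v y, y) \<in> A}"
  have m[measurable]: "(\<lambda>y. (preim v y, y)) \<in> borel_measurable (restrict_space lborel (uniq v))"
    using preim_measurable[OF v] by (intro borel_measurable_Pair) (auto intro: measurable_restrict_space1)
  have U: "uniq v \<in> sets lborel" using uniq_measurable[OF v] by simp
  have E_eq: "(\<lambda>y. (preim v y, y)) -` A \<inter> space (restrict_space lborel (uniq v)) = ?E"
    by (auto simp: space_restrict_space)
  have "?E \<in> sets (restrict_space lborel (uniq v))" using measurable_sets[OF m A] by (simp only: E_eq)
  then have E: "?E \<in> sets lborel" using U by (auto simp: sets_restrict_space)
  have "emeasure (distr (restrict_space lborel (uniq v)) borel (\<lambda>y. (preim v y, y))) A
    = emeasure (restrict_space lborel (uniq v)) ?E"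
    by (subst emeasure_distr[OF m A]) (simp only: E_eq)
  also have "\<dots> = emeasure lborel ?E" using U by (intro emeasure_restrict_space) auto
  also have "\<dots> = emeasure lebesgue ?E"
    using emeasure_completion[OF sets_completionI_sets[OF E]] unfolding main_part[OF E] by (rule sym)
  also have "\<dots> = emeasure lebesgue (?E \<union> ({y. \<exists>x. (x, y) \<in> A \<and> y \<in> subgrad v x} \<inter> multi v))"
  proof (rule emeasure_Un_null_set[symmetric])
    show "{y. \<exists>x. (x, y) \<in> A \<and> y \<in> subgrad v x} \<inter> multi v \<in> null_sets lebesgue"
      by (rule null_sets_completion_subset[OF Int_lower2 null_sets_completionI[OF null_multi[OF v]]])
  qed (rule sets_completionI_sets[OF E])
  also have "?E \<union> ({y. \<exists>x. (x, y) \<in> A \<and> y \<in> subgrad v x} \<inter> multi v) = {y. \<exists>x. (x, y) \<in> A \<and> y \<in> subgrad v x}"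
  proof (intro equalityI subsetI)
    fix y assume "y \<in> ?E \<union> ({y. \<exists>x. (x, y) \<in> A \<and> y \<in> subgrad v x} \<inter> multi v)"
    then show "y \<in> {y. \<exists>x. (x, y) \<in> A \<and> y \<in> subgrad v x}" using uniq_subgrad[of y v] by auto
  next
    fix y assume "y \<in> {y. \<exists>x. (x, y) \<in> A \<and> y \<in> subgrad v x}"
    then obtain x where "(x, y) \<in> A" "y \<in> subgrad v x" by auto
    then show "y \<in> ?E \<union> ({y. \<exists>x. (x, y) \<in> A \<and> y \<in> subgrad v x} \<inter> multi v)"
      using uniqI[of y v x] preim_eq[of y v x] by (cases "y \<in> multi v") auto
  qed
  finally show ?thesis by simp
qed

text \<open>\<open>measure_of\<close> returns the prescribed values only for a countably additive
  set function. Agreement with an image measure supplies countable additivity and gives access to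
  change of variables.\<close>

lemma Theta0_eq_distr:
  fixes v :: "real^'n \<Rightarrow> real"
  assumes v: "v \<in> Conv"
  shows "Theta0 v = distr (restrict_space lborel (uniq v)) borel (\<lambda>y. (preim v y, y))" (is "_ = ?D")
proof -
  have "Theta0 v = measure_of (space ?D) (sets ?D) (emeasure ?D)"
    unfolding Theta0_def
    by (simp, intro measure_of_eq) (simp_all add: emeasure_subgrad_selection[OF v] sets.sigma_sets_eq[of borel, simplified])
  then show ?thesis by (simp only: measure_of_of_measure)
qed

lemma MA_eq_distr:
  fixes v :: "real^'n \<Rightarrow> real"
  assumes v: "v \<in> Conv"
  shows "MA v = distr (restrict_space lborel (uniq v)) borel (preim v)" (is "_ = ?D")
proof -
  have "emeasure lebesgue (\<Union>x\<in>B. subgrad v x) = emeasure ?D B" if B: "B \<in> sets borel" for B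
  proof -
    have B': "B \<times> UNIV \<in> sets (borel :: ((real^'n) \<times> (real^'n)) measure)"
      using B by (intro borel_Times) auto
    have m: "(\<lambda>y. (preim v y, y)) \<in> borel_measurable (restrict_space lborel (uniq v))"
      using preim_measurable[OF v] by (intro borel_measurable_Pair) (auto intro: measurable_restrict_space1)
    have "(\<Union>x\<in>B. subgrad v x) = {y. \<exists>x. (x, y) \<in> B \<times> UNIV \<and> y \<in> subgrad v x}" by auto
    then have "emeasure lebesgue (\<Union>x\<in>B. subgrad v x)
       = emeasure (distr (restrict_space lborel (uniq v)) borel (\<lambda>y. (preim v y, y))) (B \<times> UNIV)"
      by (simp only: emeasure_subgrad_selection[OF v B'])
    also have "\<dots> = emeasure ?D B"
      using preim_measurable[OF v] B B' m by (simp add: emeasure_distr vimage_def)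
    finally show ?thesis .
  qed
  then have "MA v = measure_of (space ?D) (sets ?D) (emeasure ?D)"
    unfolding MA_def
    by (simp, intro measure_of_eq) (simp_all add: sets.sigma_sets_eq[of borel, simplified])
  then show ?thesis by (simp only: measure_of_of_measure)
qed

text \<open>The integrand after pulling back to slopes, for both measures at once. The value 0 is
  genuine where \<open>y\<close> is no subgradient and harmless on the null set
  \<open>multi v\<close>.\<close>

definition fiber :: "(real^'n \<Rightarrow> real^'n \<Rightarrow> 'b::real_normed_vector) \<Rightarrow> (real^'n \<Rightarrow> real) \<Rightarrow> real^'n \<Rightarrow> 'b" where
  "fiber f v y = (if y \<in> uniq v then f (preim v y) y else 0)"

lemma integral_Theta0:
  fixes f :: "real^'n \<Rightarrow> real^'n \<Rightarrow> 'b::{banach, second_countable_topology}"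
  assumes v: "v \<in> Conv" and f: "continuous_on UNIV (\<lambda>(x, y). f x y)"
  shows "integral\<^sup>L (Theta0 v) (\<lambda>(x, y). f x y) = (\<integral>y. fiber f v y \<partial>lborel)"
proof -
  have m: "(\<lambda>y. (preim v y, y)) \<in> borel_measurable (restrict_space lborel (uniq v))"
    using preim_measurable[OF v] by (intro borel_measurable_Pair) (auto intro: measurable_restrict_space1)
  have "integral\<^sup>L (Theta0 v) (\<lambda>(x, y). f x y) = (\<integral>y. f (preim v y) y \<partial>(restrict_space lborel (uniq v)))"
    unfolding Theta0_eq_distr[OF v]
    by (subst integral_distr[OF m]) (auto intro: borel_measurable_continuous_onI[OF f])
  also have "\<dots> = (\<integral>y. indicator (uniq v) y *\<^sub>R f (preim v y) y \<partial>lborel)"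
    using uniq_measurable[OF v] by (intro integral_restrict_space) simp
  also have "(\<lambda>y. indicator (uniq v) y *\<^sub>R f (preim v y) y) = fiber f v"
    by (auto simp: fiber_def fun_eq_iff)
  finally show ?thesis .
qed

lemma integral_MA:
  fixes f :: "real^'n \<Rightarrow> 'b::{banach, second_countable_topology}"
  assumes v: "v \<in> Conv" and f: "continuous_on UNIV f"
  shows "integral\<^sup>L (MA v) f = (\<integral>y. fiber (\<lambda>x y. f x) v y \<partial>lborel)"
proof -
  have "integral\<^sup>L (MA v) f = (\<integral>y. f (preim v y) \<partial>(restrict_space lborel (uniq v)))"
    unfolding MA_eq_distr[OF v]
    by (subst integral_distr[OF preim_measurable[OF v]]) (auto intro: borel_measurable_continuous_onI[OF f])
  also have "\<dots> = (\<integral>y. indicator (uniq v) y *\<^sub>R f (preim v y) \<partial>lborel)"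
    using uniq_measurable[OF v] by (intro integral_restrict_space) simp
  also have "(\<lambda>y. indicator (uniq v) y *\<^sub>R f (preim v y)) = fiber (\<lambda>x y. f x) v"
    by (auto simp: fiber_def fun_eq_iff)
  finally show ?thesis .
qed

section \<open>Pointwise convergence of convex functions\<close>

text \<open>For convex functions, convergence on an ample set already implies locally uniform convergence.
  There are countable ample sets, so sequences suffice for testing continuity on \<open>Conv\<close>.\<close>

definition ample :: "(real^'n) set \<Rightarrow> bool" where
  "ample Q \<longleftrightarrow> 0 \<in> Q \<and> (\<forall>x e. e > 0 \<longrightarrow> (\<exists>q\<in>Q. dist q x < e))
     \<and> (\<forall>r. \<exists>S. finite S \<and> S \<subseteq> Q \<and> cball 0 r \<subseteq> convex hull S)"

lemma countable_ample: "\<exists>Q :: (real^'n) set. countable Q \<and> ample Q"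
proof -
  obtain D :: "(real^'n) set" where D: "countable D" "\<And>X. open X \<Longrightarrow> X \<noteq> {} \<Longrightarrow> \<exists>d\<in>D. d \<in> X"
    using countable_dense_setE by blast
  have "\<exists>S :: (real^'n) set. finite S \<and> cball 0 (real k) \<subseteq> convex hull S" for k :: nat
  proof -
    obtain S :: "(real^'n) set" where S: "finite S"
      "cbox (0 - (\<Sum>i\<in>Basis. (real k + 1) *\<^sub>R i)) (0 + (\<Sum>i\<in>Basis. (real k + 1) *\<^sub>R i)) = convex hull S"
      using cube_convex_hull[of "real k + 1" "0 :: real^'n"] by auto
    have "cball 0 (real k) \<subseteq> cbox (0 - (\<Sum>i\<in>Basis. (real k + 1) *\<^sub>R i)) (0 + (\<Sum>i\<in>Basis. (real k + 1) *\<^sub>R i) :: real^'n)"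
    proof
      fix x :: "real^'n" assume "x \<in> cball 0 (real k)"
      then have "\<bar>x \<bullet> i\<bar> \<le> real k" if "i \<in> Basis" for i using Basis_le_norm[OF that, of x] by simp
      then show "x \<in> cbox (0 - (\<Sum>i\<in>Basis. (real k + 1) *\<^sub>R i)) (0 + (\<Sum>i\<in>Basis. (real k + 1) *\<^sub>R i))"
        by (fastforce simp: mem_box inner_sum_left_Basis abs_le_iff)
    qed
    with S show ?thesis by auto
  qed
  then obtain S :: "nat \<Rightarrow> (real^'n) set" where S: "\<And>k. finite (S k)" "\<And>k. cball 0 (real k) \<subseteq> convex hull (S k)" by metis
  define Q where "Q = insert 0 (D \<union> (\<Union>k. S k))"
  have "countable Q" unfolding Q_def using D(1) S(1) by (auto intro: countable_finite)
  moreover have "ample Q"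
    unfolding ample_def
  proof (intro conjI allI impI)
    show "0 \<in> Q" by (simp add: Q_def)
    show "\<exists>q\<in>Q. dist q x < e" if "e > 0" for x e
      using D(2)[of "ball x e"] that by (auto simp: Q_def dist_commute)
    show "\<exists>S. finite S \<and> S \<subseteq> Q \<and> cball 0 r \<subseteq> convex hull S" for r
    proof -
      obtain k where "r \<le> real k" using real_arch_simple by blast
      then have "cball 0 r \<subseteq> cball (0::real^'n) (real k)" by auto
      with S[of k] show ?thesis by (intro exI[of _ "S k"]) (auto simp: Q_def)
    qed
  qed
  ultimately show ?thesis by blast
qed

lemma ample_UNIV: "ample UNIV"
proof -
  obtain Q :: "(real^'a) set" where "ample Q" using countable_ample by blast
  then show ?thesis unfolding ample_def by (metis UNIV_I dist_self subset_UNIV)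
qed

text \<open>Values at finitely many points of \<open>Q\<close> bound all \<open>v n\<close> from
  above on their convex hull; reflection through 0, which is why \<open>ample\<close> asks for
  \<open>0 \<in> Q\<close>, turns this into a lower bound.\<close>

lemma Conv_equibounded:
  fixes v :: "nat \<Rightarrow> real^'n \<Rightarrow> real"
  assumes v: "\<And>n. v n \<in> Conv" and Q: "ample Q" and conv: "\<And>q. q \<in> Q \<Longrightarrow> convergent (\<lambda>n. v n q)"
  shows "\<exists>B. \<forall>n. \<forall>z\<in>cball 0 r. \<bar>v n z\<bar> \<le> B"
proof -
  have "\<exists>c. \<forall>n. \<bar>v n q\<bar> \<le> c" if "q \<in> Q" for q
    using convergent_imp_Bseq[OF conv[OF that]] by (auto simp: Bseq_def)
  then obtain c where c: "\<And>q n. q \<in> Q \<Longrightarrow> \<bar>v n q\<bar> \<le> c q" by metis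
  from Q obtain S where S: "finite S" "S \<subseteq> Q" "cball 0 r \<subseteq> convex hull S" unfolding ample_def by blast
  have "0 \<in> Q" using Q by (simp add: ample_def)
  define b where "b = (\<Sum>s\<in>S. c s)"
  have c0: "0 \<le> c q" if "q \<in> Q" for q using c[OF that, of 0] by linarith
  have "\<bar>v n z\<bar> \<le> b + 2 * c 0" if z: "z \<in> cball 0 r" for n z
  proof -
    have cv: "convex_on A (v n)" if "convex A" for A
      using v[of n] that convex_on_subset[of UNIV "v n" A] by (simp add: Conv_def)
    have "\<forall>x\<in>S. v n x \<le> b"
    proof
      fix x assume "x \<in> S"
      then have "c x \<le> b" unfolding b_def using S c0 by (intro member_le_sum) auto
      then show "v n x \<le> b" using c[of x n] S \<open>x \<in> S\<close> by fastforce
    qed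
    then have "\<forall>x\<in>convex hull S. v n x \<le> b"
      by (intro convex_on_convex_hull_bound cv convex_convex_hull)
    then have "\<bar>v n z\<bar> \<le> b + 2 * \<bar>v n 0\<bar>"
      using S z by (intro convex_bounds_lemma[OF cv]) auto
    then show ?thesis using c[OF \<open>0 \<in> Q\<close>, of n] by linarith
  qed
  then show ?thesis by blast
qed

lemma Conv_Lipschitz:
  fixes v :: "real^'n \<Rightarrow> real"
  assumes v: "v \<in> Conv" and B: "\<And>z. z \<in> cball 0 (r + 1) \<Longrightarrow> \<bar>v z\<bar> \<le> B"
    and x: "norm x \<le> r" and z: "norm z \<le> r"
  shows "\<bar>v x - v z\<bar> \<le> 2 * B * norm (x - z)"
proof -
  have *: "v x - v z \<le> 2 * B * norm (x - z)" if x: "norm x \<le> r" for x z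
  proof -
    obtain y where y: "y \<in> subgrad v x" using subgrad_exists[OF v] .
    have "v x - v z \<le> y \<bullet> (x - z)" using subgradD[OF y, of z] by (simp add: inner_diff_right)
    also have "\<dots> \<le> norm y * norm (x - z)" by (rule norm_cauchy_schwarz)
    also have "\<dots> \<le> 2 * B * norm (x - z)" using subgrad_bound[OF B x y] by (intro mult_right_mono) auto
    finally show ?thesis .
  qed
  show ?thesis using *[OF x, of z] *[OF z, of x] by (simp add: norm_minus_commute abs_le_iff)
qed

text \<open>A uniform bound on a larger ball gives a common Lipschitz constant, and a point of
  \<open>Q\<close> near the limit does the comparison. The evaluation points may move, as limits of
  subgradients require.\<close>

lemma Conv_converges_on_ample:
  fixes v :: "nat \<Rightarrow> real^'n \<Rightarrow> real"
  assumes v: "\<And>n. v n \<in> Conv" "w \<in> Conv" and Q: "ample Q" and conv: "\<And>q. q \<in> Q \<Longrightarrow> (\<lambda>n. v n q) \<longlonglongrightarrow> w q"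
    and x: "x \<longlonglongrightarrow> x0"
  shows "(\<lambda>n. v n (x n)) \<longlonglongrightarrow> w x0"
  unfolding tendsto_iff
proof (intro allI impI)
  fix e :: real assume e: "e > 0"
  obtain r0 where r0: "\<And>n. norm (x n) \<le> r0"
    using convergent_imp_Bseq[OF convergentI[OF x]] by (auto simp: Bseq_def)
  define r where "r = max r0 (norm x0 + 1)"
  have r: "norm (x n) \<le> r" "norm x0 + 1 \<le> r" for n using r0[of n] by (auto simp: r_def)
  have "convergent (\<lambda>n. v n q)" if "q \<in> Q" for q using conv[OF that] by (rule convergentI)
  from Conv_equibounded[of v, OF v(1) Q this, of "r + 1"]
  obtain B1 where B1: "\<And>n z. z \<in> cball 0 (r + 1) \<Longrightarrow> \<bar>v n z\<bar> \<le> B1" by blast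
  obtain B2 where B2: "\<And>z. z \<in> cball 0 (r + 1) \<Longrightarrow> \<bar>w z\<bar> \<le> B2" using Conv_bounded[OF v(2), of "r + 1"] by blast
  define B where "B = max 1 (max B1 B2)"
  have B: "B \<ge> 1" "\<And>n z. z \<in> cball 0 (r + 1) \<Longrightarrow> \<bar>v n z\<bar> \<le> B" "\<And>z. z \<in> cball 0 (r + 1) \<Longrightarrow> \<bar>w z\<bar> \<le> B"
  proof -
    show "B \<ge> 1" by (simp add: B_def)
    show "\<bar>v n z\<bar> \<le> B" if "z \<in> cball 0 (r + 1)" for n z using B1[OF that, of n] by (simp add: B_def)
    show "\<bar>w z\<bar> \<le> B" if "z \<in> cball 0 (r + 1)" for z using B2[OF that] by (simp add: B_def)
  qed
  \<comment> \<open>With Lipschitz constant \<open>2 * B\<close> the three errors are at most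
    \<open>e / 4\<close>, \<open>e / 4\<close> and \<open>e / 8\<close>; the bound 1 keeps
    \<open>q\<close> in the ball of radius \<open>r\<close>.\<close>
  define d where "d = min 1 (e / (16 * B))"
  have d: "d > 0" using e B by (simp add: d_def)
  have Bd: "2 * B * d \<le> e / 8"
  proof -
    have "2 * B * d \<le> 2 * B * (e / (16 * B))" using B by (intro mult_left_mono) (auto simp: d_def)
    also have "\<dots> = e / 8" using B by simp
    finally show ?thesis .
  qed
  obtain q where q: "q \<in> Q" "dist q x0 < d" using Q d unfolding ample_def by blast
  have nq: "norm q \<le> r"
  proof -
    have "norm q \<le> norm x0 + norm (q - x0)" using norm_triangle_ineq[of x0 "q - x0"] by simp
    then show ?thesis using q(2) r(2) by (simp add: dist_norm d_def)
  qed
  have "eventually (\<lambda>n. dist (x n) x0 < d) sequentially" using x d by (simp add: tendsto_iff)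
  moreover have "eventually (\<lambda>n. dist (v n q) (w q) < e / 4) sequentially"
    by (rule tendstoD[OF conv[OF q(1)]]) (use e in simp)
  ultimately show "eventually (\<lambda>n. dist (v n (x n)) (w x0) < e) sequentially"
  proof eventually_elim
    case (elim n)
    have nx0: "norm x0 \<le> r" using r(2) by simp
    have "norm (x n - q) \<le> 2 * d"
      using elim(1) q(2) dist_triangle2[of "x n" q x0] by (simp add: dist_norm)
    then have "2 * B * norm (x n - q) \<le> 2 * B * (2 * d)" using B by (intro mult_left_mono) auto
    then have 1: "\<bar>v n (x n) - v n q\<bar> \<le> e / 4"
      using Conv_Lipschitz[OF v(1) B(2) r(1)[of n] nq, of n] Bd by simp
    have "2 * B * norm (q - x0) \<le> 2 * B * d" using B q(2) by (intro mult_left_mono) (auto simp: dist_norm)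
    then have 2: "\<bar>w q - w x0\<bar> \<le> e / 8"
      using Conv_Lipschitz[OF v(2) B(3) nq nx0] Bd by simp
    show ?case using 1 2 elim(2) e unfolding dist_real_def by linarith
  qed
qed

text \<open>Neighbourhoods that test more and more points of a countable ample set, ever more
  precisely, turn a failure of continuity into a pointwise convergent sequence. Dominated
  convergence then becomes applicable.\<close>

lemma continuous_on_Conv_sequentially:
  fixes F :: "(real^'n \<Rightarrow> real) \<Rightarrow> 'b::topological_space"
  assumes F: "\<And>v w. (\<And>n. v n \<in> Conv) \<Longrightarrow> w \<in> Conv \<Longrightarrow> (\<And>x. (\<lambda>n. v n x) \<longlonglongrightarrow> w x) \<Longrightarrow> (\<lambda>n::nat. F (v n)) \<longlonglongrightarrow> F w"
  shows "continuous_on Conv F"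
  unfolding continuous_on_topological
proof (intro ballI allI impI, rule ccontr)
  fix w :: "real^'n \<Rightarrow> real" and B assume w: "w \<in> Conv" and B: "open B" "F w \<in> B"
    and no: "\<nexists>A. open A \<and> w \<in> A \<and> (\<forall>y\<in>Conv. y \<in> A \<longrightarrow> F y \<in> B)"
  obtain Q :: "(real^'n) set" where Q: "countable Q" "ample Q" using countable_ample by blast
  have "Q \<noteq> {}" using Q(2) by (auto simp: ample_def)
  define q where "q = from_nat_into Q"
  define A where "A = (\<lambda>n. \<Inter>j\<in>{..n}. {u. \<bar>u (q j) - w (q j)\<bar> < inverse (real (Suc n))})"
  have "open (A n)" for n
    unfolding A_def by (intro open_INT ballI open_Collect_less continuous_intros) auto
  moreover have "w \<in> A n" for n by (simp add: A_def)
  ultimately have "\<exists>u. u \<in> Conv \<and> u \<in> A n \<and> F u \<notin> B" for n using no by blast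
  then obtain v where v: "\<And>n. v n \<in> Conv" "\<And>n. v n \<in> A n" "\<And>n. F (v n) \<notin> B" by metis
  have "(\<lambda>n. v n (q j)) \<longlonglongrightarrow> w (q j)" for j
  proof -
    have "eventually (\<lambda>n. norm (v n (q j) - w (q j)) \<le> inverse (real (Suc n))) sequentially"
      using eventually_ge_at_top[of j]
    proof eventually_elim
      case (elim n)
      then show ?case using v(2)[of n] by (auto simp: A_def less_imp_le simp del: of_nat_Suc)
    qed
    then have "(\<lambda>n. v n (q j) - w (q j)) \<longlonglongrightarrow> 0"
      using LIMSEQ_inverse_real_of_nat by (rule Lim_null_comparison)
    then show ?thesis by (rule LIM_zero_cancel)
  qed
  then have conv: "(\<lambda>n. v n p) \<longlonglongrightarrow> w p" if "p \<in> Q" for p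
    using from_nat_into_surj[OF Q(1) that] by (auto simp: q_def)
  have "(\<lambda>n. v n x) \<longlonglongrightarrow> w x" for x
    by (rule Conv_converges_on_ample[of v, OF v(1) w Q(2) conv tendsto_const])
  from F[OF v(1) w this] have "eventually (\<lambda>n. F (v n) \<in> B) sequentially"
    using B by (rule topological_tendstoD)
  then show False using v(3) by simp
qed

section \<open>Integrals over the fibers of the subdifferential\<close>

lemma local_subgrad:
  fixes v :: "real^'n \<Rightarrow> real"
  assumes v: "v \<in> Conv" and e: "e > 0" and le: "\<And>z. z \<in> ball p e \<Longrightarrow> v p + y \<bullet> (z - p) \<le> v z"
  shows "y \<in> subgrad v p"
proof -
  have "(\<lambda>z. v z + (z \<bullet> (- y) + 0)) \<in> Conv" by (intro Conv_add v Conv_affine)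
  then have "convex_on UNIV (\<lambda>z. v z + (z \<bullet> (- y) + 0))" by (simp add: Conv_def)
  from convex_local_global_minimum[OF e this, of p]
  have "\<forall>z\<in>UNIV. v p + (p \<bullet> (- y) + 0) \<le> v z + (z \<bullet> (- y) + 0)"
    using le by (simp add: inner_diff_right inner_commute algebra_simps)
  then show ?thesis
    unfolding subgrad_def by (simp add: inner_diff_right inner_commute algebra_simps)
qed

lemma local_subgrad_eq:
  fixes v :: "real^'n \<Rightarrow> real"
  assumes v: "v \<in> Conv" and w: "w \<in> Conv" and y: "y \<in> subgrad u p"
    and lt: "w p < v p" and eq: "\<And>z. w z < v z \<Longrightarrow> u z = f z" and f: "f \<in> Conv"
  shows "y \<in> subgrad f p"
proof -
  have "open {z. w z < v z}" using Conv_continuous[OF v] Conv_continuous[OF w] by (intro open_Collect_less)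
  then obtain e where e: "e > 0" "ball p e \<subseteq> {z. w z < v z}" using lt open_contains_ball_eq by blast
  show ?thesis
  proof (rule local_subgrad[OF f e(1)])
    fix z assume "z \<in> ball p e"
    then have "u z = f z" "u p = f p" using e lt eq by auto
    then show "f p + y \<bullet> (z - p) \<le> f z" using subgradD[OF y, of z] by simp
  qed
qed

section \<open>Subgradients of a maximum and a minimum\<close>

locale convex_max_min =
  fixes v w M m :: "real^'n \<Rightarrow> real"
  assumes v: "v \<in> Conv" and w: "w \<in> Conv" and M: "M \<in> Conv" and m: "m \<in> Conv"
    and M_def: "\<And>x. M x = max (v x) (w x)" and m_def: "\<And>x. m x = min (v x) (w x)"
begin

text \<open>At a tie, suppose \<open>v\<close> dips below the affine function \<open>L\<close> at
  \<open>a\<close> and \<open>w\<close> at \<open>b\<close>. Then \<open>v - w\<close> changes sign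
  between them; at a zero the maximum equals the minimum, which convexity of \<open>m\<close> puts
  below \<open>L\<close>, whereas \<open>M\<close> lies above \<open>L\<close>.\<close>

lemma subgrad_max_cases:
  assumes y: "y \<in> subgrad M p"
  shows "y \<in> subgrad v p \<or> y \<in> subgrad w p"
proof -
  consider "w p < v p" | "v p < w p" | "v p = w p" by linarith
  then show ?thesis
  proof cases
    case 1
    then show ?thesis using local_subgrad_eq[OF v w y 1 _ v] by (simp add: M_def)
  next
    case 2
    then show ?thesis using local_subgrad_eq[OF w v y 2 _ w] by (simp add: M_def)
  next
    case 3
    show ?thesis
    proof (rule ccontr)
      assume "\<not> ?thesis"
      then obtain a b where a: "v a < v p + y \<bullet> (a - p)" and b: "w b < w p + y \<bullet> (b - p)"
        unfolding subgrad_def by (auto simp: not_le)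
      define L where "L = (\<lambda>z. v p + y \<bullet> (z - p))"
      have leM: "L z \<le> max (v z) (w z)" for z
        using subgradD[OF y, of z] 3 by (simp add: L_def M_def)
      have a': "v a < w a" using a leM[of a] by (auto simp: L_def)
      have b': "w b < v b" using b leM[of b] 3 by (auto simp: L_def)
      define s where "s = (\<lambda>t::real. (1 - t) *\<^sub>R a + t *\<^sub>R b)"
      have cont: "continuous_on {0..1} (\<lambda>t. v (s t) - w (s t))"
        unfolding s_def
        by (intro continuous_intros continuous_on_compose2[OF Conv_continuous[OF v, of UNIV]]
            continuous_on_compose2[OF Conv_continuous[OF w, of UNIV]]) auto
      have "\<exists>t\<ge>0. t \<le> 1 \<and> v (s t) - w (s t) = 0"
        using a' b' by (intro IVT' cont) (auto simp: s_def)
      then obtain t where t: "0 \<le> t" "t \<le> 1" "v (s t) = w (s t)" by auto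
      have "m (s t) \<le> (1 - t) * m a + t * m b" unfolding s_def using ConvD[OF m] t by simp
      also have "\<dots> < (1 - t) * L a + t * L b"
      proof (cases "t = 0")
        case False
        have "m a \<le> v a" "m b \<le> w b" by (auto simp: m_def)
        then have "m a < L a" "m b < L b" using a b 3 by (auto simp: L_def)
        then have "(1 - t) * m a \<le> (1 - t) * L a" "t * m b < t * L b"
          using t False by (auto intro!: mult_left_mono)
        then show ?thesis by simp
      qed (use a a' in \<open>simp add: m_def L_def\<close>)
      also have "\<dots> = L (s t)" by (simp add: L_def s_def inner_diff_right inner_add_right algebra_simps)
      also have "\<dots> \<le> m (s t)" using leM[of "s t"] t by (simp add: m_def)
      finally show False by simp
    qed
  qed
qed

text \<open>With \<open>subgrad_Int\<close> this says that, for fixed \<open>y\<close>, the sets of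
  points having \<open>y\<close> as subgradient obey inclusion and exclusion, which is the valuation
  property slope by slope.\<close>

lemma subgrad_Un: "y \<in> subgrad M p \<or> y \<in> subgrad m p \<longleftrightarrow> y \<in> subgrad v p \<or> y \<in> subgrad w p"
proof
  assume "y \<in> subgrad M p \<or> y \<in> subgrad m p"
  then show "y \<in> subgrad v p \<or> y \<in> subgrad w p"
  proof
    assume y: "y \<in> subgrad m p"
    have "m z \<le> v z" "m z \<le> w z" for z by (auto simp: m_def)
    moreover have "m p = v p \<or> m p = w p" by (auto simp: m_def)
    ultimately show ?thesis using y unfolding subgrad_def by (smt (verit) mem_Collect_eq)
  qed (rule subgrad_max_cases)
next
  have *: "y \<in> subgrad M p \<or> y \<in> subgrad m p"
    if f: "f \<in> Conv" "g \<in> Conv" "y \<in> subgrad f p" "\<And>z. M z = max (f z) (g z)" "\<And>z. m z = min (f z) (g z)" for f g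
  proof (cases "f p < g p")
    case True
    then show ?thesis using local_subgrad_eq[OF f(2,1,3) True _ m] f(5) by simp
  next
    case False
    then have "M p = f p" "\<And>z. f z \<le> M z" by (auto simp: f(4))
    then show ?thesis using f(3) unfolding subgrad_def by (smt (verit) mem_Collect_eq)
  qed
  assume "y \<in> subgrad v p \<or> y \<in> subgrad w p"
  then show "y \<in> subgrad M p \<or> y \<in> subgrad m p"
    using *[OF v w] *[OF w v] by (auto simp: M_def m_def max.commute min.commute)
qed

lemma subgrad_Int: "y \<in> subgrad M p \<and> y \<in> subgrad m p \<longleftrightarrow> y \<in> subgrad v p \<and> y \<in> subgrad w p"
proof
  assume y: "y \<in> subgrad M p \<and> y \<in> subgrad m p"
  have *: "y \<in> subgrad f p"
    if f: "f \<in> Conv" "g \<in> Conv" "\<And>z. M z = max (f z) (g z)" "\<And>z. m z = min (f z) (g z)" for f g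
  proof (cases "g p < f p")
    case True
    then show ?thesis using local_subgrad_eq[OF f(1,2) conjunct1[OF y] True _ f(1)] f(3) by simp
  next
    case False
    then have "m p = f p" "\<And>z. m z \<le> f z" by (auto simp: f(4))
    then show ?thesis using y unfolding subgrad_def by (smt (verit) mem_Collect_eq)
  qed
  show "y \<in> subgrad v p \<and> y \<in> subgrad w p"
    using *[OF v w] *[OF w v] by (auto simp: M_def m_def max.commute min.commute)
next
  assume y: "y \<in> subgrad v p \<and> y \<in> subgrad w p"
  have "M p + y \<bullet> (z - p) \<le> M z \<and> m p + y \<bullet> (z - p) \<le> m z" for z
    using subgradD[of y v p z] subgradD[of y w p z] y unfolding M_def m_def by linarith
  then show "y \<in> subgrad M p \<and> y \<in> subgrad m p" by (simp add: subgrad_def)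
qed

end

text \<open>The set has at most one element; writing it as a sum lets \<open>sum.union_inter\<close>
  yield the valuation identity without a case distinction.\<close>

lemma fiber_eq_sum:
  assumes "y \<notin> multi v"
  shows "finite {x. y \<in> subgrad v x}" "fiber f v y = (\<Sum>x | y \<in> subgrad v x. f x y)"
proof -
  have "finite {x. y \<in> subgrad v x} \<and> fiber f v y = (\<Sum>x | y \<in> subgrad v x. f x y)"
  proof (cases "\<exists>x. y \<in> subgrad v x")
    case True
    then obtain x where x: "y \<in> subgrad v x" by auto
    then have "{x. y \<in> subgrad v x} = {x}" using assms by (auto simp: multi_def)
    then show ?thesis using preim_eq[OF assms x] uniqI[OF assms x] by (simp add: fiber_def)
  qed (auto simp: fiber_def uniq_def)
  then show "finite {x. y \<in> subgrad v x}" "fiber f v y = (\<Sum>x | y \<in> subgrad v x. f x y)" by auto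
qed

lemma fiber_valuation:
  fixes v w :: "real^'n \<Rightarrow> real"
  assumes C: "v \<in> Conv" "w \<in> Conv" "(\<lambda>x. max (v x) (w x)) \<in> Conv" "(\<lambda>x. min (v x) (w x)) \<in> Conv"
    and y: "y \<notin> multi v" "y \<notin> multi w" "y \<notin> multi (\<lambda>x. max (v x) (w x))" "y \<notin> multi (\<lambda>x. min (v x) (w x))"
  shows "fiber f (\<lambda>x. max (v x) (w x)) y + fiber f (\<lambda>x. min (v x) (w x)) y = fiber f v y + fiber f w y"
proof -
  interpret convex_max_min v w "\<lambda>x. max (v x) (w x)" "\<lambda>x. min (v x) (w x)"
    by unfold_locales (use C in auto)
  have U: "{x. y \<in> subgrad (\<lambda>x. max (v x) (w x)) x} \<union> {x. y \<in> subgrad (\<lambda>x. min (v x) (w x)) x}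
      = {x. y \<in> subgrad v x} \<union> {x. y \<in> subgrad w x}"
    using subgrad_Un by blast
  have I: "{x. y \<in> subgrad (\<lambda>x. max (v x) (w x)) x} \<inter> {x. y \<in> subgrad (\<lambda>x. min (v x) (w x)) x}
      = {x. y \<in> subgrad v x} \<inter> {x. y \<in> subgrad w x}"
    using subgrad_Int by blast
  show ?thesis
    unfolding fiber_eq_sum(2)[OF y(1)] fiber_eq_sum(2)[OF y(2)] fiber_eq_sum(2)[OF y(3)] fiber_eq_sum(2)[OF y(4)]
    using sum.union_inter[OF fiber_eq_sum(1)[OF y(3)] fiber_eq_sum(1)[OF y(4)], of "\<lambda>x. f x y"]
      sum.union_inter[OF fiber_eq_sum(1)[OF y(1)] fiber_eq_sum(1)[OF y(2)], of "\<lambda>x. f x y"] U I by simp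
qed

text \<open>Support is restricted in the first variable only. Growth in \<open>y\<close> is
  harmless, because subgradients over a bounded set are bounded.\<close>

definition admissible :: "(real^'n \<Rightarrow> real^'n \<Rightarrow> 'b::real_normed_vector) \<Rightarrow> bool" where
  "admissible f \<longleftrightarrow> continuous_on UNIV (\<lambda>(x, y). f x y) \<and> (\<exists>r. \<forall>x y. r < norm x \<longrightarrow> f x y = 0)"

lemma fiber_measurable:
  fixes f :: "real^'n \<Rightarrow> real^'n \<Rightarrow> 'b::{banach, second_countable_topology}"
  assumes v: "v \<in> Conv" and f: "continuous_on UNIV (\<lambda>(x, y). f x y)"
  shows "fiber f v \<in> borel_measurable lborel"
proof -
  have m: "(\<lambda>y. (preim v y, y)) \<in> borel_measurable (restrict_space lborel (uniq v))"
    using preim_measurable[OF v] by (intro borel_measurable_Pair) (auto intro: measurable_restrict_space1)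
  have "(\<lambda>y. (\<lambda>(x, y). f x y) (preim v y, y)) \<in> borel_measurable (restrict_space lborel (uniq v))"
    by (rule measurable_compose[OF m borel_measurable_continuous_onI[OF f]])
  then have "(\<lambda>y. indicator (uniq v) y *\<^sub>R f (preim v y) y) \<in> borel_measurable lborel"
    using uniq_measurable[OF v] by (subst (asm) borel_measurable_restrict_space_iff) auto
  also have "(\<lambda>y. indicator (uniq v) y *\<^sub>R f (preim v y) y) = fiber f v"
    by (auto simp: fiber_def fun_eq_iff)
  finally show ?thesis .
qed

text \<open>The radius depends on \<open>f\<close> alone and the constant only on \<open>B\<close>,
  not on \<open>v\<close>; this uniformity provides the dominating function along a convergent
  sequence.\<close>

lemma fiber_bound:
  fixes f :: "real^'n \<Rightarrow> real^'n \<Rightarrow> 'b::real_normed_vector"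
  assumes f: "admissible f"
  shows "\<exists>R. \<forall>B. \<exists>C. \<forall>v. (\<forall>z\<in>cball 0 R. \<bar>v z\<bar> \<le> B) \<longrightarrow> (\<forall>y. norm (fiber f v y) \<le> C * indicator (cball 0 (2 * B)) y)"
proof -
  obtain r where r: "\<And>x y. r < norm x \<Longrightarrow> f x y = 0" and c: "continuous_on UNIV (\<lambda>(x, y). f x y)"
    using f by (auto simp: admissible_def)
  have "\<exists>C. \<forall>v. (\<forall>z\<in>cball 0 (r + 1). \<bar>v z\<bar> \<le> B) \<longrightarrow> (\<forall>y. norm (fiber f v y) \<le> C * indicator (cball 0 (2 * B)) y)" for B
  proof -
    have "compact ((\<lambda>(x, y). f x y) ` (cball 0 r \<times> cball 0 (2 * B)))"
      by (intro compact_continuous_image continuous_on_subset[OF c] compact_Times compact_cball) auto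
    from compact_imp_bounded[OF this]
    obtain C where C0: "\<forall>p\<in>(\<lambda>(x, y). f x y) ` (cball 0 r \<times> cball 0 (2 * B)). norm p \<le> C"
      unfolding bounded_iff by blast
    have C: "norm (f x y) \<le> C" if "norm x \<le> r" "norm y \<le> 2 * B" for x y
      using C0[rule_format, OF imageI[of "(x, y)"]] that by simp
    have "norm (fiber f v y) \<le> max 0 C * indicator (cball 0 (2 * B)) y"
      if B: "\<forall>z\<in>cball 0 (r + 1). \<bar>v z\<bar> \<le> B" for v and y :: "real^'n"
    proof (cases "y \<in> uniq v \<and> norm (preim v y) \<le> r")
      case True
      then have "norm y \<le> 2 * B"
        using B by (intro subgrad_bound[of r v B "preim v y"] uniq_subgrad) auto
      with True C[of "preim v y" y] show ?thesis by (simp add: fiber_def)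
    qed (auto simp: fiber_def r not_le)
    then show ?thesis by blast
  qed
  then show ?thesis by blast
qed

lemma integrable_cball: "integrable lborel (\<lambda>y::real^'n. C * indicator (cball 0 s) y :: real)"
  by (intro integrable_mult_right integrable_real_indicator emeasure_lborel_cball_finite) auto

lemma fiber_integrable:
  fixes f :: "real^'n \<Rightarrow> real^'n \<Rightarrow> 'b::{banach, second_countable_topology}"
  assumes f: "admissible f" and v: "v \<in> Conv"
  shows "integrable lborel (fiber f v)"
proof -
  obtain R where R: "\<forall>B. \<exists>C. \<forall>v. (\<forall>z\<in>cball 0 R. \<bar>v z\<bar> \<le> B) \<longrightarrow> (\<forall>y. norm (fiber f v y) \<le> C * indicator (cball 0 (2 * B)) y)"
    using fiber_bound[OF f] ..
  obtain B where B: "\<forall>z\<in>cball 0 R. \<bar>v z\<bar> \<le> B" using Conv_bounded[OF v, of R] ..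
  obtain C where "\<forall>v. (\<forall>z\<in>cball 0 R. \<bar>v z\<bar> \<le> B) \<longrightarrow> (\<forall>y. norm (fiber f v y) \<le> C * indicator (cball 0 (2 * B)) y)"
    using R[rule_format, of B] ..
  then have C: "norm (fiber f v y) \<le> C * indicator (cball 0 (2 * B)) y" for y using B by blast
  show ?thesis
  proof (rule Bochner_Integration.integrable_bound[OF integrable_cball[of C "2 * B"]])
    show "fiber f v \<in> borel_measurable lborel" using f v by (intro fiber_measurable) (auto simp: admissible_def)
    have "norm (fiber f v y) \<le> norm (C * indicator (cball 0 (2 * B)) y)" for y
      using C[of y] by (simp only: real_norm_def)
    then show "AE y in lborel. norm (fiber f v y) \<le> norm (C * indicator (cball 0 (2 * B)) y)" by simp
  qed
qed

text \<open>Kept to a single test point \<open>z\<close>, because \<open>subgrad_persistent\<close>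
  knows the inequality only at the centre of its ball.\<close>

lemma subgrad_limit:
  fixes v :: "nat \<Rightarrow> real^'n \<Rightarrow> real"
  assumes v: "\<And>n. v n \<in> Conv" "w \<in> Conv" and conv: "\<And>x. (\<lambda>n. v n x) \<longlonglongrightarrow> w x"
    and x: "x \<longlonglongrightarrow> x0" and y: "\<And>n. v n (x n) + y \<bullet> (z - x n) \<le> v n z"
  shows "w x0 + y \<bullet> (z - x0) \<le> w z"
proof -
  have "(\<lambda>n. v n (x n)) \<longlonglongrightarrow> w x0"
    by (rule Conv_converges_on_ample[where v=v and w=w and Q=UNIV and x=x, OF v ample_UNIV]) (rule conv, rule x)
  moreover have "(\<lambda>n. y \<bullet> (z - x n)) \<longlonglongrightarrow> y \<bullet> (z - x0)"
    by (intro tendsto_inner tendsto_diff tendsto_const x)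
  ultimately have 1: "(\<lambda>n. v n (x n) + y \<bullet> (z - x n)) \<longlonglongrightarrow> w x0 + y \<bullet> (z - x0)"
    by (rule tendsto_add)
  show ?thesis
    by (rule LIMSEQ_le[OF 1 conv[of z]]) (use y in blast)
qed

text \<open>Minimise \<open>v n z - y \<bullet> z\<close> over the closed ball. An interior
  minimiser has \<open>y\<close> as subgradient; if minimisers stayed on the sphere along a
  subsequence, their limit would be a second point of \<open>w\<close> with subgradient
  \<open>y\<close>.\<close>

lemma subgrad_persistent:
  fixes v :: "nat \<Rightarrow> real^'n \<Rightarrow> real"
  assumes v: "\<And>n. v n \<in> Conv" and w: "w \<in> Conv" and conv: "\<And>x. (\<lambda>n. v n x) \<longlonglongrightarrow> w x"
    and y: "y \<in> uniq w" and e: "e > 0"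
  shows "eventually (\<lambda>n. \<exists>x\<in>ball (preim w y) e. y \<in> subgrad (v n) x) sequentially"
proof (rule ccontr)
  define x0 where "x0 = preim w y"
  assume "\<not> ?thesis"
  from not_eventually_sequentiallyD[OF this]
  obtain s where s: "strict_mono (s :: nat \<Rightarrow> nat)" "\<forall>n. \<not> (\<exists>x\<in>ball x0 e. y \<in> subgrad (v (s n)) x)"
    unfolding x0_def by (elim exE conjE)
  have "\<exists>z. dist x0 z = e \<and> v (s n) z + y \<bullet> (x0 - z) \<le> v (s n) x0" for n
  proof -
    have "continuous_on (cball x0 e) (\<lambda>z. v (s n) z - y \<bullet> z)"
      by (intro continuous_intros Conv_continuous v)
    then obtain z where z: "z \<in> cball x0 e" "\<And>u. u \<in> cball x0 e \<Longrightarrow> v (s n) z - y \<bullet> z \<le> v (s n) u - y \<bullet> u"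
      using continuous_attains_inf[OF compact_cball, of x0 e "\<lambda>z. v (s n) z - y \<bullet> z"] e by auto
    have "dist x0 z = e"
    proof (rule ccontr)
      assume "dist x0 z \<noteq> e"
      then have d: "dist x0 z < e" using z by simp
      have "y \<in> subgrad (v (s n)) z"
      proof (rule local_subgrad[OF v, of "e - dist x0 z"])
        fix u assume "u \<in> ball z (e - dist x0 z)"
        then have "u \<in> cball x0 e" using dist_triangle[of x0 u z] by simp
        from z(2)[OF this] show "v (s n) z + y \<bullet> (u - z) \<le> v (s n) u" by (simp add: inner_diff_right)
      qed (use d in simp)
      with d s(2) show False by auto
    qed
    moreover have "v (s n) z + y \<bullet> (x0 - z) \<le> v (s n) x0"
      using z(2)[of x0] e by (simp add: inner_diff_right)
    ultimately show ?thesis by blast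
  qed
  then obtain z where z: "\<And>n. dist x0 (z n) = e" "\<And>n. v (s n) (z n) + y \<bullet> (x0 - z n) \<le> v (s n) x0" by metis
  have "\<exists>z0\<in>sphere x0 e. \<exists>t. strict_mono (t :: nat \<Rightarrow> nat) \<and> (z \<circ> t) \<longlonglongrightarrow> z0"
    by (rule compact_sphere[unfolded compact_def, rule_format]) (simp add: z(1))
  then obtain z0 t where t: "z0 \<in> sphere x0 e" "strict_mono (t :: nat \<Rightarrow> nat)" "(z \<circ> t) \<longlonglongrightarrow> z0"
    by (elim bexE exE conjE)
  have "w z0 + y \<bullet> (x0 - z0) \<le> w x0"
  proof (rule subgrad_limit[where v="\<lambda>n. v (s (t n))" and x="\<lambda>n. z (t n)"])
    show "(\<lambda>n. v (s (t n)) x) \<longlonglongrightarrow> w x" for x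
      using LIMSEQ_subseq_LIMSEQ[OF conv strict_mono_o[OF s(1) t(2)], of x] by (simp add: o_def)
    show "(\<lambda>n. z (t n)) \<longlonglongrightarrow> z0" using t(3) by (simp add: o_def)
  qed (use v w z(2) in auto)
  moreover have "y \<in> subgrad w x0" unfolding x0_def by (rule uniq_subgrad[OF y])
  ultimately have "y \<in> subgrad w z0"
  proof -
    assume *: "w z0 + y \<bullet> (x0 - z0) \<le> w x0" "y \<in> subgrad w x0"
    have "w z0 + y \<bullet> (u - z0) \<le> w u" for u
      using *(1) subgradD[OF *(2), of u] by (simp add: inner_diff_right)
    then show ?thesis by (simp add: subgrad_def)
  qed
  then have "preim w y = z0" by (rule preim_eq[OF uniq_not_multi[OF y]])
  then show False using t(1) e by (simp add: x0_def)
qed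

text \<open>If \<open>y\<close> is a subgradient of \<open>w\<close>, its unique preimage is stable.
  Otherwise preimages under \<open>v n\<close> eventually leave the support of \<open>f\<close>,
  since a bounded subsequence would produce a preimage under \<open>w\<close>.\<close>

lemma fiber_tendsto:
  fixes v :: "nat \<Rightarrow> real^'n \<Rightarrow> real"
  assumes f: "admissible f" and v: "\<And>n. v n \<in> Conv" and w: "w \<in> Conv" and conv: "\<And>x. (\<lambda>n. v n x) \<longlonglongrightarrow> w x"
    and y: "y \<notin> multi w" "\<And>n. y \<notin> multi (v n)"
  shows "(\<lambda>n. fiber f (v n) y) \<longlonglongrightarrow> fiber f w y"
proof (cases "y \<in> uniq w")
  case True
  have ev: "eventually (\<lambda>n. y \<in> uniq (v n) \<and> dist (preim (v n) y) (preim w y) < e) sequentially" if "e > 0" for e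
    using subgrad_persistent[of v, OF v w conv True that]
  proof eventually_elim
    case (elim n)
    then obtain x where x: "dist (preim w y) x < e" "y \<in> subgrad (v n) x" by auto
    then show ?case using uniqI[OF y(2) x(2)] preim_eq[OF y(2) x(2)] by (simp add: dist_commute)
  qed
  have "(\<lambda>n. preim (v n) y) \<longlonglongrightarrow> preim w y"
    unfolding tendsto_iff
  proof (intro allI impI)
    show "eventually (\<lambda>n. dist (preim (v n) y) (preim w y) < e) sequentially" if "e > 0" for e
      using ev[OF that] by (rule eventually_mono) simp
  qed
  then have "(\<lambda>n. (preim (v n) y, y)) \<longlonglongrightarrow> (preim w y, y)" by (intro tendsto_intros)
  moreover have "continuous_on UNIV (\<lambda>(x, y). f x y)" using f by (simp add: admissible_def)
  ultimately have "(\<lambda>n. (\<lambda>(x, y). f x y) (preim (v n) y, y)) \<longlonglongrightarrow> (\<lambda>(x, y). f x y) (preim w y, y)"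
    by (intro continuous_on_tendsto_compose[of UNIV "\<lambda>(x, y). f x y"]) auto
  then have "(\<lambda>n. f (preim (v n) y) y) \<longlonglongrightarrow> fiber f w y" using True by (simp add: fiber_def)
  moreover have "eventually (\<lambda>n. f (preim (v n) y) y = fiber f (v n) y) sequentially"
    using ev[of 1] by (auto simp: fiber_def elim!: eventually_mono)
  ultimately show ?thesis by (rule Lim_transform_eventually)
next
  case False
  obtain r where r: "\<And>x y. r < norm x \<Longrightarrow> f x y = 0" using f by (auto simp: admissible_def)
  have "eventually (\<lambda>n. fiber f (v n) y = 0) sequentially"
  proof (rule ccontr)
    assume "\<not> ?thesis"
    from not_eventually_sequentiallyD[OF this]
    obtain s where s: "strict_mono (s :: nat \<Rightarrow> nat)" "\<forall>n. fiber f (v (s n)) y \<noteq> 0" by (elim exE conjE)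
    define x where "x = (\<lambda>n. preim (v (s n)) y)"
    have "y \<in> uniq (v (s n))" for n using spec[OF s(2), of n] by (auto simp: fiber_def split: if_splits)
    then have x: "y \<in> subgrad (v (s n)) (x n)" for n unfolding x_def by (rule uniq_subgrad)
    have "norm (x n) \<le> r" for n
      using spec[OF s(2), of n] r[of "x n" y] by (force simp: fiber_def x_def split: if_splits)
    then have "\<exists>x0\<in>cball 0 r. \<exists>t. strict_mono (t :: nat \<Rightarrow> nat) \<and> (x \<circ> t) \<longlonglongrightarrow> x0"
      by (intro compact_cball[unfolded compact_def, rule_format]) simp
    then obtain x0 t where t: "strict_mono (t :: nat \<Rightarrow> nat)" "(x \<circ> t) \<longlonglongrightarrow> x0"
      by (elim bexE exE conjE)
    have "w x0 + y \<bullet> (z - x0) \<le> w z" for z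
    proof (rule subgrad_limit[where v="\<lambda>n. v (s (t n))" and x="\<lambda>n. x (t n)"])
      show "(\<lambda>n. v (s (t n)) x) \<longlonglongrightarrow> w x" for x
        using LIMSEQ_subseq_LIMSEQ[OF conv strict_mono_o[OF s(1) t(1)], of x] by (simp add: o_def)
      show "(\<lambda>n. x (t n)) \<longlonglongrightarrow> x0" using t(2) by (simp add: o_def)
      show "v (s (t n)) (x (t n)) + y \<bullet> (z - x (t n)) \<le> v (s (t n)) z" for n by (rule subgradD[OF x])
    qed (use v w in auto)
    then have "y \<in> subgrad w x0" by (simp add: subgrad_def)
    then show False using False uniqI[OF y(1)] by blast
  qed
  then have "(\<lambda>n. fiber f (v n) y) \<longlonglongrightarrow> 0" by (rule tendsto_eventually)
  then show ?thesis using False by (simp add: fiber_def)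
qed

definition fiber_integral :: "(real^'n \<Rightarrow> real^'n \<Rightarrow> 'b::{banach, second_countable_topology}) \<Rightarrow> (real^'n \<Rightarrow> real) \<Rightarrow> 'b" where
  "fiber_integral f v = (\<integral>y. fiber f v y \<partial>lborel)"

lemma fiber_integral_continuous:
  fixes f :: "real^'n \<Rightarrow> real^'n \<Rightarrow> 'b::{banach, second_countable_topology}"
  assumes f: "admissible f"
  shows "continuous_on Conv (fiber_integral f)"
proof (rule continuous_on_Conv_sequentially)
  fix v and w :: "real^'n \<Rightarrow> real"
  assume v: "\<And>n::nat. v n \<in> Conv" and w: "w \<in> Conv" and conv: "\<And>x. (\<lambda>n. v n x) \<longlonglongrightarrow> w x"
  obtain R where R: "\<forall>B. \<exists>C. \<forall>v. (\<forall>z\<in>cball 0 R. \<bar>v z\<bar> \<le> B) \<longrightarrow> (\<forall>y. norm (fiber f v y) \<le> C * indicator (cball 0 (2 * B)) y)"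
    using fiber_bound[OF f] ..
  have "convergent (\<lambda>n. v n q)" for q using conv by (rule convergentI)
  from Conv_equibounded[of v, OF v ample_UNIV this, of R]
  obtain B where B: "\<And>n. \<forall>z\<in>cball 0 R. \<bar>v n z\<bar> \<le> B" by blast
  obtain C where "\<forall>v. (\<forall>z\<in>cball 0 R. \<bar>v z\<bar> \<le> B) \<longrightarrow> (\<forall>y. norm (fiber f v y) \<le> C * indicator (cball 0 (2 * B)) y)"
    using R[rule_format, of B] ..
  then have C: "norm (fiber f (v n) y) \<le> C * indicator (cball 0 (2 * B)) y" for n y using B by blast
  have cont: "continuous_on UNIV (\<lambda>(x, y). f x y)" using f by (simp add: admissible_def)
  show "(\<lambda>n. fiber_integral f (v n)) \<longlonglongrightarrow> fiber_integral f w"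
    unfolding fiber_integral_def
  proof (rule integral_dominated_convergence[OF _ _ integrable_cball[of C "2 * B"]])
    have "AE y in lborel. y \<notin> multi w" "AE y in lborel. \<forall>n. y \<notin> multi (v n)"
      using AE_not_multi[OF w] AE_not_multi[OF v] by (auto simp: AE_all_countable)
    then show "AE y in lborel. (\<lambda>n. fiber f (v n) y) \<longlonglongrightarrow> fiber f w y"
    proof eventually_elim
      case (elim y)
      then show ?case by (intro fiber_tendsto[of f v, OF f v w conv]) auto
    qed
  qed (use C fiber_measurable[OF v cont] fiber_measurable[OF w cont] in auto)
qed

lemma fiber_integral_valuation:
  fixes f :: "real^'n \<Rightarrow> real^'n \<Rightarrow> 'b::{banach, second_countable_topology}"
  assumes f: "admissible f"
  shows "is_valuation (fiber_integral f)"
  unfolding is_valuation_def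
proof (intro ballI impI)
  fix v w :: "real^'n \<Rightarrow> real"
  let ?M = "\<lambda>x. max (v x) (w x)" and ?m = "\<lambda>x. min (v x) (w x)"
  assume C: "v \<in> Conv" "w \<in> Conv" "?M \<in> Conv" "?m \<in> Conv"
  have "fiber_integral f ?M + fiber_integral f ?m = (\<integral>y. fiber f ?M y + fiber f ?m y \<partial>lborel)"
    unfolding fiber_integral_def using C f
    by (intro Bochner_Integration.integral_add[symmetric] fiber_integrable)
  also have "\<dots> = (\<integral>y. fiber f v y + fiber f w y \<partial>lborel)"
  proof (rule integral_cong_AE)
    show "AE y in lborel. fiber f ?M y + fiber f ?m y = fiber f v y + fiber f w y"
      using AE_not_multi[OF C(1)] AE_not_multi[OF C(2)] AE_not_multi[OF C(3)] AE_not_multi[OF C(4)]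
      by eventually_elim (rule fiber_valuation[OF C])
  qed (intro borel_measurable_integrable Bochner_Integration.integrable_add fiber_integrable f C)+
  also have "\<dots> = fiber_integral f v + fiber_integral f w"
    unfolding fiber_integral_def using C f
    by (intro Bochner_Integration.integral_add fiber_integrable)
  finally show "fiber_integral f ?M + fiber_integral f ?m = fiber_integral f v + fiber_integral f w" .
qed

lemma subgrad_add_affine: "y \<in> subgrad (\<lambda>x. v x + (x \<bullet> a + b)) p \<longleftrightarrow> y - a \<in> subgrad v p"
  unfolding subgrad_def by (simp add: inner_diff_left inner_diff_right inner_commute algebra_simps)

lemma fiber_add_affine:
  "fiber f (\<lambda>x. v x + (x \<bullet> a + b)) y = fiber (\<lambda>p y. f p (y + a)) v (y - a)"
  by (simp add: fiber_def uniq_def preim_def subgrad_add_affine)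

lemma admissible_translate:
  fixes f :: "real^'n \<Rightarrow> real^'n \<Rightarrow> 'b::real_normed_vector"
  assumes "admissible f"
  shows "admissible (\<lambda>p y. f p (y + a))"
proof -
  have c: "continuous_on UNIV (\<lambda>(x, y). f x y)" using assms by (simp add: admissible_def)
  have "continuous_on UNIV (\<lambda>q. (\<lambda>(x, y). f x y) (fst q, snd q + a))"
    by (intro continuous_on_compose2[OF c] continuous_intros) auto
  then have "continuous_on UNIV (\<lambda>(x, y). f x (y + a))" by (simp add: case_prod_beta')
  then show ?thesis using assms unfolding admissible_def by blast
qed

lemma fiber_integral_add_affine:
  fixes f :: "real^'n \<Rightarrow> real^'n \<Rightarrow> 'b::{banach, second_countable_topology}"
  assumes f: "admissible f" and v: "v \<in> Conv"
  shows "fiber_integral f (\<lambda>x. v x + (x \<bullet> a + b)) = fiber_integral (\<lambda>p y. f p (y + a)) v"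
proof -
  let ?F = "fiber (\<lambda>p y. f p (y + a)) v"
  have m: "?F \<in> borel_measurable borel"
    using fiber_measurable[OF v, of "\<lambda>p y. f p (y + a)"] admissible_translate[OF f, of a] by (simp add: admissible_def)
  have "fiber_integral f (\<lambda>x. v x + (x \<bullet> a + b)) = (\<integral>y. ?F (- a + y) \<partial>lborel)"
    unfolding fiber_integral_def fiber_add_affine by simp
  also have "\<dots> = (\<integral>y. ?F y \<partial>(distr lborel borel ((+) (- a))))"
    using m by (subst integral_distr) auto
  finally show ?thesis by (simp add: lborel_distr_plus fiber_integral_def)
qed

lemma fiber_integral_sum:
  assumes "admissible f" "admissible g" "v \<in> Conv"
  shows "fiber_integral (\<lambda>x y. f x y + g x y) v = fiber_integral f v + fiber_integral g v"
proof -
  have "fiber (\<lambda>x y. f x y + g x y) v = (\<lambda>y. fiber f v y + fiber g v y)"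
    by (auto simp: fiber_def fun_eq_iff)
  then show ?thesis unfolding fiber_integral_def
    using Bochner_Integration.integral_add[OF fiber_integrable[OF assms(1,3)] fiber_integrable[OF assms(2,3)]] by simp
qed

lemma fiber_integral_bounded_linear:
  assumes "bounded_linear T" "admissible f" "v \<in> Conv"
  shows "fiber_integral (\<lambda>x y. T (f x y)) v = T (fiber_integral f v)"
proof -
  interpret bounded_linear T by fact
  have "fiber (\<lambda>x y. T (f x y)) v = (\<lambda>y. T (fiber f v y))"
    by (auto simp: fiber_def fun_eq_iff zero)
  then show ?thesis unfolding fiber_integral_def
    using integral_bounded_linear[OF assms(1) fiber_integrable[OF assms(2,3)]] by simp
qed

text \<open>Testing a subgradient in the directions \<open>a\<close> and \<open>- a\<close> confines
  it to the hyperplane \<open>a \<bullet> y = c\<close>, a null set of slopes.\<close>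

lemma fiber_integral_hyperplane:
  fixes f :: "real^'n \<Rightarrow> real^'n \<Rightarrow> 'b::{banach, second_countable_topology}"
  assumes f: "admissible f" and v: "v \<in> Conv" and a: "a \<noteq> 0"
    and inv: "\<And>x t. v (x + t *\<^sub>R a) = v x + t * c"
  shows "fiber_integral f v = 0"
proof -
  have *: "a \<bullet> y = c" if "y \<in> subgrad v x" for x y
    using subgradD[OF that, of "x + 1 *\<^sub>R a"] subgradD[OF that, of "x + (-1) *\<^sub>R a"]
    unfolding inv inner_commute[of a] by simp
  have zero: "fiber f v y = 0" if "y \<notin> {y. a \<bullet> y = c}" for y
    using that *[OF uniq_subgrad[of y v]] by (auto simp: fiber_def)
  have "negligible {y. a \<bullet> y = c}" using a by (simp add: negligible_hyperplane)
  moreover have "{y. a \<bullet> y = c} \<in> sets lborel" by (simp add: closed_hyperplane)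
  ultimately have "{y. a \<bullet> y = c} \<in> null_sets lborel"
    by (simp only: negligible_iff_null_sets null_sets_completion_iff)
  then have "AE y in lborel. fiber f v y = 0" by (rule AE_I') (use zero in auto)
  then show ?thesis
    unfolding fiber_integral_def using integral_cong_AE[of "fiber f v" lborel "\<lambda>_. 0"]
      fiber_integrable[OF f v] by auto
qed

text \<open>Slopes in the open unit cube belong to \<open>p\<close> alone, slopes outside the closed
  cube to no point, and the boundary is null. The cube has volume 1.\<close>

lemma fiber_integral_vertex:
  fixes \<zeta> :: "real^'n \<Rightarrow> real"
  assumes adm: "admissible (\<lambda>x (y :: real^'n). \<zeta> x)"
  shows "fiber_integral (\<lambda>x y. \<zeta> x) (\<lambda>x. \<Sum>i\<in>UNIV. kink (axis i 1, p $ i) x) = \<zeta> p"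
proof -
  define q where "q = (\<lambda>x::real^'n. \<Sum>i\<in>UNIV. max 0 (x $ i - p $ i))"
  have q_eq: "(\<lambda>x. \<Sum>i\<in>UNIV. kink (axis i 1, p $ i) x) = q"
    by (auto simp: q_def kink_def inner_axis)
  have qC: "q \<in> Conv" unfolding q_eq[symmetric] by (intro Conv_sum kink_Conv) simp
  have one_Basis: "(1 :: real^'n) \<bullet> b = 1" if "b \<in> Basis" for b
    using that by (auto simp: Basis_vec_def inner_axis)
  let ?U = "cbox 0 (1 :: real^'n)" and ?O = "box 0 (1 :: real^'n)"
  have inside: "y \<in> uniq q \<and> preim q y = p" if y: "y \<in> ?O" for y
  proof -
    have y01: "0 < y $ i" "y $ i < 1" for i using y by (auto simp: mem_box_cart)
    have y_sub: "y \<in> subgrad q p"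
      unfolding subgrad_def
    proof (intro CollectI allI)
      fix z
      have "y $ i * (z $ i - p $ i) \<le> max 0 (z $ i - p $ i)" for i
        using y01[of i] mult_left_le[of "y $ i" "z $ i - p $ i"]
        by (cases "z $ i \<ge> p $ i") (auto simp: mult_nonneg_nonpos mult.commute)
      then show "q p + y \<bullet> (z - p) \<le> q z" by (simp add: q_def inner_vec_def sum_mono)
    qed
    have unique: "x = p" if x: "y \<in> subgrad q x" for x
    proof (rule ccontr)
      assume "x \<noteq> p"
      then obtain j where j: "x $ j \<noteq> p $ j" by (auto simp: vec_eq_iff)
      have le: "y $ i * (x $ i - p $ i) \<le> max 0 (x $ i - p $ i)" for i
        using y01[of i] mult_left_le[of "y $ i" "x $ i - p $ i"]
        by (cases "x $ i \<ge> p $ i") (auto simp: mult_nonneg_nonpos mult.commute)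
      have less: "y $ j * (x $ j - p $ j) < max 0 (x $ j - p $ j)"
        using y01[of j] j mult_strict_right_mono[of "y $ j" 1 "x $ j - p $ j"]
        by (cases "x $ j \<ge> p $ j") (auto simp: mult_pos_neg)
      have "(\<Sum>i\<in>UNIV. y $ i * (x $ i - p $ i)) < (\<Sum>i\<in>UNIV. max 0 (x $ i - p $ i))"
        by (rule sum_strict_mono_ex1) (use le less in auto)
      then have "y \<bullet> (x - p) < q x" by (simp add: q_def inner_vec_def)
      moreover have "q x + y \<bullet> (p - x) \<le> q p" by (rule subgradD[OF x])
      moreover have "q p = 0" by (simp add: q_def)
      ultimately show False by (simp add: inner_diff_right)
    qed
    have "y \<notin> multi q" using unique by (auto simp: multi_def)
    then show ?thesis using uniqI[OF _ y_sub] preim_eq[OF _ y_sub] by simp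
  qed
  have outside: "y \<notin> uniq q" if y: "y \<notin> ?U" for y
  proof
    assume "y \<in> uniq q"
    then obtain x where x: "y \<in> subgrad q x" by (auto simp: uniq_def)
    have q_axis: "q (x + t *\<^sub>R axis i 1) = q x + (max 0 (x $ i + t - p $ i) - max 0 (x $ i - p $ i))" for t i
    proof -
      have "(\<Sum>j\<in>UNIV - {i}. max 0 ((x + t *\<^sub>R axis i 1) $ j - p $ j)) = (\<Sum>j\<in>UNIV - {i}. max 0 (x $ j - p $ j))"
        by (intro sum.cong) (auto simp: axis_def)
      then show ?thesis by (simp add: q_def sum.remove[of UNIV i])
    qed
    from y obtain i where "y $ i < 0 \<or> 1 < y $ i" by (auto simp: mem_box_cart not_le)
    then show False
    proof
      assume "y $ i < 0"
      then show False using subgradD[OF x, of "x + (-1) *\<^sub>R axis i 1"] unfolding q_axis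
        by (simp add: inner_axis)
    next
      assume "1 < y $ i"
      then show False using subgradD[OF x, of "x + 1 *\<^sub>R axis i 1"] unfolding q_axis
        by (simp add: inner_axis)
    qed
  qed
  have null: "?U - ?O \<in> null_sets lborel"
  proof -
    have "negligible (?U - ?O)" by (rule negligible_frontier_interval)
    then show ?thesis
      by (simp add: negligible_iff_null_sets null_sets_completion_iff)
  qed
  have "(\<integral>y. fiber (\<lambda>x y. \<zeta> x) q y \<partial>lborel) = (\<integral>y. indicator ?O y *\<^sub>R \<zeta> p \<partial>lborel)"
  proof (rule integral_cong_AE)
    have "fiber (\<lambda>x y. \<zeta> x) q y = indicator ?O y *\<^sub>R \<zeta> p" if "y \<notin> ?U - ?O" for y
      using that inside[of y] outside[of y] by (cases "y \<in> ?O") (auto simp: fiber_def)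
    then show "AE y in lborel. fiber (\<lambda>x y. \<zeta> x) q y = indicator ?O y *\<^sub>R \<zeta> p"
      using null by (intro AE_I'[OF null]) auto
    show "fiber (\<lambda>x y. \<zeta> x) q \<in> borel_measurable lborel"
      by (rule borel_measurable_integrable[OF fiber_integrable[OF adm qC]])
  qed simp
  also have "\<dots> = \<zeta> p"
    using one_Basis by (simp add: emeasure_lborel_box_eq measure_def)
  finally show ?thesis unfolding q_eq fiber_integral_def .
qed

section \<open>The integral representation\<close>

lemma Cc_support:
  assumes "g \<in> Cc"
  obtains r where "\<And>x :: real^'n. r < norm x \<Longrightarrow> g x = 0"
proof -
  obtain K where K: "compact K" "\<And>x. x \<notin> K \<Longrightarrow> g x = 0" using assms by (auto simp: Cc_def)
  obtain r where r: "\<forall>x\<in>K. norm x \<le> r" using compact_imp_bounded[OF K(1)] by (auto simp: bounded_iff)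
  show ?thesis
  proof (rule that[of r])
    show "g x = 0" if "r < norm x" for x using K(2)[of x] r that by force
  qed
qed

lemma admissible_Cc:
  fixes g :: "real^'n \<Rightarrow> 'b::real_normed_vector"
  assumes g: "g \<in> Cc"
  shows "admissible (\<lambda>x (y :: real^'n). g x)"
proof -
  have c: "continuous_on UNIV g" using g by (simp add: Cc_def)
  have "continuous_on UNIV (\<lambda>q :: (real^'n) \<times> (real^'n). g (fst q))"
    by (intro continuous_on_compose2[OF c] continuous_intros) auto
  then have "continuous_on UNIV (\<lambda>(x, y :: real^'n). g x)" by (simp add: case_prod_beta')
  moreover obtain r where "\<And>x. r < norm x \<Longrightarrow> g x = 0" using Cc_support[OF g] by blast
  ultimately show ?thesis unfolding admissible_def by blast
qed

lemma admissible_Cc_scaleR: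
  fixes g :: "real^'n \<Rightarrow> real"
  assumes g: "g \<in> Cc"
  shows "admissible (\<lambda>x y. g x *\<^sub>R y)"
proof -
  have c: "continuous_on UNIV g" using g by (simp add: Cc_def)
  have "continuous_on UNIV (\<lambda>q :: (real^'n) \<times> (real^'n). g (fst q) *\<^sub>R snd q)"
    by (intro continuous_intros continuous_on_compose2[OF c]) auto
  then have "continuous_on UNIV (\<lambda>(x, y :: real^'n). g x *\<^sub>R y)" by (simp add: case_prod_beta')
  moreover obtain r where "\<And>x. r < norm x \<Longrightarrow> g x = 0" using Cc_support[OF g] by blast
  ultimately show ?thesis unfolding admissible_def by (metis scaleR_zero_left)
qed

lemma admissible_add:
  fixes f g :: "real^'n \<Rightarrow> real^'n \<Rightarrow> 'b::real_normed_vector"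
  assumes "admissible f" "admissible g"
  shows "admissible (\<lambda>x y. f x y + g x y)"
proof -
  obtain r where "\<forall>x y. r < norm x \<longrightarrow> f x y = 0" using assms(1) unfolding admissible_def by blast
  moreover obtain s where "\<forall>x y. s < norm x \<longrightarrow> g x y = 0" using assms(2) unfolding admissible_def by blast
  ultimately have "\<forall>x y. max r s < norm x \<longrightarrow> f x y + g x y = 0" by simp
  moreover have "continuous_on UNIV (\<lambda>(x, y). f x y + g x y)"
    using assms continuous_on_add[of UNIV "\<lambda>(x, y). f x y" "\<lambda>(x, y). g x y"]
    by (simp add: admissible_def case_prod_beta')
  ultimately show ?thesis unfolding admissible_def by blast
qed

lemma is_valuationD:
  assumes "is_valuation Z" "v \<in> Conv" "w \<in> Conv" "(\<lambda>x. max (v x) (w x)) \<in> Conv" "(\<lambda>x. min (v x) (w x)) \<in> Conv"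
  shows "Z (\<lambda>x. max (v x) (w x)) + Z (\<lambda>x. min (v x) (w x)) = Z v + Z w"
  using assms by (simp add: is_valuation_def)

lemma is_valuation_diff:
  fixes Z W :: "(real^'n \<Rightarrow> real) \<Rightarrow> 'a::ab_group_add"
  assumes "is_valuation Z" "is_valuation W"
  shows "is_valuation (\<lambda>v. Z v - W v)"
  using assms unfolding is_valuation_def by (simp add: add_diff_add[symmetric])

lemma is_valuation_additive:
  assumes "\<And>x y. f (x + y) = f x + f y" "is_valuation Z"
  shows "is_valuation (\<lambda>v. f (Z v))"
  using assms(2) unfolding is_valuation_def assms(1)[symmetric] by simp

lemma is_valuation_add_affine:
  fixes Z :: "(real^'n \<Rightarrow> real) \<Rightarrow> 'a::ab_semigroup_add"
  assumes Z: "is_valuation Z"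
  shows "is_valuation (\<lambda>v. Z (\<lambda>x. v x + (x \<bullet> a + b)))"
  unfolding is_valuation_def
proof (intro ballI impI)
  fix v w :: "real^'n \<Rightarrow> real"
  let ?l = "\<lambda>x. x \<bullet> a + b" and ?M = "\<lambda>x. max (v x) (w x)" and ?m = "\<lambda>x. min (v x) (w x)"
  assume C: "v \<in> Conv" "w \<in> Conv" "?M \<in> Conv" "?m \<in> Conv"
  have eq: "(\<lambda>x. ?M x + ?l x) = (\<lambda>x. max (v x + ?l x) (w x + ?l x))"
    "(\<lambda>x. ?m x + ?l x) = (\<lambda>x. min (v x + ?l x) (w x + ?l x))" by auto
  have "(\<lambda>x. u x + ?l x) \<in> Conv" if "u \<in> Conv" for u by (intro Conv_add that Conv_affine)
  from this[OF C(1)] this[OF C(2)] this[OF C(3)] this[OF C(4)]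
  show "Z (\<lambda>x. ?M x + ?l x) + Z (\<lambda>x. ?m x + ?l x) = Z (\<lambda>x. v x + ?l x) + Z (\<lambda>x. w x + ?l x)"
    unfolding eq by (rule is_valuationD[OF Z])
qed

lemma fiber_integral_scaleR_add_affine:
  fixes v :: "real^'n \<Rightarrow> real"
  assumes \<zeta>: "\<zeta> \<in> Cc" and v: "v \<in> Conv"
  shows "fiber_integral (\<lambda>x y. \<zeta> x *\<^sub>R y) (\<lambda>x. v x + (x \<bullet> a + b))
    = fiber_integral (\<lambda>x y. \<zeta> x *\<^sub>R y) v + fiber_integral (\<lambda>x y. \<zeta> x) v *\<^sub>R a"
proof -
  have g: "admissible (\<lambda>x y :: real^'n. \<zeta> x *\<^sub>R y)" by (rule admissible_Cc_scaleR[OF \<zeta>])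
  have "fiber_integral (\<lambda>x y. \<zeta> x *\<^sub>R y) (\<lambda>x. v x + (x \<bullet> a + b))
    = fiber_integral (\<lambda>x y. \<zeta> x *\<^sub>R y + \<zeta> x *\<^sub>R a) v"
    by (simp add: fiber_integral_add_affine[OF g v] scaleR_add_right)
  also have "\<dots> = fiber_integral (\<lambda>x y. \<zeta> x *\<^sub>R y) v + fiber_integral (\<lambda>x y. \<zeta> x *\<^sub>R a) v"
  proof (rule fiber_integral_sum[OF g _ v])
    have "(\<lambda>x. \<zeta> x *\<^sub>R a) \<in> Cc"
      using \<zeta> unfolding Cc_def by (auto intro: continuous_on_scaleR continuous_on_const)
    then show "admissible (\<lambda>x (y :: real^'n). \<zeta> x *\<^sub>R a)" by (rule admissible_Cc)
  qed
  also have "fiber_integral (\<lambda>x y. \<zeta> x *\<^sub>R a) v = fiber_integral (\<lambda>x y. \<zeta> x) v *\<^sub>R a"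
    by (rule fiber_integral_bounded_linear[OF bounded_linear_scaleR_left admissible_Cc[OF \<zeta>] v])
  finally show ?thesis .
qed

theorem (in simple_valuation) representation:
  assumes v: "v \<in> Conv"
  shows "Z v = fiber_integral (\<lambda>x y. vertex x) v"
proof -
  let ?J = "fiber_integral (\<lambda>x (y :: real^'n). vertex x)"
  have adm: "admissible (\<lambda>x (y :: real^'n). vertex x)" by (intro admissible_Cc vertex_Cc)
  interpret diff: simple_valuation "\<lambda>v. Z v - ?J v"
  proof
    show "continuous_on Conv (\<lambda>v. Z v - ?J v)"
      by (intro continuous_on_diff continuous fiber_integral_continuous adm)
    show "is_valuation (\<lambda>v. Z v - ?J v)"
      by (intro is_valuation_diff valuation fiber_integral_valuation adm)
    show "Z (\<lambda>x. v x + (x \<bullet> a + b)) - ?J (\<lambda>x. v x + (x \<bullet> a + b)) = Z v - ?J v" if "v \<in> Conv" for v a b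
      using affine[OF that] fiber_integral_add_affine[OF adm that] by simp
    show "Z v - ?J v = 0" if "v \<in> Conv" "a \<noteq> 0" "\<And>x t. v (x + t *\<^sub>R a) = v x" for v a
      using simple[OF that] fiber_integral_hyperplane[OF adm that(1,2), of 0] that(3) by simp
  qed
  have "diff.vertex p = 0" for p
    unfolding diff.vertex_def fiber_integral_vertex[OF adm] by (simp add: vertex_def)
  from diff.vertex_zero_imp_zero[OF this v] show ?thesis by simp
qed

lemma proj_onto_eqI:
  assumes E: "subspace E" and p: "p \<in> E" "\<And>e. e \<in> E \<Longrightarrow> (x - p) \<bullet> e = 0"
  shows "proj_onto E x = p"
  unfolding proj_onto_def
proof (rule the_equality)
  show "p \<in> E \<and> (\<forall>e\<in>E. (x - p) \<bullet> e = 0)" using p by blast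
  fix q assume q: "q \<in> E \<and> (\<forall>e\<in>E. (x - q) \<bullet> e = 0)"
  then have "p - q \<in> E" using E p by (simp add: subspace_diff)
  then have "(x - q) \<bullet> (p - q) - (x - p) \<bullet> (p - q) = 0" using p(2) q by simp
  then have "(p - q) \<bullet> (p - q) = 0" by (simp add: inner_diff_left)
  then show "q = p" by simp
qed

text \<open>The hyperplane orthogonal to \<open>a\<close> serves as \<open>E\<close>: its projection
  moves points only along \<open>a\<close>.\<close>

lemma dually_simple_direction:
  fixes z :: "(real^'n \<Rightarrow> real) \<Rightarrow> real^'n" and a :: "real^'n"
  assumes z: "dually_simple z" and v: "v \<in> Conv" and l: "linear l" and a: "a \<noteq> 0"
    and inv: "\<And>x t. v (x + t *\<^sub>R a) - l (x + t *\<^sub>R a) = v x - l x"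
  shows "z v = 0"
proof -
  let ?E = "{x. a \<bullet> x = 0}"
  have E: "subspace ?E" by (rule subspace_hyperplane)
  have "a \<notin> ?E" using a by simp
  then have "?E \<noteq> UNIV" by blast
  moreover have "v x - l x = v (proj_onto ?E x) - l (proj_onto ?E x)" for x
  proof -
    have "proj_onto ?E x = x + (- ((a \<bullet> x) / (a \<bullet> a))) *\<^sub>R a"
      using a by (intro proj_onto_eqI E) (auto simp: inner_add_right inner_diff_left inner_diff_right)
    then show ?thesis by (simp only: inv)
  qed
  ultimately show ?thesis using z v l E unfolding dually_simple_def by blast
qed

lemma dually_simple_fiber_integral:
  fixes f :: "real^'n \<Rightarrow> real^'n \<Rightarrow> real^'n"
  assumes f: "admissible f" and z: "\<And>v. v \<in> Conv \<Longrightarrow> z v = fiber_integral f v"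
  shows "dually_simple z"
  unfolding dually_simple_def
proof (intro ballI impI, elim exE conjE)
  fix v :: "real^'n \<Rightarrow> real" and l :: "real^'n \<Rightarrow> real" and E :: "(real^'n) set"
  assume v: "v \<in> Conv" and l: "linear l" and E: "subspace E" "E \<noteq> UNIV"
    and eq: "\<forall>x. v x - l x = v (proj_onto E x) - l (proj_onto E x)"
  \<comment> \<open>A direction orthogonal to \<open>E\<close> exists because \<open>E\<close> is
    proper, and \<open>v - l\<close> is constant along it; hence all subgradients lie in one
    hyperplane.\<close>
  have "span E \<subset> span UNIV" using E by (auto simp: span_eq_iff[THEN iffD2])
  from orthogonal_to_subspace_exists_gen[OF this] obtain a where
    a: "a \<noteq> 0" "\<And>e. e \<in> E \<Longrightarrow> orthogonal a e" by (metis span_base)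
  have "v (x + t *\<^sub>R a) = v x + t * l a" for x t
  proof -
    obtain p q where pq: "p \<in> span E" "\<And>w. w \<in> span E \<Longrightarrow> orthogonal q w" "x = p + q"
      using orthogonal_subspace_decomp_exists[of E x] by blast
    have "proj_onto E x = p"
      using pq E by (intro proj_onto_eqI) (auto simp: orthogonal_def span_base span_eq_iff[THEN iffD2])
    moreover have "proj_onto E (x + t *\<^sub>R a) = p"
      using pq E a by (intro proj_onto_eqI) (auto simp: orthogonal_def span_base span_eq_iff[THEN iffD2] inner_add_left)
    ultimately have "v (x + t *\<^sub>R a) - l (x + t *\<^sub>R a) = v x - l x" using eq by metis
    then show ?thesis using l by (simp add: linear_add linear_scale)
  qed
  then show "z v = 0" using fiber_integral_hyperplane[OF f v a(1), of "l a"] z[OF v] by simp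
qed

lemma integral_representation_properties:
  fixes z :: "(real^'n \<Rightarrow> real) \<Rightarrow> real^'n" and \<psi> :: "real^'n \<Rightarrow> real^'n" and \<zeta> :: "real^'n \<Rightarrow> real"
  assumes \<psi>: "\<psi> \<in> Cc" and \<zeta>: "\<zeta> \<in> Cc"
    and z: "\<And>v. v \<in> Conv \<Longrightarrow> z v = fiber_integral (\<lambda>x y. \<psi> x + \<zeta> x *\<^sub>R y) v"
  shows "continuous_on Conv z \<and> is_valuation z \<and> dually_translation_covariant z
    \<and> vertically_translation_invariant z \<and> dually_simple z"
proof (intro conjI)
  let ?f = "\<lambda>x y. \<psi> x + \<zeta> x *\<^sub>R y"
  have f: "admissible ?f" by (intro admissible_add admissible_Cc \<psi> admissible_Cc_scaleR \<zeta>)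
  show "continuous_on Conv z"
    using fiber_integral_continuous[OF f] by (rule continuous_on_eq) (simp add: z)
  show "is_valuation z"
    using fiber_integral_valuation[OF f] unfolding is_valuation_def by (simp add: z)
  have aff: "z (\<lambda>x. v x + (x \<bullet> a + b)) = z v + fiber_integral (\<lambda>x y. \<zeta> x) v *\<^sub>R a" if v: "v \<in> Conv" for v a b
  proof -
    have split: "fiber_integral ?f u = fiber_integral (\<lambda>x y. \<psi> x) u + fiber_integral (\<lambda>x y. \<zeta> x *\<^sub>R y) u"
      if "u \<in> Conv" for u
      by (intro fiber_integral_sum admissible_Cc \<psi> admissible_Cc_scaleR \<zeta> that)
    have u: "(\<lambda>x. v x + (x \<bullet> a + b)) \<in> Conv" by (intro Conv_add v Conv_affine)
    show ?thesis
      unfolding z[OF u] z[OF v] split[OF u] split[OF v]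
      by (simp add: fiber_integral_add_affine[OF admissible_Cc[OF \<psi>] v] fiber_integral_scaleR_add_affine[OF \<zeta> v])
  qed
  show "dually_translation_covariant z"
    unfolding dually_translation_covariant_def
    using aff[where b=0] by (intro exI[of _ "fiber_integral (\<lambda>x y. \<zeta> x)"]) (simp add: inner_commute)
  show "vertically_translation_invariant z"
    unfolding vertically_translation_invariant_def using aff[where a=0] by simp
  show "dually_simple z" by (rule dually_simple_fiber_integral[OF f z])
qed

lemma integral_representation_exists:
  fixes z :: "(real^'n \<Rightarrow> real) \<Rightarrow> real^'n"
  assumes cont: "continuous_on Conv z" and val: "is_valuation z" and cov: "dually_translation_covariant z"
    and vert: "vertically_translation_invariant z" and simp: "dually_simple z"
  shows "\<exists>(\<psi> :: real^'n \<Rightarrow> real^'n) (\<zeta> :: real^'n \<Rightarrow> real). \<psi> \<in> Cc \<and> \<zeta> \<in> Cc \<and>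
    (\<forall>v\<in>Conv. z v = fiber_integral (\<lambda>x y. \<psi> x + \<zeta> x *\<^sub>R y) v)"
proof -
  obtain z0 where z0: "\<And>v x. v \<in> Conv \<Longrightarrow> z (\<lambda>y. v y + x \<bullet> y) = z v + z0 v *\<^sub>R x"
    using cov unfolding dually_translation_covariant_def by blast
  have aff: "z (\<lambda>x. v x + (x \<bullet> a + b)) = z v + z0 v *\<^sub>R a" if v: "v \<in> Conv" for v a b
  proof -
    have "(\<lambda>y. v y + a \<bullet> y) \<in> Conv"
      using Conv_add[OF v Conv_affine[of a 0]] by (simp add: inner_commute)
    then have "z (\<lambda>y. (v y + a \<bullet> y) + b) = z (\<lambda>y. v y + a \<bullet> y)"
      by (rule vert[unfolded vertically_translation_invariant_def, rule_format])
    then show ?thesis using z0[OF v, of a] by (simp add: inner_commute add.assoc)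
  qed
  define e where "e = (axis undefined 1 :: real^'n)"
  have ee: "e \<bullet> e = 1" by (simp add: e_def inner_axis_axis)
  \<comment> \<open>Covariance merely asserts that some \<open>z0\<close> exists. Recovering it from
    \<open>z\<close> through a fixed unit vector yields its continuity and valuation
    property.\<close>
  define Z0 where "Z0 = (\<lambda>v. (z (\<lambda>x. v x + (x \<bullet> e + 0)) - z v) \<bullet> e)"
  have Z0: "Z0 v = z0 v" if "v \<in> Conv" for v
    unfolding Z0_def aff[OF that] by (simp add: ee)
  interpret Z0: simple_valuation Z0
  proof
    have "continuous_on Conv (\<lambda>v. z (\<lambda>x. v x + (x \<bullet> e + 0)))"
    proof (rule continuous_on_compose2[OF cont])
      show "continuous_on Conv (\<lambda>v x. v x + (x \<bullet> e + 0))"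
        by (intro continuous_on_coordinatewise_then_product continuous_intros
            continuous_on_subset[OF continuous_on_product_coordinates]) auto
    qed (auto intro!: Conv_add Conv_affine simp del: add_0_right)
    then show "continuous_on Conv Z0"
      unfolding Z0_def by (intro continuous_intros cont)
    show "is_valuation Z0"
      unfolding Z0_def
      by (intro is_valuation_additive[where f="\<lambda>x. x \<bullet> e"] inner_add_left is_valuation_diff is_valuation_add_affine val)
    show "Z0 (\<lambda>x. v x + (x \<bullet> a + b)) = Z0 v" if v: "v \<in> Conv" for v a b
    proof -
      have "(\<lambda>x. v x + (x \<bullet> a + b) + (x \<bullet> e + 0)) = (\<lambda>x. v x + (x \<bullet> (a + e) + b))"
        by (simp add: inner_add_right add_ac)
      then show ?thesis unfolding Z0_def by (simp only: aff[OF v]) (simp add: scaleR_add_right)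
    qed
    show "Z0 v = 0" if v: "v \<in> Conv" and a: "a \<noteq> 0" and inv: "\<And>x t. v (x + t *\<^sub>R a) = v x" for v a
    proof -
      have "z v = 0"
        by (rule dually_simple_direction[OF simp v linear_zero a]) (simp add: inv)
      moreover have "z (\<lambda>x. v x + (x \<bullet> e + 0)) = 0"
        by (rule dually_simple_direction[OF simp Conv_add[OF v Conv_affine] bounded_linear.linear[OF bounded_linear_inner_left[of e]] a])
          (simp add: inv)
      ultimately show ?thesis by (simp add: Z0_def)
    qed
  qed
  define \<zeta> where "\<zeta> = Z0.vertex"
  have \<zeta>: "\<zeta> \<in> Cc" unfolding \<zeta>_def by (rule Z0.vertex_Cc)
  have z0_eq: "z0 v = fiber_integral (\<lambda>x y. \<zeta> x) v" if "v \<in> Conv" for v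
    unfolding \<zeta>_def Z0.representation[OF that, symmetric] by (simp add: Z0 that)
  let ?g = "\<lambda>x y :: real^'n. \<zeta> x *\<^sub>R y"
  have g: "admissible ?g" by (rule admissible_Cc_scaleR[OF \<zeta>])
  have g_aff: "fiber_integral ?g (\<lambda>x. v x + (x \<bullet> a + b)) = fiber_integral ?g v + z0 v *\<^sub>R a"
    if "v \<in> Conv" for v a b
    unfolding z0_eq[OF that] by (rule fiber_integral_scaleR_add_affine[OF \<zeta> that])
  \<comment> \<open>Adding a linear function shifts \<open>z\<close> and the \<open>?g\<close>
    integral by the same vector, so the components of the difference are affine invariant.\<close>
  define Y where "Y = (\<lambda>i v. (z v - fiber_integral ?g v) $ i)"
  have Y: "simple_valuation (Y i)" for i
  proof
    show "continuous_on Conv (Y i)"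
      unfolding Y_def by (intro continuous_intros cont fiber_integral_continuous g)
    show "is_valuation (Y i)"
      unfolding Y_def
      by (intro is_valuation_additive[where f="\<lambda>x. x $ i"] vector_add_component is_valuation_diff
          fiber_integral_valuation val g)
    show "Y i (\<lambda>x. v x + (x \<bullet> a + b)) = Y i v" if v: "v \<in> Conv" for v a b
      unfolding Y_def aff[OF v] g_aff[OF v] by simp
    show "Y i v = 0" if v: "v \<in> Conv" and a: "a \<noteq> 0" and inv: "\<And>x t. v (x + t *\<^sub>R a) = v x" for v a
    proof -
      have "z v = 0"
        by (rule dually_simple_direction[OF simp v linear_zero a]) (simp add: inv)
      moreover have "fiber_integral ?g v = 0"
        by (rule fiber_integral_hyperplane[OF g v a, of 0]) (simp add: inv)
      ultimately show ?thesis by (simp add: Y_def)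
    qed
  qed
  define V where "V = (\<lambda>i. simple_valuation.vertex (Y i))"
  have V: "V i \<in> Cc" for i unfolding V_def by (rule simple_valuation.vertex_Cc[OF Y])
  define \<psi> where "\<psi> = (\<lambda>x. \<chi> i. V i x)"
  have \<psi>: "\<psi> \<in> Cc"
  proof -
    have "\<forall>i. \<exists>K. compact K \<and> (\<forall>x. x \<notin> K \<longrightarrow> V i x = 0)" using V by (auto simp: Cc_def)
    then obtain K where K: "\<And>i. compact (K i)" "\<And>i x. x \<notin> K i \<Longrightarrow> V i x = 0" by metis
    have "continuous_on UNIV \<psi>"
      unfolding \<psi>_def using V by (intro continuous_on_vec_lambda) (auto simp: Cc_def)
    moreover have "compact (\<Union>i. K i)" using K(1) by (intro compact_UN) auto
    moreover have "\<psi> x = 0" if "x \<notin> (\<Union>i. K i)" for x using that K(2) by (simp add: \<psi>_def vec_eq_iff)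
    ultimately show ?thesis unfolding Cc_def by blast
  qed
  have "z v = fiber_integral (\<lambda>x y. \<psi> x + \<zeta> x *\<^sub>R y) v" if v: "v \<in> Conv" for v
  proof -
    have "(z v - fiber_integral ?g v) $ i = fiber_integral (\<lambda>x y. \<psi> x) v $ i" for i
    proof -
      have "(z v - fiber_integral ?g v) $ i = fiber_integral (\<lambda>x y. V i x) v"
        using simple_valuation.representation[OF Y v, of i] by (simp only: Y_def V_def)
      also have "(\<lambda>x (y :: real^'n). V i x) = (\<lambda>x y. \<psi> x $ i)" by (simp add: \<psi>_def)
      also have "fiber_integral (\<lambda>x y. \<psi> x $ i) v = fiber_integral (\<lambda>x y. \<psi> x) v $ i"
        by (rule fiber_integral_bounded_linear[OF bounded_linear_vec_nth admissible_Cc[OF \<psi>] v])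
      finally show ?thesis .
    qed
    then have "z v - fiber_integral ?g v = fiber_integral (\<lambda>x y. \<psi> x) v" by (simp add: vec_eq_iff)
    then show ?thesis
      using fiber_integral_sum[OF admissible_Cc[OF \<psi>] g v] by (simp add: algebra_simps)
  qed
  then show ?thesis using \<psi> \<zeta> by blast
qed

lemma integrals_eq_fiber_integral:
  fixes v :: "real^'n \<Rightarrow> real" and \<psi> :: "real^'n \<Rightarrow> real^'n" and \<zeta> :: "real^'n \<Rightarrow> real"
  assumes \<psi>: "\<psi> \<in> Cc" and \<zeta>: "\<zeta> \<in> Cc" and v: "v \<in> Conv"
  shows "integral\<^sup>L (MA v) \<psi> + integral\<^sup>L (Theta0 v) (\<lambda>(x, y). \<zeta> x *\<^sub>R y)
    = fiber_integral (\<lambda>x y. \<psi> x + \<zeta> x *\<^sub>R y) v"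
proof -
  have g: "admissible (\<lambda>x y :: real^'n. \<zeta> x *\<^sub>R y)" by (rule admissible_Cc_scaleR[OF \<zeta>])
  have "integral\<^sup>L (MA v) \<psi> = fiber_integral (\<lambda>x y. \<psi> x) v"
    using integral_MA[OF v, of \<psi>] \<psi> by (simp add: Cc_def fiber_integral_def)
  moreover have "integral\<^sup>L (Theta0 v) (\<lambda>(x, y). \<zeta> x *\<^sub>R y) = fiber_integral (\<lambda>x y. \<zeta> x *\<^sub>R y) v"
    using integral_Theta0[OF v, of "\<lambda>x y. \<zeta> x *\<^sub>R y"] g by (simp add: admissible_def fiber_integral_def)
  ultimately show ?thesis using fiber_integral_sum[OF admissible_Cc[OF \<psi>] g v] by simp
qed

theorem theorem1p4:
  fixes z :: "(real^'n \<Rightarrow> real) \<Rightarrow> real^'n"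
  shows "(continuous_on Conv z \<and> is_valuation z \<and> dually_translation_covariant z
          \<and> vertically_translation_invariant z \<and> dually_simple z)
     \<longleftrightarrow> (\<exists>(\<psi> :: real^'n \<Rightarrow> real^'n) (\<zeta> :: real^'n \<Rightarrow> real). \<psi> \<in> Cc \<and> \<zeta> \<in> Cc \<and>
          (\<forall>v\<in>Conv. z v = integral\<^sup>L (MA v) \<psi>
                 + integral\<^sup>L (Theta0 v) (\<lambda>(x, y). \<zeta> x *\<^sub>R y)))"
proof
  assume "continuous_on Conv z \<and> is_valuation z \<and> dually_translation_covariant z
    \<and> vertically_translation_invariant z \<and> dually_simple z"
  then obtain \<psi> :: "real^'n \<Rightarrow> real^'n" and \<zeta> :: "real^'n \<Rightarrow> real" where *: "\<psi> \<in> Cc" "\<zeta> \<in> Cc"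
    "\<forall>v\<in>Conv. z v = fiber_integral (\<lambda>x y. \<psi> x + \<zeta> x *\<^sub>R y) v"
    using integral_representation_exists[of z] by blast
  then show "\<exists>(\<psi> :: real^'n \<Rightarrow> real^'n) (\<zeta> :: real^'n \<Rightarrow> real). \<psi> \<in> Cc \<and> \<zeta> \<in> Cc \<and>
      (\<forall>v\<in>Conv. z v = integral\<^sup>L (MA v) \<psi> + integral\<^sup>L (Theta0 v) (\<lambda>(x, y). \<zeta> x *\<^sub>R y))"
    using integrals_eq_fiber_integral[OF *(1,2)] by (intro exI[of _ \<psi>] exI[of _ \<zeta>]) simp
next
  assume "\<exists>(\<psi> :: real^'n \<Rightarrow> real^'n) (\<zeta> :: real^'n \<Rightarrow> real). \<psi> \<in> Cc \<and> \<zeta> \<in> Cc \<and>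
      (\<forall>v\<in>Conv. z v = integral\<^sup>L (MA v) \<psi> + integral\<^sup>L (Theta0 v) (\<lambda>(x, y). \<zeta> x *\<^sub>R y))"
  then obtain \<psi> :: "real^'n \<Rightarrow> real^'n" and \<zeta> :: "real^'n \<Rightarrow> real" where *: "\<psi> \<in> Cc" "\<zeta> \<in> Cc"
    "\<forall>v\<in>Conv. z v = integral\<^sup>L (MA v) \<psi> + integral\<^sup>L (Theta0 v) (\<lambda>(x, y). \<zeta> x *\<^sub>R y)" by blast
  then have "z v = fiber_integral (\<lambda>x y. \<psi> x + \<zeta> x *\<^sub>R y) v" if "v \<in> Conv" for v
    using integrals_eq_fiber_integral[OF *(1,2) that] that by simp
  from integral_representation_properties[OF *(1,2) this]
  show "continuous_on Conv z \<and> is_valuation z \<and> dually_translation_covariant z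
    \<and> vertically_translation_invariant z \<and> dually_simple z" by blast
qed

end
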